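(* For each dimension $d$ let $\kappa_d>0$ and consider hyperbolic space $\mathbb H^d_{-\kappa_d^2}$ of constant curvature $-\kappa_d^2$ with geodesic distance $\mathsf d_{\mathbb H}$. Let $P_d$ be the law of the random point with geodesic polar coordinates $(R_d,U_d)$ about a fixed origin, where $U_d\sim\operatorname{Unif}(S^{d-1})$, $R_d$ is independent of $U_d$, $R_d>0$ almost surely, $\rho_d=\mathbb E R_d$, $\epsilon_d=\operatorname{sd}(R_d)>0$, and $\xi_d=(R_d-\rho_d)/\epsilon_d$. Assume that, as $d\to\infty$, $\xi_d\Rightarrow\Xi$ in distribution, with $F=\mathcal L(\Xi)$, and that $$b_d=\kappa_d\epsilon_d\coth(\kappa_d\rho_d)\to0 .$$ Put $\lambda_{d,\mathbb H}=\sqrt d\,b_d=\sqrt d\,\kappa_d\epsilon_d\coth(\kappa_d\rho_d)$. Then: (1) if $\lambda_{d,\mathbb H}\to0$, then $H_3(P_d,\mathsf d_{\mathbb H})\to\log3$; (2) if $\lambda_{d,\mathbb H}\to\lambda\in(0,\infty)$, then $H_3(P_d,\mathsf d_{\mathbb H})\to H_\infty(\lambda;F)$; (3) if $\lambda_{d,\mathbb H}\to\infty$ and $F$ is continuous (i.e. has a continuous distribution function), then $H_3(P_d,\mathsf d_{\mathbb H})\to0$.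
   Context: Hyperbolic distance in polar coordinates. For points with geodesic polar coordinates $(r,u)$ and $(r',u')$ in $\mathbb H^d_{-\kappa^2}$ ($r,r'>0$, $u,u'\in S^{d-1}$), the distance $D$ satisfies $\cosh(\kappa D)=\cosh(\kappa r)\cosh(\kappa r')-\sinh(\kappa r)\sinh(\kappa r')\langle u,u'\rangle$. Farthest-cell triplet entropy. Let $(\mathcal X,\mathsf d,P)$ be a metric probability space. Draw a query $X\sim P$ and a prototype triple $V=(V_1,V_2,V_3)\sim P^3$ independently. For fixed $v=(v_1,v_2,v_3)$ let $L_v(X)\in\arg\max_{1\le i\le3}\mathsf d(X,v_i)$ be the farthest-prototype label, with independent uniform randomization among exact ties. Put $q_i(v)=\mathbb P\{L_V(X)=i\mid V=v\}$, $q(v)=(q_1(v),q_2(v),q_3(v))$, and for a probability vector $q$ let $h(q)=-\sum_{i=1}^3q_i\log q_i$ (natural logarithm, $0\log0=0$). Then $H_3(P,\mathsf d)=\mathbb E_V\,h\{q(V)\}$. Master entropy curve. Let $\Xi_1,\Xi_2,\Xi_3$ be i.i.d. with law $F$ and $Z_1,Z_2,Z_3$ be i.i.d. $N(0,1)$, the two triples being independent. For deterministic $w=(w_1,w_2,w_3)\in\mathbb R^3$ and $\lambda\ge0$ define $$q_i^\lambda(w)=\mathbb P\Bigl(\lambda w_i-Z_i=\max_{1\le j\le3}\{\lambda w_j-Z_j\}\Bigr),\qquad i=1,2,3,$$ $q^\lambda(w)=(q_1^\lambda(w),q_2^\lambda(w),q_3^\lambda(w))$, and $$H_\infty(\lambda;F)=\mathbb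 E\bigl[h\{q^\lambda(\Xi_1,\Xi_2,\Xi_3)\}\bigr].$$ *)

theory Defs
  imports "HOL-Probability.Probability"
begin

text \<open>
  The dimension varies along a sequence, so a vector of $R^d$ is an extensional function on
  the index set \<open>{1..d}\<close>, and a vector of $R^{1+d}$ one on \<open>{0..d}\<close>.
\<close>

definition dot :: "nat \<Rightarrow> (nat \<Rightarrow> real) \<Rightarrow> (nat \<Rightarrow> real) \<Rightarrow> real" where
  "dot d x y = (\<Sum>i\<in>{1..d}. x i * y i)"

definition enorm :: "nat \<Rightarrow> (nat \<Rightarrow> real) \<Rightarrow> real" where
  "enorm d x = sqrt (dot d x x)"


subsection \<open>The uniform distribution on the unit sphere\<close>

definition unit_sphere :: "nat \<Rightarrow> (nat \<Rightarrow> real) set" where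
  "unit_sphere d = {u \<in> {1..d} \<rightarrow>\<^sub>E UNIV. enorm d u = 1}"

definition sphere_borel :: "nat \<Rightarrow> (nat \<Rightarrow> real) measure" where
  "sphere_borel d = restrict_space (Pi\<^sub>M {1..d} (\<lambda>_. borel)) (unit_sphere d)"

definition punctured_ball :: "nat \<Rightarrow> (nat \<Rightarrow> real) set" where
  "punctured_ball d = {x \<in> {1..d} \<rightarrow>\<^sub>E UNIV. 0 < enorm d x \<and> enorm d x \<le> 1}"

definition normalize_vec :: "nat \<Rightarrow> (nat \<Rightarrow> real) \<Rightarrow> (nat \<Rightarrow> real)" where
  "normalize_vec d x = (\<lambda>i\<in>{1..d}. x i / enorm d x)"

text \<open>
  Normalized surface measure: the mass of a Borel set $A$ of the sphere is the Lebesgue volume of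
  the cone $\{t u : 0 < t \le 1, u \in A\}$ divided by the volume of the unit ball. The origin is
  removed, a null set for $d \ge 1$, so that radial projection is defined everywhere.
\<close>

definition uniform_sphere :: "nat \<Rightarrow> (nat \<Rightarrow> real) measure" where
  "uniform_sphere d =
     distr (restrict_space
              (uniform_measure (Pi\<^sub>M {1..d} (\<lambda>_. lborel)) (punctured_ball d)) (punctured_ball d))
           (sphere_borel d) (normalize_vec d)"


subsection \<open>Hyperbolic space of curvature $-\kappa^2$\<close>

text \<open>
  The hyperboloid model: the upper sheet of $x_0^2 - x_1^2 - \dots - x_d^2 = 1/\kappa^2$ with the
  Riemannian metric induced by the Lorentz form, whose geodesic distance is
  $\kappa^{-1} \mathrm{arcosh}(\kappa^2 (x_0 y_0 - x_1 y_1 - \dots - x_d y_d))$.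
\<close>

definition hyperboloid :: "nat \<Rightarrow> real \<Rightarrow> (nat \<Rightarrow> real) set" where
  "hyperboloid d \<kappa> = {x \<in> {0..d} \<rightarrow>\<^sub>E UNIV. 0 < x 0 \<and> (x 0)\<^sup>2 - dot d x x = 1 / \<kappa>\<^sup>2}"

definition hyperboloid_borel :: "nat \<Rightarrow> real \<Rightarrow> (nat \<Rightarrow> real) measure" where
  "hyperboloid_borel d \<kappa> = restrict_space (Pi\<^sub>M {0..d} (\<lambda>_. borel)) (hyperboloid d \<kappa>)"

definition hyp_dist :: "nat \<Rightarrow> real \<Rightarrow> (nat \<Rightarrow> real) \<Rightarrow> (nat \<Rightarrow> real) \<Rightarrow> real" where
  "hyp_dist d \<kappa> x y = arcosh (\<kappa>\<^sup>2 * (x 0 * y 0 - dot d x y)) / \<kappa>"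

definition hyp_origin :: "nat \<Rightarrow> real \<Rightarrow> (nat \<Rightarrow> real)" where
  "hyp_origin d \<kappa> = (\<lambda>i\<in>{0..d}. if i = 0 then 1 / \<kappa> else 0)"

text \<open>
  The point with geodesic polar coordinates $(r,u)$ about the origin: the exponential map at the
  origin applied to $r u$.
\<close>

definition hyp_polar :: "nat \<Rightarrow> real \<Rightarrow> real \<Rightarrow> (nat \<Rightarrow> real) \<Rightarrow> (nat \<Rightarrow> real)" where
  "hyp_polar d \<kappa> r u =
     (\<lambda>i\<in>{0..d}. if i = 0 then cosh (\<kappa> * r) / \<kappa> else sinh (\<kappa> * r) / \<kappa> * u i)"

definition hyp_polar_law ::
  "nat \<Rightarrow> real \<Rightarrow> 'w measure \<Rightarrow> ('w \<Rightarrow> real) \<Rightarrow> ('w \<Rightarrow> nat \<Rightarrow> real) \<Rightarrow> (nat \<Rightarrow> real) measure" where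
  "hyp_polar_law d \<kappa> M R U =
     distr M (hyperboloid_borel d \<kappa>) (\<lambda>\<omega>. hyp_polar d \<kappa> (R \<omega>) (U \<omega>))"

definition coth :: "real \<Rightarrow> real" where
  "coth x = cosh x / sinh x"


subsection \<open>Random variables\<close>

text \<open>
  The library's \<open>indep_var\<close> forces both variables into the same type; this is the same condition
  for variables of different types.
\<close>

definition indep_rv ::
  "'w measure \<Rightarrow> 'a measure \<Rightarrow> ('w \<Rightarrow> 'a) \<Rightarrow> 'b measure \<Rightarrow> ('w \<Rightarrow> 'b) \<Rightarrow> bool" where
  "indep_rv M S X T Y \<longleftrightarrow>
     X \<in> measurable M S \<and> Y \<in> measurable M T \<and>
     prob_space.indep_set M {X -` A \<inter> space M | A. A \<in> sets S} {Y -` B \<inter> space M | B. B \<in> sets T}"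

definition stddev :: "'w measure \<Rightarrow> ('w \<Rightarrow> real) \<Rightarrow> real" where
  "stddev M X = sqrt (prob_space.variance M X)"


subsection \<open>Farthest-cell triplet entropy\<close>

definition entropy3 :: "(nat \<Rightarrow> real) \<Rightarrow> real" where
  "entropy3 q = - (\<Sum>i\<in>{1..3}. q i * ln (q i))"

definition farthest :: "('a \<Rightarrow> 'a \<Rightarrow> real) \<Rightarrow> (nat \<Rightarrow> 'a) \<Rightarrow> 'a \<Rightarrow> nat set" where
  "farthest D v x = {i \<in> {1..3}. \<forall>j\<in>{1..3}. D x (v j) \<le> D x (v i)}"

text \<open>
  Given the query \<open>x\<close>, the label is uniform on the set of farthest prototypes; averaging over the
  query gives the cell probabilities.
\<close>

definition cell_prob :: "'a measure \<Rightarrow> ('a \<Rightarrow> 'a \<Rightarrow> real) \<Rightarrow> (nat \<Rightarrow> 'a) \<Rightarrow> nat \<Rightarrow> real" where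
  "cell_prob P D v i = (\<integral>x. pmf (pmf_of_set (farthest D v x)) i \<partial>P)"

definition triplet_entropy :: "'a measure \<Rightarrow> ('a \<Rightarrow> 'a \<Rightarrow> real) \<Rightarrow> real" where
  "triplet_entropy P D = (\<integral>v. entropy3 (cell_prob P D v) \<partial>(Pi\<^sub>M {1..3} (\<lambda>_. P)))"


subsection \<open>Master entropy curve\<close>

definition master_prob :: "real \<Rightarrow> (nat \<Rightarrow> real) \<Rightarrow> nat \<Rightarrow> real" where
  "master_prob l w i =
     (let N = Pi\<^sub>M {1..3} (\<lambda>_. std_normal_distribution)
      in measure N {z \<in> space N. l * w i - z i = Max ((\<lambda>j. l * w j - z j) ` {1..3})})"

definition master_entropy :: "real \<Rightarrow> real measure \<Rightarrow> real" where
  "master_entropy l F = (\<integral>w. entropy3 (master_prob l w) \<partial>(Pi\<^sub>M {1..3} (\<lambda>_. F)))"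


subsection \<open>Basic facts on the sphere and the hyperboloid\<close>

lemma enorm_nonneg: "0 \<le> enorm d x"
  by (simp add: enorm_def dot_def sum_nonneg)

lemma enorm_power2: "(enorm d x)\<^sup>2 = dot d x x"
  by (simp add: enorm_def dot_def sum_nonneg)

lemma dot_self_unit_sphere: "u \<in> unit_sphere d \<Longrightarrow> dot d u u = 1"
  using enorm_power2[of d u] by (simp add: unit_sphere_def)

lemma normalize_vec_in_sphere:
  assumes "0 < enorm d x"
  shows "normalize_vec d x \<in> unit_sphere d"
proof -
  have "dot d (normalize_vec d x) (normalize_vec d x) = (\<Sum>i\<in>{1..d}. x i * x i / (enorm d x)\<^sup>2)"
    unfolding dot_def normalize_vec_def by (intro sum.cong) (auto simp: power2_eq_square)
  also have "\<dots> = dot d x x / (enorm d x)\<^sup>2"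
    by (simp add: dot_def sum_divide_distrib)
  also have "\<dots> = 1"
    using assms by (simp flip: enorm_power2)
  finally show ?thesis
    by (simp add: unit_sphere_def enorm_def normalize_vec_def)
qed

lemma dot_measurable [measurable]:
  "(\<lambda>x. dot d x x) \<in> borel_measurable (Pi\<^sub>M {1..d} (\<lambda>_. borel))"
  unfolding dot_def by measurable

lemma enorm_measurable [measurable]: "enorm d \<in> borel_measurable (Pi\<^sub>M {1..d} (\<lambda>_. borel))"
  unfolding enorm_def by measurable

lemma sets_PiM_lborel: "sets (Pi\<^sub>M I (\<lambda>_. lborel)) = sets (Pi\<^sub>M I (\<lambda>_. borel :: real measure))"
  by (intro sets_PiM_cong) auto

lemma punctured_ball_sets: "punctured_ball d \<in> sets (Pi\<^sub>M {1..d} (\<lambda>_. lborel))"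
proof -
  have "punctured_ball d =
      {x \<in> space (Pi\<^sub>M {1..d} (\<lambda>_. borel)). 0 < enorm d x \<and> enorm d x \<le> 1}"
    by (auto simp: punctured_ball_def space_PiM)
  also have "\<dots> \<in> sets (Pi\<^sub>M {1..d} (\<lambda>_. borel))"
    by measurable
  finally show ?thesis
    by (simp add: sets_PiM_lborel)
qed

lemma normalize_vec_measurable:
  "normalize_vec d \<in> measurable
     (restrict_space (uniform_measure (Pi\<^sub>M {1..d} (\<lambda>_. lborel)) (punctured_ball d)) (punctured_ball d))
     (sphere_borel d)"
  unfolding sphere_borel_def
proof (rule measurable_restrict_space2)
  show "normalize_vec d \<in> space (restrict_space (uniform_measure (Pi\<^sub>M {1..d} (\<lambda>_. lborel))
      (punctured_ball d)) (punctured_ball d)) \<rightarrow> unit_sphere d"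
    by (auto simp: space_restrict_space punctured_ball_def intro: normalize_vec_in_sphere)
  have "normalize_vec d \<in> measurable (Pi\<^sub>M {1..d} (\<lambda>_. borel)) (Pi\<^sub>M {1..d} (\<lambda>_. borel))"
    unfolding normalize_vec_def by measurable
  then have "normalize_vec d \<in> measurable
      (uniform_measure (Pi\<^sub>M {1..d} (\<lambda>_. lborel)) (punctured_ball d)) (Pi\<^sub>M {1..d} (\<lambda>_. borel))"
    by (subst measurable_cong_sets[where N = "Pi\<^sub>M {1..d} (\<lambda>_. borel)"
          and M' = "Pi\<^sub>M {1..d} (\<lambda>_. borel)"]) (auto simp: sets_PiM_lborel)
  then show "normalize_vec d \<in> measurable (restrict_space (uniform_measure
      (Pi\<^sub>M {1..d} (\<lambda>_. lborel)) (punctured_ball d)) (punctured_ball d)) (Pi\<^sub>M {1..d} (\<lambda>_. borel))"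
    by (rule measurable_restrict_space1)
qed

lemma emeasure_punctured_ball:
  assumes "1 \<le> d"
  shows "emeasure (Pi\<^sub>M {1..d} (\<lambda>_. lborel)) (punctured_ball d) \<noteq> 0"
    and "emeasure (Pi\<^sub>M {1..d} (\<lambda>_. lborel)) (punctured_ball d) \<noteq> \<infinity>"
proof -
  interpret product_sigma_finite "\<lambda>_. lborel :: real measure"
    by standard
  let ?L = "Pi\<^sub>M {1..d} (\<lambda>_. lborel :: real measure)"
  let ?A = "{1..d} \<rightarrow>\<^sub>E {0<..<1 / real d}" and ?B = "{1..d} \<rightarrow>\<^sub>E {-1..1::real}"
  have "?A \<subseteq> punctured_ball d"
  proof
    fix x assume x: "x \<in> ?A"
    then have xi: "0 < x i" "x i < 1 / real d" if "i \<in> {1..d}" for i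
      using that by (auto simp: PiE_def Pi_def)
    have "0 < dot d x x"
      unfolding dot_def using xi assms by (intro sum_pos) auto
    moreover have "dot d x x \<le> (\<Sum>i\<in>{1..d}. 1 / real d)"
      unfolding dot_def
    proof (rule sum_mono)
      fix i assume i: "i \<in> {1..d}"
      have "1 / real d \<le> 1" using assms by simp
      then have "x i * x i \<le> (1 / real d) * 1"
        using xi[OF i] by (intro mult_mono) auto
      then show "x i * x i \<le> 1 / real d" by simp
    qed
    ultimately show "x \<in> punctured_ball d"
      using x assms by (auto simp: punctured_ball_def enorm_def)
  qed
  then have "emeasure ?L ?A \<le> emeasure ?L (punctured_ball d)"
    by (intro emeasure_mono punctured_ball_sets)
  moreover have "emeasure ?L ?A = ennreal (1 / real d) ^ d"
    by (subst emeasure_PiM) auto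
  ultimately show "emeasure ?L (punctured_ball d) \<noteq> 0"
    using assms by (auto simp: ennreal_power)
  have "punctured_ball d \<subseteq> ?B"
  proof
    fix x assume x: "x \<in> punctured_ball d"
    have "x i \<in> {-1..1}" if i: "i \<in> {1..d}" for i
    proof -
      have "(x i)\<^sup>2 \<le> dot d x x"
        unfolding dot_def power2_eq_square by (rule member_le_sum[OF i]) auto
      also have "\<dots> \<le> 1"
        using x by (auto simp: punctured_ball_def enorm_def)
      finally show ?thesis
        by (simp add: abs_square_le_1 abs_le_iff)
    qed
    then show "x \<in> ?B"
      using x by (auto simp: punctured_ball_def PiE_def)
  qed
  then have "emeasure ?L (punctured_ball d) \<le> emeasure ?L ?B"
    by (intro emeasure_mono sets_PiM_I_finite) auto
  also have "\<dots> = ennreal 2 ^ d"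
    by (subst emeasure_PiM) auto
  also have "\<dots> < \<infinity>"
    unfolding ennreal_power[OF zero_le_numeral] by simp
  finally show "emeasure ?L (punctured_ball d) \<noteq> \<infinity>"
    by simp
qed

lemma prob_space_uniform_sphere:
  assumes "1 \<le> d"
  shows "prob_space (uniform_sphere d)"
proof -
  let ?L = "Pi\<^sub>M {1..d} (\<lambda>_. lborel :: real measure)"
  let ?U = "uniform_measure ?L (punctured_ball d)"
  have "emeasure ?U (punctured_ball d) = 1"
    using emeasure_punctured_ball[OF assms] punctured_ball_sets[of d]
    by (simp add: emeasure_uniform_measure top.not_eq_extremum)
  moreover have "punctured_ball d \<inter> space ?U = punctured_ball d"
    using sets.sets_into_space[OF punctured_ball_sets[of d]] by auto
  ultimately have "prob_space (restrict_space ?U (punctured_ball d))"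
    using punctured_ball_sets[of d]
    by (intro prob_spaceI) (simp add: space_restrict_space emeasure_restrict_space)
  then show ?thesis
    unfolding uniform_sphere_def by (rule prob_space.prob_space_distr[OF _ normalize_vec_measurable])
qed

lemma dot_hyp_polar:
  "dot d (hyp_polar d \<kappa> r u) (hyp_polar d \<kappa> r' u') =
     sinh (\<kappa> * r) * sinh (\<kappa> * r') / \<kappa>\<^sup>2 * dot d u u'"
  unfolding dot_def sum_distrib_left
  by (intro sum.cong) (auto simp: hyp_polar_def power2_eq_square)

lemma hyp_polar_in_hyperboloid:
  assumes "0 < \<kappa>" "u \<in> unit_sphere d"
  shows "hyp_polar d \<kappa> r u \<in> hyperboloid d \<kappa>"
proof -
  have "(cosh (\<kappa> * r))\<^sup>2 - sinh (\<kappa> * r) * sinh (\<kappa> * r) = 1"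
    using hyperbolic_pythagoras[of "\<kappa> * r"] by (simp add: power2_eq_square)
  then have "(hyp_polar d \<kappa> r u 0)\<^sup>2 - dot d (hyp_polar d \<kappa> r u) (hyp_polar d \<kappa> r u) = 1 / \<kappa>\<^sup>2"
    using assms
    by (simp add: dot_hyp_polar dot_self_unit_sphere)
       (simp add: hyp_polar_def power_divide flip: diff_divide_distrib)
  moreover have "0 < hyp_polar d \<kappa> r u 0"
    using assms by (simp add: hyp_polar_def)
  ultimately show ?thesis
    by (simp add: hyperboloid_def) (simp add: hyp_polar_def)
qed

lemma hyp_dist_polar:
  assumes "0 < \<kappa>"
  shows "hyp_dist d \<kappa> (hyp_polar d \<kappa> r u) (hyp_polar d \<kappa> r' u') =
    arcosh (cosh (\<kappa> * r) * cosh (\<kappa> * r') - sinh (\<kappa> * r) * sinh (\<kappa> * r') * dot d u u') / \<kappa>"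
proof -
  have "hyp_polar d \<kappa> r u 0 = cosh (\<kappa> * r) / \<kappa>" "hyp_polar d \<kappa> r' u' 0 = cosh (\<kappa> * r') / \<kappa>"
    by (simp_all add: hyp_polar_def)
  then show ?thesis
    using assms unfolding hyp_dist_def dot_hyp_polar
    by (simp add: power2_eq_square right_diff_distrib)
qed

lemma hyperbolic_law_of_cosines:
  assumes "0 < \<kappa>" "0 \<le> r" "0 \<le> r'" "u \<in> unit_sphere d" "u' \<in> unit_sphere d"
  shows "cosh (\<kappa> * hyp_dist d \<kappa> (hyp_polar d \<kappa> r u) (hyp_polar d \<kappa> r' u')) =
    cosh (\<kappa> * r) * cosh (\<kappa> * r') - sinh (\<kappa> * r) * sinh (\<kappa> * r') * dot d u u'"
proof -
  have "(dot d u u')\<^sup>2 \<le> dot d u u * dot d u' u'"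
    using Cauchy_Schwarz_ineq_sum[of u u' "{1..d}"] by (simp add: dot_def power2_eq_square)
  then have "(dot d u u')\<^sup>2 \<le> 1"
    using assms by (simp add: dot_self_unit_sphere)
  then have "dot d u u' \<le> 1"
    by (simp add: abs_square_le_1 abs_le_iff)
  moreover have "0 \<le> sinh (\<kappa> * r) * sinh (\<kappa> * r')"
    using assms by simp
  ultimately have "sinh (\<kappa> * r) * sinh (\<kappa> * r') * dot d u u' \<le> sinh (\<kappa> * r) * sinh (\<kappa> * r')"
    using mult_left_le by blast
  moreover have "1 \<le> cosh (\<kappa> * r) * cosh (\<kappa> * r') - sinh (\<kappa> * r) * sinh (\<kappa> * r')"
    using cosh_real_ge_1[of "\<kappa> * r - \<kappa> * r'"] by (simp add: cosh_diff)
  ultimately have "1 \<le> cosh (\<kappa> * r) * cosh (\<kappa> * r') - sinh (\<kappa> * r) * sinh (\<kappa> * r') * dot d u u'"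
    by linarith
  then show ?thesis
    using assms by (simp add: hyp_dist_polar)
qed

lemma hyp_dist_origin_polar:
  assumes "0 < \<kappa>" "0 \<le> r"
  shows "hyp_dist d \<kappa> (hyp_origin d \<kappa>) (hyp_polar d \<kappa> r u) = r"
proof -
  have "hyp_origin d \<kappa> = hyp_polar d \<kappa> 0 u"
    by (auto simp: hyp_origin_def hyp_polar_def)
  then show ?thesis
    using assms by (simp add: hyp_dist_polar arcosh_cosh_real)
qed

end

theory Submission
  imports Defs
begin

text \<open>
  In the hyperbolic law of cosines for a query and a prototype, with radii written as
  $\rho_d + \epsilon_d w$, both sides can be divided by $\sinh$ of the query radius and by $\sinh$ of the
  mean radius. Up to a term that does not depend on the prototype, this turns $\cosh(\kappa_d D)$ into
  $b_d w_i - \langle U_0, U_i\rangle$, to leading order. The angular part has size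
  $d^{-1/2}$, so after multiplication by $\sqrt d$ the farthest prototype is the maximizer of
  $\Lambda_d w_i - Z_i$ with asymptotically standard normal $Z_i$. If $\Lambda_d$ has a finite limit, both
  parts persist; if $\Lambda_d$ diverges, division by $\Lambda_d$ leaves the radii alone, and the label
  becomes deterministic unless radii tie. The vanishing of $b_d$ is what kills the second-order radial terms.

  The entropy is an average over the prototypes of a function of the conditional cell probabilities, so
  the convergence has to hold conditionally on the prototypes. The radial deviations are realized by
  Skorohod's theorem as pointwise convergent functions, which can then be frozen. The prototype
  directions live on spheres of growing dimension and do not converge, but with probability tending to one
  they are almost orthogonal (\<open>near_orthogonal_prob_tendsto\<close>), and for almost orthogonal directions the cell
  probabilities have a limit (\<open>query_label_prob_tendsto\<close>). The two are combined by
  \<open>integral_tendsto_of_selections\<close> and dominated convergence in \<open>triplet_entropy_tendsto\<close>.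

  The conditional limit rests on a Gaussian representation. The direction of a standard Gaussian vector is
  uniform on the sphere (\<open>uniform_sphere_eq_direction\<close>). Almost orthogonal prototype directions are moved to an
  orthonormal frame (\<open>gram_schmidt3\<close>), along which the coordinates of the Gaussian vector are independent
  standard normal (\<open>distr_gaussian_orthonormal\<close>, from Kac's theorem \<open>char_factor_imp_distr_PiM\<close>), and the norm of
  the Gaussian vector concentrates at $\sqrt d$. Thus the scores are close in probability to scores whose law
  does not depend on the dimension, and the label probabilities follow since that law has no ties
  (\<open>argmax_prob_tendsto\<close>).
\<close>

section \<open>Limits, selections and product measures\<close>

lemma tendsto_cong_from_1:
  fixes f g :: "nat \<Rightarrow> 'a :: topological_space"
  assumes "f \<longlonglongrightarrow> l" "\<And>d. 1 \<le> d \<Longrightarrow> f d = g d"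
  shows "g \<longlonglongrightarrow> l"
  by (rule Lim_transform_eventually[OF assms(1) eventually_mono[OF eventually_ge_at_top[of 1] assms(2)]])

lemma pointwise_limit_imp_in_probability:
  fixes f :: "nat \<Rightarrow> 'a \<Rightarrow> real"
  assumes "prob_space M" and f: "\<And>d. 1 \<le> d \<Longrightarrow> f d \<in> borel_measurable M"
    and lim: "\<And>\<omega>. \<omega> \<in> space M \<Longrightarrow> (\<lambda>d. f d \<omega>) \<longlonglongrightarrow> x" and \<eta>: "0 < \<eta>"
  shows "(\<lambda>d. measure M {\<omega> \<in> space M. \<eta> \<le> \<bar>f d \<omega> - x\<bar>}) \<longlonglongrightarrow> 0"
proof -
  interpret prob_space M by fact
  let ?g = "\<lambda>d. if 1 \<le> d then f d else (\<lambda>_. x)"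
  let ?A = "\<lambda>d. {\<omega> \<in> space M. \<eta> \<le> \<bar>?g d \<omega> - x\<bar>}"
  have [measurable]: "?g d \<in> borel_measurable M" for d using f by auto
  have sets: "?A d \<in> sets M" for d by measurable
  have "(\<lambda>d. \<integral>\<omega>. indicator (?A d) \<omega> \<partial>M) \<longlonglongrightarrow> (\<integral>\<omega>. 0 \<partial>M :: real)"
  proof (rule integral_dominated_convergence[where w="\<lambda>_. 1"])
    show "AE \<omega> in M. (\<lambda>d. indicator (?A d) \<omega>) \<longlonglongrightarrow> (0 :: real)"
    proof (rule AE_I2)
      fix \<omega> assume "\<omega> \<in> space M"
      from tendstoD[OF lim[OF this] \<eta>] have "\<forall>\<^sub>F d in sequentially. indicator (?A d) \<omega> = (0 :: real)"
        by eventually_elim (use \<eta> in \<open>auto simp: dist_real_def indicator_def\<close>)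
      then show "(\<lambda>d. indicator (?A d) \<omega>) \<longlonglongrightarrow> (0 :: real)" by (rule tendsto_eventually)
    qed
  qed (use sets in \<open>auto simp: indicator_def\<close>)
  then have "(\<lambda>d. measure M (?A d)) \<longlonglongrightarrow> 0"
    using sets by simp
  then show ?thesis
    by (rule tendsto_cong_from_1) simp
qed

text \<open>
  Uniformity from sequences: if \<open>f d\<close> converges to \<open>l\<close> along every choice of points of \<open>K d\<close>, then it
  does so uniformly on \<open>K d\<close>, since otherwise a sequence of violating points would contradict the
  hypothesis. What happens outside \<open>K d\<close> has vanishing weight. This lets random directions be
  replaced by arbitrary deterministic ones that are almost orthogonal.
\<close>

lemma integral_tendsto_of_selections:
  fixes f :: "nat \<Rightarrow> 'a \<Rightarrow> real"
  assumes N: "\<And>d. 1 \<le> d \<Longrightarrow> prob_space (N d)"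
    and f: "\<And>d. 1 \<le> d \<Longrightarrow> f d \<in> borel_measurable (N d)"
    and bound: "\<And>d x. 1 \<le> d \<Longrightarrow> x \<in> space (N d) \<Longrightarrow> \<bar>f d x\<bar> \<le> B"
    and K: "\<And>d. 1 \<le> d \<Longrightarrow> K d \<in> sets (N d)"
    and K_lim: "(\<lambda>d. measure (N d) (K d)) \<longlonglongrightarrow> 1"
    and selection: "\<And>x. (\<And>d. 1 \<le> d \<Longrightarrow> x d \<in> space (N d)) \<Longrightarrow> \<forall>\<^sub>F d in sequentially. x d \<in> K d \<Longrightarrow> (\<lambda>d. f d (x d)) \<longlonglongrightarrow> l"
  shows "(\<lambda>d. \<integral>x. f d x \<partial>N d) \<longlonglongrightarrow> l"
proof (rule tendstoI)
  fix r :: real assume r: "0 < r"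
  define bad where "bad d x \<longleftrightarrow> x \<in> K d \<and> r / 2 \<le> \<bar>f d x - l\<bar>" for d x
  define x where "x d = (if \<exists>y. bad d y then SOME y. bad d y else if K d \<noteq> {} then SOME y. y \<in> K d else SOME y. y \<in> space (N d))" for d
  have x_bad: "bad d (x d)" if "bad d y" for d y
    using that someI_ex[of "bad d"] unfolding x_def by auto
  have x_K: "x d \<in> K d" if "K d \<noteq> {}" for d
  proof (cases "\<exists>y. bad d y")
    case True
    then show ?thesis using x_bad by (auto simp: bad_def)
  next
    case False
    then have "x d = (SOME y. y \<in> K d)" using that by (simp add: x_def)
    then show ?thesis using that by (simp add: some_in_eq)
  qed
  have x_space: "x d \<in> space (N d)" if d: "1 \<le> d" for d
  proof (cases "K d = {}")
    case True
    then have "x d = (SOME y. y \<in> space (N d))" by (simp add: x_def bad_def)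
    then show ?thesis using prob_space.not_empty[OF N[OF d]] by (simp add: some_in_eq)
  next
    case False
    then show ?thesis using x_K sets.sets_into_space[OF K[OF d]] by auto
  qed
  have "\<forall>\<^sub>F d in sequentially. 0 < measure (N d) (K d)"
    using order_tendstoD(1)[OF K_lim, of 0] by simp
  then have "\<forall>\<^sub>F d in sequentially. x d \<in> K d"
    by eventually_elim (auto intro!: x_K)
  then have "(\<lambda>d. f d (x d)) \<longlonglongrightarrow> l" using x_space by (intro selection)
  then have "\<forall>\<^sub>F d in sequentially. dist (f d (x d)) l < r / 2"
    using r by (intro tendstoD) auto
  then have no_bad: "\<forall>\<^sub>F d in sequentially. \<forall>y\<in>K d. \<bar>f d y - l\<bar> < r / 2"
  proof eventually_elim
    case (elim d)
    show ?case
    proof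
      fix y assume y: "y \<in> K d"
      show "\<bar>f d y - l\<bar> < r / 2"
      proof (rule ccontr)
        assume "\<not> \<bar>f d y - l\<bar> < r / 2"
        then have "bad d (x d)" using y by (intro x_bad[of d y]) (simp add: bad_def)
        then show False using elim by (simp add: bad_def dist_real_def)
      qed
    qed
  qed
  define C where "C = \<bar>B\<bar> + \<bar>l\<bar> + 1"
  have C: "0 < C" by (simp add: C_def add_nonneg_pos)
  have "\<forall>\<^sub>F d in sequentially. 1 - r / (2 * C) < measure (N d) (K d)"
    using r C by (intro order_tendstoD(1)[OF K_lim]) simp
  with no_bad show "\<forall>\<^sub>F d in sequentially. dist (\<integral>x. f d x \<partial>N d) l < r"
    using eventually_ge_at_top[of 1]
  proof eventually_elim
    case (elim d)
    interpret N: prob_space "N d" by (rule N[OF elim(3)])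
    have [measurable]: "f d \<in> borel_measurable (N d)" "K d \<in> sets (N d)" using f K elim(3) by auto
    have int: "integrable (N d) (f d)"
      by (rule N.integrable_const_bound[of _ B]) (use bound[OF elim(3)] in auto)
    have "\<bar>(\<integral>x. f d x \<partial>N d) - l\<bar> = \<bar>\<integral>x. f d x - l \<partial>N d\<bar>"
      using int by (simp add: N.prob_space)
    also have "\<dots> \<le> (\<integral>x. \<bar>f d x - l\<bar> \<partial>N d)" by (rule integral_abs_bound)
    also have "\<dots> \<le> (\<integral>x. r / 2 + C * indicator (space (N d) - K d) x \<partial>N d)"
    proof (rule integral_mono)
      show "integrable (N d) (\<lambda>x. \<bar>f d x - l\<bar>)" using int by auto
      show "integrable (N d) (\<lambda>x. r / 2 + C * indicator (space (N d) - K d) x)"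
        by (rule N.integrable_const_bound[of _ "r / 2 + C"]) (use r C in \<open>auto simp: indicator_def\<close>)
      fix x assume x: "x \<in> space (N d)"
      show "\<bar>f d x - l\<bar> \<le> r / 2 + C * indicator (space (N d) - K d) x"
      proof (cases "x \<in> K d")
        case True
        then have "\<bar>f d x - l\<bar> < r / 2" using elim(1) by blast
        then show ?thesis using True by simp
      next
        case False
        then show ?thesis using x bound[OF elim(3) x] r by (simp add: C_def)
      qed
    qed
    also have "\<dots> = r / 2 + C * measure (N d) (space (N d) - K d)"
    proof -
      have "integrable (N d) (indicator (space (N d) - K d) :: _ \<Rightarrow> real)"
        by (rule N.integrable_const_bound[of _ 1]) (auto simp: indicator_def)
      then show ?thesis by (simp add: N.prob_space Int_absorb1)
    qed
    also have "measure (N d) (space (N d) - K d) = 1 - measure (N d) (K d)"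
      by (rule N.prob_compl) simp
    also have "r / 2 + C * (1 - measure (N d) (K d)) < r"
    proof -
      have "C * (1 - measure (N d) (K d)) < C * (r / (2 * C))"
        using elim(2) C by (intro mult_strict_left_mono) auto
      then show ?thesis using C by simp
    qed
    finally show ?case by (simp add: dist_real_def)
  qed
qed

lemma (in prob_space) distr_pair_snd:
  assumes "prob_space N"
  shows "distr (M \<Otimes>\<^sub>M N) N snd = N"
proof (rule measure_eqI)
  interpret N: prob_space N by fact
  fix A assume "A \<in> sets (distr (M \<Otimes>\<^sub>M N) N snd)"
  then have A: "A \<in> sets N" by simp
  have "snd -` A \<inter> space (M \<Otimes>\<^sub>M N) = space M \<times> A"
    using sets.sets_into_space[OF A] by (auto simp: space_pair_measure)
  then show "emeasure (distr (M \<Otimes>\<^sub>M N) N snd) A = emeasure N A"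
    using A by (simp add: emeasure_distr N.emeasure_pair_measure_Times emeasure_space_1)
qed simp

lemma AE_pair_fst:
  assumes "prob_space N" "AE x in M. Q x"
  shows "AE p in M \<Otimes>\<^sub>M N. Q (fst p)"
proof -
  have "AE x in distr (M \<Otimes>\<^sub>M N) M fst. Q x"
    using assms(2) unfolding prob_space.distr_pair_fst[OF assms(1)] .
  then show ?thesis
    by (rule AE_distrD[rotated]) simp
qed

lemma prob_pair_difference_le:
  fixes f :: "'a \<Rightarrow> real" and g :: "'b \<Rightarrow> real"
  assumes M: "prob_space M" and N: "prob_space N"
    and f [measurable]: "f \<in> borel_measurable M" and g [measurable]: "g \<in> borel_measurable N"
  shows "measure (M \<Otimes>\<^sub>M N) {p \<in> space (M \<Otimes>\<^sub>M N). \<eta> \<le> \<bar>f (fst p) - g (snd p)\<bar>} \<le>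
    measure M {x \<in> space M. \<eta> / 2 \<le> \<bar>f x\<bar>} + measure N {y \<in> space N. \<eta> / 2 \<le> \<bar>g y\<bar>}"
proof -
  interpret M: prob_space M by (rule M)
  interpret N: prob_space N by (rule N)
  interpret MN: prob_space "M \<Otimes>\<^sub>M N" by (rule prob_space_pair[OF M N])
  let ?F = "{x \<in> space M. \<eta> / 2 \<le> \<bar>f x\<bar>}" and ?H = "{y \<in> space N. \<eta> / 2 \<le> \<bar>g y\<bar>}"
  have F: "?F \<in> sets M" and H: "?H \<in> sets N" by measurable
  have "{p \<in> space (M \<Otimes>\<^sub>M N). \<eta> \<le> \<bar>f (fst p) - g (snd p)\<bar>} \<subseteq> ?F \<times> space N \<union> space M \<times> ?H"
  proof
    fix p assume "p \<in> {p \<in> space (M \<Otimes>\<^sub>M N). \<eta> \<le> \<bar>f (fst p) - g (snd p)\<bar>}"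
    then have "p \<in> space M \<times> space N" and "\<eta> \<le> \<bar>f (fst p) - g (snd p)\<bar>"
      by (auto simp: space_pair_measure)
    moreover from this(2) have "\<eta> / 2 \<le> \<bar>f (fst p)\<bar> \<or> \<eta> / 2 \<le> \<bar>g (snd p)\<bar>" by linarith
    ultimately show "p \<in> ?F \<times> space N \<union> space M \<times> ?H"
      unfolding Un_iff mem_Times_iff mem_Collect_eq by blast
  qed
  then have "measure (M \<Otimes>\<^sub>M N) {p \<in> space (M \<Otimes>\<^sub>M N). \<eta> \<le> \<bar>f (fst p) - g (snd p)\<bar>}
      \<le> measure (M \<Otimes>\<^sub>M N) (?F \<times> space N \<union> space M \<times> ?H)"
    by (rule MN.finite_measure_mono) (intro sets.Un pair_measureI F H sets.top)
  also have "\<dots> \<le> measure (M \<Otimes>\<^sub>M N) (?F \<times> space N) + measure (M \<Otimes>\<^sub>M N) (space M \<times> ?H)"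
    by (intro measure_Un_le pair_measureI F H sets.top)
  also have "\<dots> = measure M ?F + measure N ?H"
    unfolding measure_def
    by (simp only: N.emeasure_pair_measure_Times[OF F sets.top] N.emeasure_pair_measure_Times[OF sets.top H]
        M.emeasure_space_1 N.emeasure_space_1 mult_1_left mult_1_right)
  finally show ?thesis .
qed

lemma indep_rv_distr_pair:
  assumes M: "prob_space M" and indep: "indep_rv M S X T Y"
  shows "distr M (S \<Otimes>\<^sub>M T) (\<lambda>\<omega>. (X \<omega>, Y \<omega>)) = distr M S X \<Otimes>\<^sub>M distr M T Y"
proof (rule pair_measure_eqI[symmetric])
  interpret M: prob_space M by (rule M)
  have X: "X \<in> measurable M S" and Y: "Y \<in> measurable M T"
    and ind: "M.indep_set {X -` A \<inter> space M | A. A \<in> sets S} {Y -` B \<inter> space M | B. B \<in> sets T}"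
    using indep by (auto simp: indep_rv_def)
  show "sigma_finite_measure (distr M S X)" "sigma_finite_measure (distr M T Y)"
    by (intro prob_space_imp_sigma_finite M.prob_space_distr X Y)+
  fix A B assume "A \<in> sets (distr M S X)" "B \<in> sets (distr M T Y)"
  then have A: "A \<in> sets S" and B: "B \<in> sets T" by auto
  have "M.prob ((X -` A \<inter> space M) \<inter> (Y -` B \<inter> space M)) = M.prob (X -` A \<inter> space M) * M.prob (Y -` B \<inter> space M)"
    by (rule M.indep_setD[OF ind]) (use A B in auto)
  moreover have "(\<lambda>\<omega>. (X \<omega>, Y \<omega>)) -` (A \<times> B) \<inter> space M = (X -` A \<inter> space M) \<inter> (Y -` B \<inter> space M)"
    by auto
  ultimately show "emeasure (distr M S X) A * emeasure (distr M T Y) B = emeasure (distr M (S \<Otimes>\<^sub>M T) (\<lambda>\<omega>. (X \<omega>, Y \<omega>))) (A \<times> B)"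
    using X Y A B by (simp add: emeasure_distr measurable_Pair M.emeasure_eq_measure ennreal_mult'')
qed simp

lemma distr_PiM_two_components:
  assumes M: "prob_space M" and ij: "i \<in> I" "j \<in> I" "i \<noteq> j"
  shows "distr (Pi\<^sub>M I (\<lambda>_. M)) (M \<Otimes>\<^sub>M M) (\<lambda>x. (x i, x j)) = M \<Otimes>\<^sub>M M"
proof (rule pair_measure_eqI[symmetric])
  interpret P: product_prob_space "\<lambda>_. M" by (rule product_prob_spaceI) (rule M)
  show "sigma_finite_measure M" "sigma_finite_measure M" using M by (simp_all add: prob_space_imp_sigma_finite)
  fix A B assume A: "A \<in> sets M" and B: "B \<in> sets M"
  let ?X = "\<lambda>k. if k = i then A else B"
  have "(\<lambda>x. (x i, x j)) -` (A \<times> B) \<inter> space (Pi\<^sub>M I (\<lambda>_. M)) = {x \<in> space (Pi\<^sub>M I (\<lambda>_. M)). \<forall>k\<in>{i, j}. x k \<in> ?X k}"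
    using ij by auto
  then have "emeasure (distr (Pi\<^sub>M I (\<lambda>_. M)) (M \<Otimes>\<^sub>M M) (\<lambda>x. (x i, x j))) (A \<times> B) = emeasure (Pi\<^sub>M I (\<lambda>_. M)) {x \<in> space (Pi\<^sub>M I (\<lambda>_. M)). \<forall>k\<in>{i, j}. x k \<in> ?X k}"
    using A B ij by (subst emeasure_distr) auto
  also have "\<dots> = (\<Prod>k\<in>{i, j}. emeasure M (?X k))"
    by (rule P.emeasure_PiM_Collect) (use A B ij in auto)
  also have "\<dots> = emeasure M A * emeasure M B" using ij by simp
  finally show "emeasure M A * emeasure M B = emeasure (distr (Pi\<^sub>M I (\<lambda>_. M)) (M \<Otimes>\<^sub>M M) (\<lambda>x. (x i, x j))) (A \<times> B)" ..
qed simp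

lemma PiM_pair_eq_distr:
  assumes A: "prob_space A" and B: "prob_space B" and I: "finite I"
  shows "Pi\<^sub>M I (\<lambda>_. A \<Otimes>\<^sub>M B) =
    distr (Pi\<^sub>M I (\<lambda>_. A) \<Otimes>\<^sub>M Pi\<^sub>M I (\<lambda>_. B)) (Pi\<^sub>M I (\<lambda>_. A \<Otimes>\<^sub>M B)) (\<lambda>p. \<lambda>i\<in>I. (fst p i, snd p i))"
proof -
  have AB: "prob_space (A \<Otimes>\<^sub>M B)" by (rule prob_space_pair[OF A B])
  interpret P: product_sigma_finite "\<lambda>_. A \<Otimes>\<^sub>M B"
    by (intro product_sigma_finite.intro prob_space_imp_sigma_finite AB)
  interpret PA: product_sigma_finite "\<lambda>_. A"
    by (intro product_sigma_finite.intro prob_space_imp_sigma_finite A)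
  interpret PB: product_sigma_finite "\<lambda>_. B"
    by (intro product_sigma_finite.intro prob_space_imp_sigma_finite B)
  have sB: "sigma_finite_measure B" by (intro prob_space_imp_sigma_finite B)
  interpret IB: sigma_finite_measure "Pi\<^sub>M I (\<lambda>_. B)" by (intro prob_space_imp_sigma_finite prob_space_PiM B)
  let ?T = "\<lambda>p. \<lambda>i\<in>I. (fst p i, snd p i)"
  have T [measurable]: "?T \<in> measurable (Pi\<^sub>M I (\<lambda>_. A) \<Otimes>\<^sub>M Pi\<^sub>M I (\<lambda>_. B)) (Pi\<^sub>M I (\<lambda>_. A \<Otimes>\<^sub>M B))"
    by measurable
  show ?thesis
  proof (rule P.PiM_eqI[OF I, symmetric])
    fix E assume "\<And>i. i \<in> I \<Longrightarrow> E i \<in> sets (A \<Otimes>\<^sub>M B)"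
    then have E: "E i \<in> sets (A \<Otimes>\<^sub>M B)" if "i \<in> I" for i using that by blast
    have box: "Pi\<^sub>E I E \<in> sets (Pi\<^sub>M I (\<lambda>_. A \<Otimes>\<^sub>M B))" by (rule sets_PiM_I_finite[OF I E])
    have "emeasure (distr (Pi\<^sub>M I (\<lambda>_. A) \<Otimes>\<^sub>M Pi\<^sub>M I (\<lambda>_. B)) (Pi\<^sub>M I (\<lambda>_. A \<Otimes>\<^sub>M B)) ?T) (Pi\<^sub>E I E)
      = emeasure (Pi\<^sub>M I (\<lambda>_. A) \<Otimes>\<^sub>M Pi\<^sub>M I (\<lambda>_. B)) (?T -` Pi\<^sub>E I E \<inter> space (Pi\<^sub>M I (\<lambda>_. A) \<Otimes>\<^sub>M Pi\<^sub>M I (\<lambda>_. B)))"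
      by (rule emeasure_distr[OF T box])
    also have "\<dots> = (\<integral>\<^sup>+x. emeasure (Pi\<^sub>M I (\<lambda>_. B)) (Pair x -` (?T -` Pi\<^sub>E I E \<inter> space (Pi\<^sub>M I (\<lambda>_. A) \<Otimes>\<^sub>M Pi\<^sub>M I (\<lambda>_. B)))) \<partial>Pi\<^sub>M I (\<lambda>_. A))"
      by (rule IB.emeasure_pair_measure_alt) (rule measurable_sets[OF T box])
    also have "\<dots> = (\<integral>\<^sup>+x. (\<Prod>i\<in>I. emeasure B (Pair (x i) -` E i)) \<partial>Pi\<^sub>M I (\<lambda>_. A))"
    proof (rule nn_integral_cong)
      fix x assume x: "x \<in> space (Pi\<^sub>M I (\<lambda>_. A))"
      have sub: "Pair (x i) -` E i \<subseteq> space B" if "i \<in> I" for i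
        using sets.sets_into_space[OF E[OF that]] by (auto simp: space_pair_measure)
      have "Pair x -` (?T -` Pi\<^sub>E I E \<inter> space (Pi\<^sub>M I (\<lambda>_. A) \<Otimes>\<^sub>M Pi\<^sub>M I (\<lambda>_. B))) = Pi\<^sub>E I (\<lambda>i. Pair (x i) -` E i)"
        using x sub by (auto simp: space_pair_measure space_PiM PiE_iff; blast)
      then show "emeasure (Pi\<^sub>M I (\<lambda>_. B)) (Pair x -` (?T -` Pi\<^sub>E I E \<inter> space (Pi\<^sub>M I (\<lambda>_. A) \<Otimes>\<^sub>M Pi\<^sub>M I (\<lambda>_. B)))) = (\<Prod>i\<in>I. emeasure B (Pair (x i) -` E i))"
        using PB.emeasure_PiM[OF I, of "\<lambda>i. Pair (x i) -` E i"] by (simp add: sets_Pair1[OF E])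
    qed
    also have "\<dots> = (\<Prod>i\<in>I. \<integral>\<^sup>+a. emeasure B (Pair a -` E i) \<partial>A)"
      by (rule PA.product_nn_integral_prod[OF I]) (rule sigma_finite_measure.measurable_emeasure_Pair[OF sB E])
    also have "\<dots> = (\<Prod>i\<in>I. emeasure (A \<Otimes>\<^sub>M B) (E i))"
      by (intro prod.cong refl sigma_finite_measure.emeasure_pair_measure_alt[OF sB, symmetric] E)
    finally show "emeasure (distr (Pi\<^sub>M I (\<lambda>_. A) \<Otimes>\<^sub>M Pi\<^sub>M I (\<lambda>_. B)) (Pi\<^sub>M I (\<lambda>_. A \<Otimes>\<^sub>M B)) ?T) (Pi\<^sub>E I E) = (\<Prod>i\<in>I. emeasure (A \<Otimes>\<^sub>M B) (E i))" .
  qed simp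
qed

lemma PiM_distr_eq:
  assumes N: "prob_space N" and I: "finite I" and f: "f \<in> measurable N M'"
  shows "Pi\<^sub>M I (\<lambda>_. distr N M' f) = distr (Pi\<^sub>M I (\<lambda>_. N)) (Pi\<^sub>M I (\<lambda>_. M')) (compose I f)"
proof -
  have "distr N (distr N M' f) f = distr N M' f" by (intro distr_cong) auto
  moreover have "distr (Pi\<^sub>M I (\<lambda>_. N)) (Pi\<^sub>M I (\<lambda>_. distr N M' f)) (compose I f) = Pi\<^sub>M I (\<lambda>_. distr N (distr N M' f) f)"
    by (rule distr_PiM_finite_prob_space'[OF I]) (use N f in \<open>auto intro: prob_space.prob_space_distr\<close>)
  moreover have "distr (Pi\<^sub>M I (\<lambda>_. N)) (Pi\<^sub>M I (\<lambda>_. distr N M' f)) (compose I f) = distr (Pi\<^sub>M I (\<lambda>_. N)) (Pi\<^sub>M I (\<lambda>_. M')) (compose I f)"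
    by (intro distr_cong refl sets_PiM_cong) simp
  ultimately show ?thesis by simp
qed

section \<open>Independence from characteristic functions\<close>

text \<open>
  If \<open>g\<close> is uncorrelated with every \<open>iexp (s * X)\<close>, then reweighting the probability by the density
  \<open>g / expectation g\<close> leaves the characteristic function of \<open>X\<close> unchanged, hence also its law. Taking
  \<open>g\<close> bounded away from $0$ makes the density legitimate; general weights are shifted to this case.
\<close>

lemma (in prob_space) char_factor_imp_indicator_factor_pos:
  fixes X g :: "'a \<Rightarrow> real"
  assumes X [measurable]: "random_variable borel X" and g [measurable]: "random_variable borel g"
    and bounds: "\<And>x. 1 \<le> g x" "\<And>x. g x \<le> B"
    and factor: "\<And>s. (CLINT x|M. iexp (s * X x) * g x) = (CLINT x|M. iexp (s * X x)) * expectation g"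
    and A [measurable]: "A \<in> sets borel"
  shows "expectation (\<lambda>x. indicator A (X x) * g x) = prob {x \<in> space M. X x \<in> A} * expectation g"
proof -
  have int_g: "integrable M g"
  proof (rule integrable_const_bound[of _ B])
    show "AE x in M. norm (g x) \<le> B"
    proof (rule AE_I2)
      show "norm (g x) \<le> B" for x using bounds[of x] by simp
    qed
  qed measurable
  define c where "c = expectation g"
  have "1 \<le> c"
    unfolding c_def using integral_mono[of M "\<lambda>_. 1" g] int_g bounds by (simp add: prob_space)
  then have c: "0 < c" by simp
  define N where "N = density M (\<lambda>x. ennreal (g x / c))"
  have sets_N [measurable_cong]: "sets N = sets M" by (simp add: N_def)
  have g0: "0 \<le> g x / c" for x using bounds(1)[of x] c by simp
  have "(\<integral>\<^sup>+x. ennreal (g x / c) \<partial>M) = ennreal (expectation (\<lambda>x. g x / c))"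
    by (rule nn_integral_eq_integral) (use int_g g0 in auto)
  also have "\<dots> = 1" using c by (simp add: c_def[symmetric])
  finally have "prob_space N"
    by (intro prob_spaceI) (simp add: N_def emeasure_density cong: nn_integral_cong)
  then interpret N: prob_space N .
  have "real_distribution (distr N borel X)"
    by (rule N.real_distribution_distr) measurable
  moreover have "real_distribution (distr M borel X)"
    by (rule real_distribution_distr) measurable
  moreover have "char (distr N borel X) = char (distr M borel X)"
  proof
    fix s
    have "char (distr N borel X) s = (CLINT x|N. iexp (s * X x))"
      by (simp add: char_def integral_distr)
    also have "\<dots> = (CLINT x|M. (g x / c) *\<^sub>R iexp (s * X x))"
      unfolding N_def by (rule integral_density) (use g0 in auto)
    also have "\<dots> = (CLINT x|M. iexp (s * X x) * g x) / c"
      by (subst integral_divide_zero[symmetric], intro Bochner_Integration.integral_cong)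
         (auto simp: scaleR_conv_of_real)
    also have "\<dots> = (CLINT x|M. iexp (s * X x))"
      using c unfolding factor c_def[symmetric] by (intro nonzero_mult_div_cancel_right) simp
    finally show "char (distr N borel X) s = char (distr M borel X) s"
      by (simp add: char_def integral_distr)
  qed
  ultimately have eq: "distr N borel X = distr M borel X"
    by (rule Levy_uniqueness)
  have "expectation (\<lambda>x. indicator A (X x) * g x) = c * expectation (\<lambda>x. (g x / c) * indicator A (X x))"
    using c by (subst integral_mult_right_zero[symmetric], intro Bochner_Integration.integral_cong) auto
  also have "expectation (\<lambda>x. (g x / c) * indicator A (X x)) = (LINT x|N. indicator A (X x))"
    unfolding N_def by (subst integral_density) (use g0 in auto)
  also have "\<dots> = (LINT x|distr N borel X. indicator A x)"
    by (subst integral_distr) auto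
  also have "\<dots> = prob {x \<in> space M. X x \<in> A}"
    unfolding eq by (simp add: measure_distr vimage_def Int_def conj_commute)
  finally show ?thesis by (simp add: c_def)
qed

lemma (in prob_space) char_factor_imp_indicator_factor:
  fixes X :: "'a \<Rightarrow> real" and W :: "'a \<Rightarrow> complex"
  assumes X [measurable]: "random_variable borel X" and W [measurable]: "random_variable borel W"
    and bound: "\<And>x. norm (W x) \<le> 1"
    and factor: "\<And>s. (CLINT x|M. iexp (s * X x) * W x) = (CLINT x|M. iexp (s * X x)) * (CLINT x|M. W x)"
    and A [measurable]: "A \<in> sets borel"
  shows "(CLINT x|M. indicator A (X x) * W x) = prob {x \<in> space M. X x \<in> A} * (CLINT x|M. W x)"
proof -
  have int_W: "integrable M W"
    by (rule integrable_const_bound[of _ 1]) (use bound in auto)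
  have int_eW: "integrable M (\<lambda>x. iexp (s * X x) * W x)" for s
    by (rule integrable_const_bound[of _ 1]) (use bound in \<open>auto simp: norm_mult\<close>)
  have int_e: "integrable M (\<lambda>x. iexp (s * X x))" for s
    by (rule integrable_iexp) auto
  have [measurable]: "(\<lambda>x. cnj (W x)) \<in> borel_measurable M"
    by (intro measurable_compose[OF W] borel_measurable_continuous_onI continuous_intros)
  have conj_factor: "(CLINT x|M. iexp (s * X x) * cnj (W x)) = (CLINT x|M. iexp (s * X x)) * cnj (CLINT x|M. W x)" for s
  proof -
    have ee: "cnj (iexp (- s * X x)) = iexp (s * X x)" for x
      by (simp add: exp_cnj)
    have "(CLINT x|M. iexp (s * X x) * cnj (W x)) = (CLINT x|M. cnj (iexp (- s * X x) * W x))"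
      by (simp only: complex_cnj_mult ee)
    also have "\<dots> = cnj (CLINT x|M. iexp (- s * X x)) * cnj (CLINT x|M. W x)"
      by (subst Bochner_Integration.integral_cnj) (simp only: factor complex_cnj_mult)
    also have "cnj (CLINT x|M. iexp (- s * X x)) = (CLINT x|M. iexp (s * X x))"
      by (simp only: Bochner_Integration.integral_cnj[symmetric] ee)
    finally show ?thesis .
  qed
  have int_eW': "integrable M (\<lambda>x. iexp (s * X x) * cnj (W x))" for s
    by (rule integrable_const_bound[of _ 1]) (use bound in \<open>auto simp: norm_mult\<close>)
  have ReIm: "expectation (\<lambda>x. indicator A (X x) * f (W x)) = prob {x \<in> space M. X x \<in> A} * f (CLINT x|M. W x)"
    if f: "f = (\<lambda>z. Re z) \<or> f = (\<lambda>z. Im z)" for f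
  proof -
    obtain a b :: complex where fab: "\<And>z. complex_of_real (f z) = a * z + b * cnj z"
    proof -
      have "complex_of_real (Re z) = (1/2) * z + (1/2) * cnj z" "complex_of_real (Im z) = (- \<i>/2) * z + (\<i>/2) * cnj z" for z
        by (auto simp: complex_eq_iff)
      then show ?thesis using f that by metis
    qed
    have [measurable]: "(\<lambda>x. f (W x)) \<in> borel_measurable M" using f by auto
    have fb: "\<bar>f z\<bar> \<le> norm z" for z using f abs_Re_le_cmod abs_Im_le_cmod by auto
    have int_f: "integrable M (\<lambda>x. f (W x))"
      by (rule integrable_const_bound[of _ 1]) (auto intro: order_trans[OF fb bound])
    have f_int: "expectation (\<lambda>x. f (W x)) = f (CLINT x|M. W x)"
      using f int_W by auto
    have "(CLINT x|M. iexp (s * X x) * complex_of_real (2 + f (W x))) = (CLINT x|M. iexp (s * X x)) * complex_of_real (expectation (\<lambda>x. 2 + f (W x)))" for s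
    proof -
      have "(CLINT x|M. iexp (s * X x) * complex_of_real (2 + f (W x)))
          = (CLINT x|M. 2 * iexp (s * X x) + a * (iexp (s * X x) * W x) + b * (iexp (s * X x) * cnj (W x)))"
        by (intro Bochner_Integration.integral_cong) (simp_all add: fab algebra_simps)
      also have "\<dots> = 2 * (CLINT x|M. iexp (s * X x)) + a * (CLINT x|M. iexp (s * X x) * W x) + b * (CLINT x|M. iexp (s * X x) * cnj (W x))"
      proof -
        have "(CLINT x|M. 2 * f1 x + a * f2 x + b * f3 x) = 2 * (CLINT x|M. f1 x) + a * (CLINT x|M. f2 x) + b * (CLINT x|M. f3 x)"
          if "integrable M f1" "integrable M f2" "integrable M f3" for f1 f2 f3 :: "'a \<Rightarrow> complex"
          using that by simp
        from this[OF int_e int_eW int_eW'] show ?thesis .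
      qed
      also have "\<dots> = (CLINT x|M. iexp (s * X x)) * (2 + f (CLINT x|M. W x))"
        by (simp only: factor conj_factor of_real_add fab) (simp add: algebra_simps)
      also have "2 + f (CLINT x|M. W x) = expectation (\<lambda>x. 2 + f (W x))"
        by (simp add: int_f f_int prob_space)
      finally show ?thesis .
    qed
    (* the shift by 2 turns f (W x), which lies in [-1, 1], into a weight between 1 and 3 *)
    then have "expectation (\<lambda>x. indicator A (X x) * (2 + f (W x))) = prob {x \<in> space M. X x \<in> A} * expectation (\<lambda>x. 2 + f (W x))"
    proof (intro char_factor_imp_indicator_factor_pos[where B=3])
      show "1 \<le> 2 + f (W x)" "2 + f (W x) \<le> 3" for x
        using fb[of "W x"] bound[of x] by auto
    qed auto
    moreover have "expectation (\<lambda>x. indicator A (X x)) = prob {x \<in> space M. X x \<in> A}"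
      using Bochner_Integration.integral_indicator[of M "X -` A \<inter> space M"]
      by (subst Bochner_Integration.integral_cong[OF refl, where g="indicator (X -` A \<inter> space M)"])
         (auto simp: indicator_def vimage_def Int_def conj_commute)
    moreover have "integrable M (\<lambda>x. indicator A (X x) * f (W x))"
      by (rule integrable_const_bound[of _ 1]) (auto simp: indicator_def intro: order_trans[OF fb bound])
    moreover have "integrable M (\<lambda>x. indicator A (X x) :: real)"
      by (rule integrable_const_bound[of _ 1]) (auto simp: indicator_def)
    ultimately show ?thesis
      by (simp add: distrib_left int_f f_int prob_space)
  qed
  have "integrable M (\<lambda>x. indicator A (X x) * W x)"
    by (rule integrable_const_bound[of _ 1]) (use bound in \<open>auto simp: indicator_def\<close>)
  then have "Re (CLINT x|M. indicator A (X x) * W x) = expectation (\<lambda>x. indicator A (X x) * Re (W x))"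
    "Im (CLINT x|M. indicator A (X x) * W x) = expectation (\<lambda>x. indicator A (X x) * Im (W x))"
    by (auto simp flip: integral_Re integral_Im intro!: Bochner_Integration.integral_cong simp: indicator_def)
  then show ?thesis
    using ReIm[of Re] ReIm[of Im] by (auto simp: complex_eq_iff)
qed

text \<open>
  Kac's theorem: real variables whose joint characteristic function is a product are independent. The
  factors \<open>iexp (t i * X i)\<close> are exchanged for indicators \<open>indicator (A i) (X i)\<close> one index at a time,
  the remaining product serving as the weight \<open>W\<close> of the preceding lemma. Only the one-dimensional
  uniqueness theorem enters.
\<close>

lemma (in prob_space) char_factor_imp_distr_PiM:
  fixes X :: "'i \<Rightarrow> 'a \<Rightarrow> real"
  assumes I: "finite I" and X [measurable]: "\<And>i. i \<in> I \<Longrightarrow> random_variable borel (X i)"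
    and factor: "\<And>t. (CLINT x|M. (\<Prod>i\<in>I. iexp (t i * X i x))) = (\<Prod>i\<in>I. CLINT x|M. iexp (t i * X i x))"
  shows "distr M (Pi\<^sub>M I (\<lambda>_. borel)) (\<lambda>x. \<lambda>i\<in>I. X i x) = Pi\<^sub>M I (\<lambda>i. distr M borel (X i))"
proof -
  define f :: "'i set \<Rightarrow> ('i \<Rightarrow> real set) \<Rightarrow> ('i \<Rightarrow> real) \<Rightarrow> 'i \<Rightarrow> 'a \<Rightarrow> complex" where
    "f J A t i x = (if i \<in> J then indicator (A i) (X i x) else iexp (t i * X i x))" for J A t i x
  have f_le: "norm (f J A t i x) \<le> 1" for J A t i x
    by (auto simp: f_def indicator_def)
  have f_meas [measurable]: "f J A t i \<in> borel_measurable M"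
    if "i \<in> I" "\<And>i. i \<in> I \<Longrightarrow> A i \<in> sets borel" for J A t i
    using that by (cases "i \<in> J") (auto simp: f_def cong: measurable_cong)
  have main: "(CLINT x|M. (\<Prod>i\<in>I. f J A t i x)) = (\<Prod>i\<in>I. CLINT x|M. f J A t i x)"
    if A: "\<And>i. i \<in> I \<Longrightarrow> A i \<in> sets borel" and J: "finite J" "J \<subseteq> I" for J A t
    using J
  proof (induction J arbitrary: t)
    case empty
    then show ?case using factor[of t] by (simp add: f_def)
  next
    case (insert j J)
    have j: "j \<in> I" "j \<notin> J" using insert by auto
    define W where "W x = (\<Prod>i\<in>I - {j}. f J A t i x)" for x
    have [measurable]: "W \<in> borel_measurable M"
      unfolding W_def using A by (intro borel_measurable_prod) auto
    have Wle: "norm (W x) \<le> 1" for x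
      unfolding W_def prod_norm[symmetric] using f_le by (intro prod_le_1) auto
    have fj: "f J A (t(j := s)) j = (\<lambda>x. iexp (s * X j x))" and fi: "i \<noteq> j \<Longrightarrow> f J A (t(j := s)) i = f J A t i" for s i
      using j by (auto simp: f_def fun_eq_iff)
    have fj': "f (insert j J) A t j = (\<lambda>x. indicator (A j) (X j x))" and fi': "i \<noteq> j \<Longrightarrow> f (insert j J) A t i = f J A t i" for i
      by (auto simp: f_def fun_eq_iff)
    have split: "(\<Prod>i\<in>I. f J A (t(j := s)) i x) = iexp (s * X j x) * W x" for s x
      unfolding W_def prod.remove[OF I j(1)] fj by (intro arg_cong2[where f="(*)"] prod.cong refl) (simp add: fi)
    have IH: "(CLINT x|M. iexp (s * X j x) * W x)
        = (CLINT x|M. iexp (s * X j x)) * (\<Prod>i\<in>I - {j}. CLINT x|M. f J A t i x)" for s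
    proof -
      have "(CLINT x|M. iexp (s * X j x) * W x) = (\<Prod>i\<in>I. CLINT x|M. f J A (t(j := s)) i x)"
        using insert.IH[of "t(j:=s)"] insert.prems unfolding split by blast
      also have "\<dots> = (CLINT x|M. iexp (s * X j x)) * (\<Prod>i\<in>I - {j}. CLINT x|M. f J A t i x)"
        unfolding prod.remove[OF I j(1)] fj by (intro arg_cong2[where f="(*)"] prod.cong refl) (simp add: fi)
      finally show ?thesis .
    qed
    have W_int: "(CLINT x|M. W x) = (\<Prod>i\<in>I - {j}. CLINT x|M. f J A t i x)"
      using IH[of 0] by (simp add: prob_space)
    have Xj [measurable]: "random_variable borel (X j)" and Aj [measurable]: "A j \<in> sets borel"
      using X A j by auto
    have ind: "(CLINT x|M. indicator (A j) (X j x)) = complex_of_real (prob {x \<in> space M. X j x \<in> A j})"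
      using char_factor_imp_indicator_factor[OF Xj, of "\<lambda>_. 1" "A j"] by (simp add: prob_space)
    have "(CLINT x|M. (\<Prod>i\<in>I. f (insert j J) A t i x)) = (CLINT x|M. indicator (A j) (X j x) * W x)"
      unfolding W_def prod.remove[OF I j(1)] fj'
      by (intro Bochner_Integration.integral_cong arg_cong2[where f="(*)"] prod.cong refl) (simp add: fi')
    also have "\<dots> = (CLINT x|M. indicator (A j) (X j x)) * (CLINT x|M. W x)"
      unfolding ind
      by (rule char_factor_imp_indicator_factor) (simp_all only: Wle IH W_int Xj Aj \<open>W \<in> borel_measurable M\<close>)
    also have "\<dots> = (\<Prod>i\<in>I. CLINT x|M. f (insert j J) A t i x)"
      unfolding W_int prod.remove[OF I j(1)] fj'
      by (intro arg_cong2[where f="(*)"] prod.cong refl) (simp add: fi')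
    finally show ?case .
  qed
  have "prob_space (if i \<in> I then distr M borel (X i) else return borel 0)" for i
    using X by (cases "i \<in> I") (simp_all add: prob_space_distr prob_space_return)
  then interpret prod: product_sigma_finite "\<lambda>i. if i \<in> I then distr M borel (X i) else return borel 0"
    by (intro product_sigma_finite.intro prob_space_imp_sigma_finite)
  have cong: "Pi\<^sub>M I (\<lambda>i. distr M borel (X i)) = Pi\<^sub>M I (\<lambda>i. if i \<in> I then distr M borel (X i) else return borel 0)"
    by (rule PiM_cong) auto
  show ?thesis
    unfolding cong
  proof (rule prod.PiM_eqI[OF I])
    show "sets (distr M (Pi\<^sub>M I (\<lambda>_. borel)) (\<lambda>x. \<lambda>i\<in>I. X i x)) = sets (Pi\<^sub>M I (\<lambda>i. if i \<in> I then distr M borel (X i) else return borel 0))"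
      by (auto intro!: sets_PiM_cong)
    fix A assume "\<And>i. i \<in> I \<Longrightarrow> A i \<in> sets (if i \<in> I then distr M borel (X i) else return borel 0)"
    then have A [measurable]: "A i \<in> sets borel" if "i \<in> I" for i using that by (metis sets_distr)
    have ind: "(CLINT x|M. indicator (A i) (X i x)) = complex_of_real (prob {x \<in> space M. X i x \<in> A i})" if "i \<in> I" for i
      using char_factor_imp_indicator_factor[OF X, of i "\<lambda>_. 1" "A i"] that by (simp add: prob_space)
    have [measurable]: "{x \<in> space M. \<forall>i\<in>I. X i x \<in> A i} \<in> sets M"
      using I by measurable
    have "complex_of_real (prob {x \<in> space M. \<forall>i\<in>I. X i x \<in> A i}) = (CLINT x|M. indicator {x \<in> space M. \<forall>i\<in>I. X i x \<in> A i} x)"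
      using char_factor_imp_indicator_factor[of "indicator {x \<in> space M. \<forall>i\<in>I. X i x \<in> A i}" "\<lambda>_. 1" "{1}"]
      by (simp add: prob_space indicator_def cong: conj_cong if_cong)
    also have "\<dots> = (CLINT x|M. (\<Prod>i\<in>I. f I A (\<lambda>_. 0) i x))"
      by (intro Bochner_Integration.integral_cong) (use I in \<open>auto simp: f_def indicator_def\<close>)
    also have "\<dots> = (\<Prod>i\<in>I. CLINT x|M. f I A (\<lambda>_. 0) i x)"
      by (rule main) (use I in auto)
    also have "\<dots> = complex_of_real (\<Prod>i\<in>I. prob {x \<in> space M. X i x \<in> A i})"
      by (auto simp: f_def ind intro!: prod.cong)
    finally have "prob {x \<in> space M. \<forall>i\<in>I. X i x \<in> A i} = (\<Prod>i\<in>I. prob {x \<in> space M. X i x \<in> A i})"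
      by (simp only: of_real_eq_iff)
    moreover have "(\<lambda>x. \<lambda>i\<in>I. X i x) -` Pi\<^sub>E I A \<inter> space M = {x \<in> space M. \<forall>i\<in>I. X i x \<in> A i}"
      by (auto simp: PiE_iff)
    moreover have "Pi\<^sub>E I A \<in> sets (Pi\<^sub>M I (\<lambda>_. borel))"
      by (rule sets_PiM_I_finite) (use I in auto)
    ultimately show "emeasure (distr M (Pi\<^sub>M I (\<lambda>_. borel)) (\<lambda>x. \<lambda>i\<in>I. X i x)) (Pi\<^sub>E I A)
        = (\<Prod>i\<in>I. emeasure (if i \<in> I then distr M borel (X i) else return borel 0) (A i))"
      using I by (simp add: emeasure_distr emeasure_eq_measure prod_ennreal vimage_def Int_def conj_commute)
  qed
qed

section \<open>Normalized Gaussian vectors are uniform on the sphere\<close>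

(* keeps index ranges in the form {1..d} *)
declare One_nat_def [simp del]

definition gaussian :: "nat \<Rightarrow> (nat \<Rightarrow> real) measure" where
  "gaussian d = Pi\<^sub>M {1..d} (\<lambda>_. std_normal_distribution)"

text \<open>
  At the origin, a null set, the direction is the first basis vector, so that for $d \ge 1$ it is
  always a point of the sphere.
\<close>

definition direction :: "nat \<Rightarrow> (nat \<Rightarrow> real) \<Rightarrow> nat \<Rightarrow> real" where
  "direction d g = (if enorm d g = 0 then (\<lambda>i\<in>{1..d}. if i = 1 then 1 else 0) else normalize_vec d g)"

lemma prob_space_std_normal: "prob_space std_normal_distribution"
  using prob_space_normal_density[of 1 0] by simp

lemma prob_space_gaussian: "prob_space (gaussian d)"
  unfolding gaussian_def by (intro prob_space_PiM prob_space_std_normal)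

lemma sets_gaussian [measurable_cong]: "sets (gaussian d) = sets (Pi\<^sub>M {1..d} (\<lambda>_. borel))"
  unfolding gaussian_def by (intro sets_PiM_cong) auto

lemma space_gaussian: "space (gaussian d) = {1..d} \<rightarrow>\<^sub>E UNIV"
  by (simp add: gaussian_def space_PiM)

lemma direction_in_sphere:
  assumes "1 \<le> d" shows "direction d g \<in> unit_sphere d"
proof (cases "enorm d g = 0")
  case True
  have "dot d (\<lambda>i\<in>{1..d}. if i = 1 then 1 else 0) (\<lambda>i\<in>{1..d}. if i = 1 then 1 else 0) = (\<Sum>i\<in>{1..d}. if i = 1 then 1 else 0)"
    unfolding dot_def by (intro sum.cong) auto
  also have "\<dots> = 1" using assms by simp
  finally show ?thesis using True by (simp add: direction_def unit_sphere_def enorm_def)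
next
  case False
  then show ?thesis using normalize_vec_in_sphere[of d g] enorm_nonneg[of d g] by (simp add: direction_def)
qed

lemma measurable_direction [measurable]:
  assumes "1 \<le> d" shows "direction d \<in> measurable (Pi\<^sub>M {1..d} (\<lambda>_. borel)) (sphere_borel d)"
  unfolding sphere_borel_def
proof (rule measurable_restrict_space2)
  show "direction d \<in> space (Pi\<^sub>M {1..d} (\<lambda>_. borel)) \<rightarrow> unit_sphere d"
    using direction_in_sphere[OF assms] by auto
  have [measurable]: "normalize_vec d \<in> measurable (Pi\<^sub>M {1..d} (\<lambda>_. borel)) (Pi\<^sub>M {1..d} (\<lambda>_. borel))"
    unfolding normalize_vec_def by measurable
  show "direction d \<in> measurable (Pi\<^sub>M {1..d} (\<lambda>_. borel)) (Pi\<^sub>M {1..d} (\<lambda>_. borel))"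
    unfolding direction_def[abs_def] by measurable
qed

lemma measurable_direction_gaussian:
  assumes "1 \<le> d" shows "direction d \<in> measurable (gaussian d) (sphere_borel d)"
  using measurable_direction[OF assms] by (subst measurable_cong_sets[OF sets_gaussian refl])

lemma measurable_gaussian_component: "i \<in> {1..d} \<Longrightarrow> (\<lambda>z. z i) \<in> borel_measurable (gaussian d)"
  by (subst measurable_cong_sets[OF sets_gaussian refl]) (rule measurable_component_singleton)

lemma product_sigma_finite_std_normal: "product_sigma_finite (\<lambda>_. std_normal_distribution)"
  by (intro product_sigma_finite.intro prob_space_imp_sigma_finite prob_space_std_normal)

lemma gaussian_eq_density:
  "gaussian d = density (Pi\<^sub>M {1..d} (\<lambda>_. lborel)) (\<lambda>x. ennreal ((1 / sqrt (2 * pi)) ^ d * exp (- dot d x x / 2)))"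
proof -
  interpret N: product_sigma_finite "\<lambda>_. std_normal_distribution" by (rule product_sigma_finite_std_normal)
  interpret L: product_sigma_finite "\<lambda>_. lborel :: real measure" by standard
  let ?L = "Pi\<^sub>M {1..d} (\<lambda>_. lborel :: real measure)"
  have dens: "ennreal ((1 / sqrt (2 * pi)) ^ d * exp (- dot d x x / 2)) = (\<Prod>i\<in>{1..d}. ennreal (std_normal_density (x i)))" for x
  proof -
    have "(\<Prod>i\<in>{1..d}. std_normal_density (x i)) = (1 / sqrt (2 * pi)) ^ d * exp (\<Sum>i\<in>{1..d}. - (x i)\<^sup>2 / 2)"
      unfolding std_normal_density_def by (simp add: prod.distrib exp_sum power_one_over prod_dividef)
    also have "(\<Sum>i\<in>{1..d}. - (x i)\<^sup>2 / 2) = - dot d x x / 2"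
      by (simp add: dot_def power2_eq_square sum_negf sum_divide_distrib)
    finally show ?thesis
      by (simp add: prod_ennreal)
  qed
  have meas [measurable]: "(\<lambda>x. dot d x x) \<in> borel_measurable ?L"
    unfolding dot_def by measurable
  show ?thesis
    unfolding gaussian_def
  proof (rule sym, rule N.PiM_eqI)
    show "sets (density ?L (\<lambda>x. ennreal ((1 / sqrt (2 * pi)) ^ d * exp (- dot d x x / 2)))) = sets (Pi\<^sub>M {1..d} (\<lambda>_. std_normal_distribution))"
      by (auto intro!: sets_PiM_cong)
    fix A :: "nat \<Rightarrow> real set" assume "\<And>i. i \<in> {1..d} \<Longrightarrow> A i \<in> sets std_normal_distribution"
    then have A [measurable]: "A i \<in> sets borel" if "i \<in> {1..d}" for i using that by auto
    have [measurable]: "Pi\<^sub>E {1..d} A \<in> sets ?L"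
      by (rule sets_PiM_I_finite) auto
    have "emeasure (density ?L (\<lambda>x. ennreal ((1 / sqrt (2 * pi)) ^ d * exp (- dot d x x / 2)))) (Pi\<^sub>E {1..d} A)
       = (\<integral>\<^sup>+x. ennreal ((1 / sqrt (2 * pi)) ^ d * exp (- dot d x x / 2)) * indicator (Pi\<^sub>E {1..d} A) x \<partial>?L)"
      by (subst emeasure_density) auto
    also have "\<dots> = (\<integral>\<^sup>+x. (\<Prod>i\<in>{1..d}. ennreal (std_normal_density (x i)) * indicator (A i) (x i)) \<partial>?L)"
      unfolding dens by (intro nn_integral_cong) (auto simp: prod.distrib indicator_def space_PiM PiE_iff prod_zero_iff)
    also have "\<dots> = (\<Prod>i\<in>{1..d}. \<integral>\<^sup>+x. ennreal (std_normal_density x) * indicator (A i) x \<partial>lborel)"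
      by (rule L.product_nn_integral_prod) auto
    also have "\<dots> = (\<Prod>i\<in>{1..d}. emeasure std_normal_distribution (A i))"
      by (intro prod.cong refl, subst emeasure_density) auto
    finally show "emeasure (density ?L (\<lambda>x. ennreal ((1 / sqrt (2 * pi)) ^ d * exp (- dot d x x / 2)))) (Pi\<^sub>E {1..d} A)
       = (\<Prod>i\<in>{1..d}. emeasure std_normal_distribution (A i))" .
  qed simp
qed

lemma gaussian_enorm_pos:
  assumes "1 \<le> d" shows "AE x in gaussian d. 0 < enorm d x"
proof -
  have "AE z in std_normal_distribution. z \<noteq> 0"
    using AE_lborel_singleton[of 0] by (subst AE_density) auto
  then have "AE x in gaussian d. x 1 \<noteq> 0"
    unfolding gaussian_def using assms by (intro AE_PiM_component prob_space_std_normal) auto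
  then show ?thesis
  proof eventually_elim
    case (elim x)
    have "0 < x 1 * x 1" using elim by (metis not_real_square_gt_zero)
    also have "\<dots> \<le> dot d x x"
      unfolding dot_def using assms by (intro member_le_sum[of 1 _ "\<lambda>i. x i * x i"]) auto
    finally show ?case by (simp add: enorm_def)
  qed
qed

lemma emeasure_lborel_PiM_scale:
  assumes t: "0 < t" and E: "E \<in> sets (Pi\<^sub>M {1..d} (\<lambda>_. lborel :: real measure))"
  shows "emeasure (Pi\<^sub>M {1..d} (\<lambda>_. lborel)) E =
    ennreal (t ^ d) * emeasure (Pi\<^sub>M {1..d} (\<lambda>_. lborel))
      ((\<lambda>x. \<lambda>i\<in>{1..d}. t * x i) -` E \<inter> space (Pi\<^sub>M {1..d} (\<lambda>_. lborel)))"
proof -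
  interpret L: product_sigma_finite "\<lambda>_. lborel :: real measure" by standard
  let ?L = "Pi\<^sub>M {1..d} (\<lambda>_. lborel :: real measure)"
  let ?s = "\<lambda>x. \<lambda>i\<in>{1..d}. t * x i"
  have s [measurable]: "?s \<in> measurable ?L ?L" by measurable
  have "density (distr ?L ?L ?s) (\<lambda>_. ennreal (t ^ d)) = ?L"
  proof (rule L.PiM_eqI)
    fix A :: "nat \<Rightarrow> real set" assume A: "\<And>i. i \<in> {1..d} \<Longrightarrow> A i \<in> sets lborel"
    then have [measurable]: "Pi\<^sub>E {1..d} A \<in> sets ?L"
      by (intro sets_PiM_I_finite) auto
    have A': "(\<lambda>x. t * x) -` A i \<in> sets lborel" if "i \<in> {1..d}" for i
      using measurable_sets[of "\<lambda>x. t * x" borel borel "A i"] A[OF that] by simp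
    have one: "ennreal t * emeasure lborel ((\<lambda>x. t * x) -` A i) = emeasure lborel (A i)" if "i \<in> {1..d}" for i
      using A[OF that] t
      by (subst (2) lborel_real_affine[of t 0]) (auto simp: emeasure_density_const emeasure_distr)
    have "emeasure (density (distr ?L ?L ?s) (\<lambda>_. ennreal (t ^ d))) (Pi\<^sub>E {1..d} A)
      = ennreal (t ^ d) * emeasure ?L (?s -` Pi\<^sub>E {1..d} A \<inter> space ?L)"
      by (simp add: emeasure_density_const emeasure_distr)
    also have "?s -` Pi\<^sub>E {1..d} A \<inter> space ?L = Pi\<^sub>E {1..d} (\<lambda>i. (\<lambda>x. t * x) -` A i)"
      by (auto simp: space_PiM PiE_iff)
    also have "emeasure ?L \<dots> = (\<Prod>i\<in>{1..d}. emeasure lborel ((\<lambda>x. t * x) -` A i))"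
      by (rule L.emeasure_PiM) (use A' in auto)
    also have "ennreal (t ^ d) * (\<Prod>i\<in>{1..d}. emeasure lborel ((\<lambda>x. t * x) -` A i))
        = (\<Prod>i\<in>{1..d}. ennreal t * emeasure lborel ((\<lambda>x. t * x) -` A i))"
      using t by (simp add: ennreal_power prod.distrib)
    also have "\<dots> = (\<Prod>i\<in>{1..d}. emeasure lborel (A i))"
      by (intro prod.cong refl one)
    finally show "emeasure (density (distr ?L ?L ?s) (\<lambda>_. ennreal (t ^ d))) (Pi\<^sub>E {1..d} A) = (\<Prod>i\<in>{1..d}. emeasure lborel (A i))" .
  qed simp_all
  then have "emeasure ?L E = emeasure (density (distr ?L ?L ?s) (\<lambda>_. ennreal (t ^ d))) E"
    by simp
  also have "\<dots> = ennreal (t ^ d) * emeasure ?L (?s -` E \<inter> space ?L)"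
    using E by (simp add: emeasure_density_const emeasure_distr)
  finally show ?thesis .
qed

lemma exp_neg_square_layer_cake:
  fixes s :: real
  assumes "0 \<le> s"
  shows "ennreal (exp (- s\<^sup>2 / 2)) = (\<integral>\<^sup>+t. ennreal (t * exp (- t\<^sup>2 / 2)) * indicator {s..} t \<partial>lborel)"
proof -
  have lim: "((\<lambda>t::real. - exp (- t\<^sup>2 / 2)) \<longlongrightarrow> - 0) at_top"
  proof (intro tendsto_minus filterlim_compose[OF exp_at_bot])
    have "filterlim (\<lambda>t::real. (1/2) * t\<^sup>2) at_top at_top"
      by (rule filterlim_tendsto_pos_mult_at_top[OF tendsto_const])
         (auto intro: filterlim_pow_at_top filterlim_ident)
    then show "filterlim (\<lambda>t::real. - t\<^sup>2 / 2) at_bot at_top"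
      by (simp add: filterlim_uminus_at_top)
  qed
  have "(\<integral>\<^sup>+t. ennreal (t * exp (- t\<^sup>2 / 2)) * indicator {s..} t \<partial>lborel) = ennreal (- 0 - - exp (- s\<^sup>2 / 2))"
  proof (rule nn_integral_FTC_atLeast)
    show "((\<lambda>t::real. - exp (- t\<^sup>2 / 2)) has_real_derivative x * exp (- x\<^sup>2 / 2)) (at x)" for x
      by (auto intro!: derivative_eq_intros simp: power2_eq_square)
    show "((\<lambda>t::real. - exp (- t\<^sup>2 / 2)) \<longlongrightarrow> - 0) at_top" by (rule lim)
  qed (use assms in auto)
  then show ?thesis by simp
qed

lemma enorm_scale:
  assumes "0 < t" shows "enorm d (\<lambda>i\<in>{1..d}. t * x i) = t * enorm d x"
proof -
  have "dot d (\<lambda>i\<in>{1..d}. t * x i) (\<lambda>i\<in>{1..d}. t * x i) = t\<^sup>2 * dot d x x"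
    unfolding dot_def sum_distrib_left by (intro sum.cong) (auto simp: power2_eq_square)
  then show ?thesis using assms by (simp add: enorm_def real_sqrt_mult)
qed

text \<open>
  The Gaussian density is a mixture of indicators of centred balls. The part of a cone inside the
  ball of radius \<open>t\<close> has volume $t^d$ times its part inside the unit ball, so the Gaussian mass of
  the cone is the latter volume times a constant \<open>K\<close> that is the same for all cones.
\<close>

lemma gaussian_cone:
  "\<exists>K. \<forall>C\<in>sets (Pi\<^sub>M {1..d} (\<lambda>_. lborel)).
       (\<forall>x\<in>{1..d} \<rightarrow>\<^sub>E UNIV. \<forall>t>0. (\<lambda>i\<in>{1..d}. t * x i) \<in> C \<longleftrightarrow> x \<in> C) \<longrightarrow>
       emeasure (gaussian d) C = K * emeasure (Pi\<^sub>M {1..d} (\<lambda>_. lborel)) {x \<in> C. enorm d x \<le> 1}"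
proof (intro exI ballI impI)
  let ?L = "Pi\<^sub>M {1..d} (\<lambda>_. lborel :: real measure)"
  let ?w = "\<lambda>t::real. ennreal (t * exp (- t\<^sup>2 / 2))"
  define k :: real where "k = (1 / sqrt (2 * pi)) ^ d"
  have k: "0 \<le> k" by (simp add: k_def)
  interpret L: product_sigma_finite "\<lambda>_. lborel :: real measure" by standard
  interpret Ld: finite_product_sigma_finite "\<lambda>_. lborel :: real measure" "{1..d}" by standard simp
  interpret pair_sigma_finite ?L lborel ..
  have [measurable]: "enorm d \<in> borel_measurable ?L" "(\<lambda>x. dot d x x) \<in> borel_measurable ?L"
    unfolding enorm_def[abs_def] dot_def by measurable
  fix C assume C [measurable]: "C \<in> sets ?L"
    and cone': "\<forall>x\<in>{1..d} \<rightarrow>\<^sub>E UNIV. \<forall>t>0. (\<lambda>i\<in>{1..d}. t * x i) \<in> C \<longleftrightarrow> x \<in> C"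
  have cone: "(\<lambda>i\<in>{1..d}. t * x i) \<in> C \<longleftrightarrow> x \<in> C" if "x \<in> {1..d} \<rightarrow>\<^sub>E UNIV" "0 < t" for x t
    using cone' that by auto
  have Cs: "C \<subseteq> space ?L" using sets.sets_into_space[OF C] .
  have scaled: "emeasure ?L {x \<in> C. enorm d x \<le> t} = ennreal (t ^ d) * emeasure ?L {x \<in> C. enorm d x \<le> 1}" if t: "0 < t" for t
  proof -
    have "{x \<in> space ?L. x \<in> C \<and> enorm d x \<le> t} \<in> sets ?L" by measurable
    also have "{x \<in> space ?L. x \<in> C \<and> enorm d x \<le> t} = {x \<in> C. enorm d x \<le> t}" using Cs by auto
    finally have S: "{x \<in> C. enorm d x \<le> t} \<in> sets ?L" .
    have "(\<lambda>x. \<lambda>i\<in>{1..d}. t * x i) -` {x \<in> C. enorm d x \<le> t} \<inter> space ?L = {x \<in> C. enorm d x \<le> 1}"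
      using Cs t cone by (auto simp: enorm_scale space_PiM)
    then show ?thesis
      using emeasure_lborel_PiM_scale[OF t S] by simp
  qed
  have "emeasure (gaussian d) C = (\<integral>\<^sup>+x. ennreal (k * exp (- dot d x x / 2)) * indicator C x \<partial>?L)"
    unfolding gaussian_eq_density k_def by (subst emeasure_density) auto
  also have "\<dots> = (\<integral>\<^sup>+x. (\<integral>\<^sup>+t. ennreal k * (?w t * indicator {x \<in> C. enorm d x \<le> t} x) \<partial>lborel) \<partial>?L)"
  proof (intro nn_integral_cong)
    fix x
    have "ennreal (k * exp (- dot d x x / 2)) * indicator C x
       = ennreal k * (\<integral>\<^sup>+t. ?w t * indicator {enorm d x..} t \<partial>lborel) * indicator C x"
      using exp_neg_square_layer_cake[OF enorm_nonneg[of d x]] k by (simp add: ennreal_mult enorm_power2)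
    also have "\<dots> = (\<integral>\<^sup>+t. ennreal k * (?w t * indicator {enorm d x..} t) * indicator C x \<partial>lborel)"
      by (simp add: nn_integral_cmult nn_integral_multc)
    also have "\<dots> = (\<integral>\<^sup>+t. ennreal k * (?w t * indicator {x \<in> C. enorm d x \<le> t} x) \<partial>lborel)"
      by (intro nn_integral_cong) (auto simp: indicator_def)
    finally show "ennreal (k * exp (- dot d x x / 2)) * indicator C x = (\<integral>\<^sup>+t. ennreal k * (?w t * indicator {x \<in> C. enorm d x \<le> t} x) \<partial>lborel)" .
  qed
  also have "\<dots> = (\<integral>\<^sup>+t. (\<integral>\<^sup>+x. ennreal k * (?w t * indicator {x \<in> C. enorm d x \<le> t} x) \<partial>?L) \<partial>lborel)"
  proof (rule Fubini'[symmetric])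
    define S where "S = {p \<in> space (?L \<Otimes>\<^sub>M lborel). fst p \<in> C \<and> enorm d (fst p) \<le> snd p}"
    have [measurable]: "S \<in> sets (?L \<Otimes>\<^sub>M lborel)" unfolding S_def by measurable
    have "(\<lambda>p. ennreal k * (?w (snd p) * indicator S p)) \<in> borel_measurable (?L \<Otimes>\<^sub>M lborel)"
      by measurable
    then show "(\<lambda>(x, t). ennreal k * (?w t * indicator {x \<in> C. enorm d x \<le> t} x)) \<in> borel_measurable (?L \<Otimes>\<^sub>M lborel)"
      by (rule measurable_cong[THEN iffD1, rotated]) (auto simp: S_def indicator_def)
  qed
  also have "\<dots> = (\<integral>\<^sup>+t. (ennreal k * (?w t * indicator {0..} t * ennreal (t ^ d))) * emeasure ?L {x \<in> C. enorm d x \<le> 1} \<partial>lborel)"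
  proof (rule nn_integral_cong_AE, use AE_lborel_singleton[of 0] in eventually_elim)
    fix t :: real assume "t \<noteq> 0"
    have "{x \<in> space ?L. x \<in> C \<and> enorm d x \<le> t} \<in> sets ?L" by measurable
    also have "{x \<in> space ?L. x \<in> C \<and> enorm d x \<le> t} = {x \<in> C. enorm d x \<le> t}" using Cs by auto
    finally have S [measurable]: "{x \<in> C. enorm d x \<le> t} \<in> sets ?L" .
    have "(\<integral>\<^sup>+x. ennreal k * (?w t * indicator {x \<in> C. enorm d x \<le> t} x) \<partial>?L) = ennreal k * (?w t * emeasure ?L {x \<in> C. enorm d x \<le> t})"
      by (simp add: nn_integral_cmult)
    also have "?w t * emeasure ?L {x \<in> C. enorm d x \<le> t} = ?w t * indicator {0..} t * ennreal (t ^ d) * emeasure ?L {x \<in> C. enorm d x \<le> 1}"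
    proof (cases "0 < t")
      case True then show ?thesis unfolding scaled[OF True] by (simp add: mult.assoc)
    next
      case False
      then have "?w t = 0" using \<open>t \<noteq> 0\<close> by (simp add: ennreal_neg mult_nonpos_nonneg)
      then show ?thesis by simp
    qed
    finally show "(\<integral>\<^sup>+x. ennreal k * (?w t * indicator {x \<in> C. enorm d x \<le> t} x) \<partial>?L) = (ennreal k * (?w t * indicator {0..} t * ennreal (t ^ d))) * emeasure ?L {x \<in> C. enorm d x \<le> 1}"
      by (simp add: mult.assoc)
  qed
  also have "\<dots> = (\<integral>\<^sup>+t. ennreal k * (?w t * indicator {0..} t * ennreal (t ^ d)) \<partial>lborel) * emeasure ?L {x \<in> C. enorm d x \<le> 1}"
    by (rule nn_integral_multc) measurable
  finally show "emeasure (gaussian d) C = (\<integral>\<^sup>+t. ennreal ((1 / sqrt (2 * pi)) ^ d) * (?w t * indicator {0..} t * ennreal (t ^ d)) \<partial>lborel) * emeasure ?L {x \<in> C. enorm d x \<le> 1}"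
    unfolding k_def .
qed

text \<open>
  A Borel set of the sphere has, under either law, a mass proportional to the volume of the cone over
  it inside the unit ball. The whole sphere fixes the constant.
\<close>

lemma uniform_sphere_eq_direction:
  assumes d: "1 \<le> d"
  shows "uniform_sphere d = distr (gaussian d) (sphere_borel d) (direction d)"
proof (rule measure_eqI)
  let ?L = "Pi\<^sub>M {1..d} (\<lambda>_. lborel :: real measure)"
  interpret G: prob_space "gaussian d" by (rule prob_space_gaussian)
  have sL: "sets ?L = sets (Pi\<^sub>M {1..d} (\<lambda>_. borel))" by (intro sets_PiM_cong) auto
  have spL: "space ?L = {1..d} \<rightarrow>\<^sub>E UNIV" by (simp add: space_PiM)
  note measurable_direction_gaussian[OF d, measurable]
  have [measurable]: "direction d \<in> measurable ?L (sphere_borel d)"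
    using measurable_direction[OF d] by (subst measurable_cong_sets[OF sL refl])
  have [measurable]: "enorm d \<in> borel_measurable ?L"
    using enorm_measurable[of d] by (subst measurable_cong_sets[OF sL refl])
  show "sets (uniform_sphere d) = sets (distr (gaussian d) (sphere_borel d) (direction d))"
    by (simp add: uniform_sphere_def)
  fix A assume "A \<in> sets (uniform_sphere d)"
  then have A [measurable]: "A \<in> sets (sphere_borel d)" by (simp add: uniform_sphere_def)
  define C where "C A = {x \<in> space ?L. 0 < enorm d x \<and> direction d x \<in> A}" for A
  have C [measurable]: "C A \<in> sets ?L" if [measurable]: "A \<in> sets (sphere_borel d)" for A
    unfolding C_def by measurable
  have cone: "(\<lambda>i\<in>{1..d}. t * x i) \<in> C A \<longleftrightarrow> x \<in> C A" if t: "0 < t" and x: "x \<in> {1..d} \<rightarrow>\<^sub>E UNIV" for t x A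
  proof -
    note e = enorm_scale[OF t, of d x]
    have "normalize_vec d (\<lambda>i\<in>{1..d}. t * x i) = normalize_vec d x"
      using t by (auto simp: normalize_vec_def e fun_eq_iff)
    moreover have "0 < t * enorm d x \<longleftrightarrow> 0 < enorm d x"
      using t by (simp add: zero_less_mult_iff)
    ultimately show ?thesis
      using t x by (auto simp: C_def spL e direction_def)
  qed
  obtain K where K0: "\<forall>C\<in>sets ?L. (\<forall>x\<in>{1..d} \<rightarrow>\<^sub>E UNIV. \<forall>t>0. (\<lambda>i\<in>{1..d}. t * x i) \<in> C \<longleftrightarrow> x \<in> C) \<longrightarrow>
       emeasure (gaussian d) C = K * emeasure ?L {x \<in> C. enorm d x \<le> 1}"
    using gaussian_cone[of d] by (rule exE)
  have K: "emeasure (gaussian d) (C A) = K * emeasure ?L {x \<in> C A. enorm d x \<le> 1}"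
    if "A \<in> sets (sphere_borel d)" for A
    by (rule K0[rule_format, OF C[OF that]]) (rule cone)
  have G: "emeasure (gaussian d) (C A) = emeasure (distr (gaussian d) (sphere_borel d) (direction d)) A"
    if [measurable]: "A \<in> sets (sphere_borel d)" for A
  proof -
    have "emeasure (gaussian d) (C A) = emeasure (gaussian d) (direction d -` A \<inter> space (gaussian d))"
    proof (rule emeasure_eq_AE)
      show "AE x in gaussian d. (x \<in> C A) = (x \<in> direction d -` A \<inter> space (gaussian d))"
        using gaussian_enorm_pos[OF d] by eventually_elim (auto simp: C_def spL space_gaussian)
      show "C A \<in> sets (gaussian d)" using C[OF that] by (simp add: sL sets_gaussian)
    qed measurable
    then show ?thesis by (simp add: emeasure_distr)
  qed
  have ball: "{x \<in> C (unit_sphere d). enorm d x \<le> 1} = punctured_ball d"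
    using direction_in_sphere[OF d] by (auto simp: C_def punctured_ball_def spL)
  have us: "unit_sphere d \<in> sets (sphere_borel d)" "space (sphere_borel d) = unit_sphere d"
  proof -
    show 1: "space (sphere_borel d) = unit_sphere d"
      by (auto simp: sphere_borel_def space_restrict_space space_PiM unit_sphere_def)
    show "unit_sphere d \<in> sets (sphere_borel d)" using sets.top[of "sphere_borel d"] by (simp add: 1)
  qed
  interpret D: prob_space "distr (gaussian d) (sphere_borel d) (direction d)"
    by (rule G.prob_space_distr) measurable
  have "K * emeasure ?L (punctured_ball d) = 1"
    using K[OF us(1)] G[OF us(1)] D.emeasure_space_1 us(2) by (simp add: ball)
  then have K_eq: "K = 1 / emeasure ?L (punctured_ball d)"
    using emeasure_punctured_ball[OF d] by (metis ennreal_mult_divide_eq infinity_ennreal_def mult.commute one_neq_zero mult_zero_left)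
  have nd: "normalize_vec d -` A \<inter> punctured_ball d = {x \<in> C A. enorm d x \<le> 1}"
    by (auto simp: C_def punctured_ball_def spL direction_def)
  have ndL: "{x \<in> C A. enorm d x \<le> 1} \<subseteq> punctured_ball d" using nd by auto
  have "{x \<in> space ?L. x \<in> C A \<and> enorm d x \<le> 1} \<in> sets ?L" using C[OF A] by measurable
  also have "{x \<in> space ?L. x \<in> C A \<and> enorm d x \<le> 1} = {x \<in> C A. enorm d x \<le> 1}" by (auto simp: C_def)
  finally have S: "{x \<in> C A. enorm d x \<le> 1} \<in> sets ?L" .
  have "emeasure (uniform_sphere d) A = emeasure (uniform_measure ?L (punctured_ball d)) {x \<in> C A. enorm d x \<le> 1}"
    unfolding uniform_sphere_def
    using punctured_ball_sets[of d] A ndL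
    by (simp add: emeasure_distr[OF normalize_vec_measurable] space_restrict_space emeasure_restrict_space nd
        Int_absorb2 Int_absorb1 sets.sets_into_space)
  also have "\<dots> = emeasure ?L {x \<in> C A. enorm d x \<le> 1} / emeasure ?L (punctured_ball d)"
    using S punctured_ball_sets[of d] ndL by (simp add: emeasure_uniform_measure Int_absorb1)
  also have "\<dots> = K * emeasure ?L {x \<in> C A. enorm d x \<le> 1}"
    by (subst mult.commute) (simp only: K_eq ennreal_times_divide mult_1_right)
  also have "\<dots> = emeasure (distr (gaussian d) (sphere_borel d) (direction d)) A"
    using K[OF A] G[OF A] by simp
  finally show "emeasure (uniform_sphere d) A = emeasure (distr (gaussian d) (sphere_borel d) (direction d)) A" .
qed

lemma sets_uniform_sphere [measurable_cong]: "sets (uniform_sphere d) = sets (sphere_borel d)"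
  by (simp add: uniform_sphere_def)

lemma space_sphere_borel: "space (sphere_borel d) = unit_sphere d"
  by (auto simp: sphere_borel_def space_restrict_space space_PiM unit_sphere_def)

lemma space_uniform_sphere: "space (uniform_sphere d) = unit_sphere d"
  by (simp add: uniform_sphere_def space_sphere_borel)

lemma measurable_sphere_component:
  "i \<in> {1..d} \<Longrightarrow> (\<lambda>u. u i) \<in> borel_measurable (sphere_borel d)"
  unfolding sphere_borel_def by (intro measurable_restrict_space1 measurable_component_singleton)

lemma measurable_uniform_sphere_component:
  "i \<in> {1..d} \<Longrightarrow> (\<lambda>u. u i) \<in> borel_measurable (uniform_sphere d)"
  using measurable_sphere_component by (subst measurable_cong_sets[OF sets_uniform_sphere refl])

section \<open>Gaussian projections in high dimension\<close>

lemma dot_commute: "dot d x y = dot d y x"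
  by (simp add: dot_def mult.commute)

lemma dot_diff_right: "dot d x (\<lambda>i. y i - z i) = dot d x y - dot d x z"
  by (simp add: dot_def sum_subtractf right_diff_distrib)

lemma dot_diff_left: "dot d (\<lambda>i. y i - z i) x = dot d y x - dot d z x"
  by (simp add: dot_def sum_subtractf left_diff_distrib)

lemma dot_scale_right: "dot d x (\<lambda>i. c * y i) = c * dot d x y"
  by (simp add: dot_def sum_distrib_left mult.left_commute)

lemma dot_scale_left: "dot d (\<lambda>i. c * y i) x = c * dot d y x"
  by (simp add: dot_def sum_distrib_left mult.assoc)

lemma dot_sum_right: "dot d x (\<lambda>i. \<Sum>k\<in>K. c k * e k i) = (\<Sum>k\<in>K. c k * dot d x (e k))"
  unfolding dot_def by (simp add: sum_distrib_left mult.left_commute) (rule sum.swap)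

lemma dot_measurable_left [measurable]: "(\<lambda>g. dot d g v) \<in> borel_measurable (Pi\<^sub>M {1..d} (\<lambda>_. borel))"
  unfolding dot_def by measurable

lemma measurable_dot:
  assumes "\<And>i. i \<in> {1..d} \<Longrightarrow> (\<lambda>p. f p i) \<in> borel_measurable M" "\<And>i. i \<in> {1..d} \<Longrightarrow> (\<lambda>p. g p i) \<in> borel_measurable M"
  shows "(\<lambda>p. dot d (f p) (g p)) \<in> borel_measurable M"
  unfolding dot_def using assms by (intro borel_measurable_sum borel_measurable_times)

lemma iexp_dot_gaussian: "(CLINT g|gaussian d. iexp (dot d g v)) = exp (- dot d v v / 2)"
proof -
  interpret N: product_sigma_finite "\<lambda>_. std_normal_distribution" by (rule product_sigma_finite_std_normal)
  have "(CLINT g|gaussian d. iexp (dot d g v)) = (CLINT g|gaussian d. (\<Prod>i\<in>{1..d}. iexp (v i * g i)))"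
    by (intro Bochner_Integration.integral_cong refl)
       (simp add: dot_def exp_sum[symmetric] sum_distrib_left mult.commute)
  also have "\<dots> = (\<Prod>i\<in>{1..d}. char std_normal_distribution (v i))"
    unfolding gaussian_def char_def
    by (intro N.product_integral_prod prob_space.integrable_iexp prob_space_std_normal) auto
  also have "\<dots> = complex_of_real (\<Prod>i\<in>{1..d}. exp (- (v i)\<^sup>2 / 2))"
    unfolding char_std_normal_distribution by simp
  also have "(\<Prod>i\<in>{1..d}. exp (- (v i)\<^sup>2 / 2)) = exp (- dot d v v / 2)"
    by (simp add: exp_sum[symmetric] dot_def power2_eq_square sum_negf sum_divide_distrib)
  finally show ?thesis by simp
qed

lemma distr_gaussian_dot:
  "distr (gaussian d) borel (\<lambda>g. dot d g v) = distr std_normal_distribution borel (\<lambda>z. enorm d v * z)"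
proof (rule Levy_uniqueness)
  show "real_distribution (distr (gaussian d) borel (\<lambda>g. dot d g v))"
    by (intro prob_space.real_distribution_distr prob_space_gaussian) measurable
  show "real_distribution (distr std_normal_distribution borel (\<lambda>z. enorm d v * z))"
    by (intro prob_space.real_distribution_distr prob_space_std_normal) simp
  show "char (distr (gaussian d) borel (\<lambda>g. dot d g v)) = char (distr std_normal_distribution borel (\<lambda>z. enorm d v * z))"
  proof
    fix t
    have "char (distr (gaussian d) borel (\<lambda>g. dot d g v)) t = (CLINT g|gaussian d. iexp (dot d g (\<lambda>i. t * v i)))"
      unfolding char_def by (subst integral_distr) (auto simp: dot_scale_right)
    also have "\<dots> = exp (- (t\<^sup>2 * dot d v v) / 2)"
      unfolding iexp_dot_gaussian by (simp add: dot_scale_right dot_scale_left power2_eq_square)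
    also have "\<dots> = char std_normal_distribution (t * enorm d v)"
      unfolding char_std_normal_distribution by (simp add: power_mult_distrib enorm_power2)
    also have "\<dots> = char (distr std_normal_distribution borel (\<lambda>z. enorm d v * z)) t"
      unfolding char_def by (subst integral_distr) (auto simp: mult.assoc)
    finally show "char (distr (gaussian d) borel (\<lambda>g. dot d g v)) t = char (distr std_normal_distribution borel (\<lambda>z. enorm d v * z)) t" .
  qed
qed

text \<open>
  The rotation invariance of the Gaussian measure, in the form needed here: coordinates along an
  orthonormal family are independent standard normal, because their joint characteristic function
  depends on the norm of the argument only and so factorizes.
\<close>

lemma distr_gaussian_orthonormal:
  assumes e: "\<And>j k. j \<in> {1..n} \<Longrightarrow> k \<in> {1..n} \<Longrightarrow> dot d (e j) (e k) = (if j = k then 1 else 0)"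
  shows "distr (gaussian d) (Pi\<^sub>M {1..n} (\<lambda>_. borel)) (\<lambda>g. \<lambda>k\<in>{1..n}. dot d g (e k)) = gaussian n"
proof -
  interpret G: prob_space "gaussian d" by (rule prob_space_gaussian)
  have one: "distr (gaussian d) borel (\<lambda>g. dot d g (e k)) = std_normal_distribution" if "k \<in> {1..n}" for k
  proof -
    have "enorm d (e k) = 1" using e[OF that that] by (simp add: enorm_def)
    then have "(\<lambda>z. enorm d (e k) * z) = (\<lambda>z. z)" by (simp add: fun_eq_iff)
    then show ?thesis unfolding distr_gaussian_dot by (simp only:) (simp add: distr_id2)
  qed
  have "(CLINT g|gaussian d. (\<Prod>k\<in>{1..n}. iexp (t k * dot d g (e k)))) = (\<Prod>k\<in>{1..n}. CLINT g|gaussian d. iexp (t k * dot d g (e k)))" for t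
  proof -
    have "(CLINT g|gaussian d. (\<Prod>k\<in>{1..n}. iexp (t k * dot d g (e k)))) = (CLINT g|gaussian d. iexp (dot d g (\<lambda>i. \<Sum>k\<in>{1..n}. t k * e k i)))"
      unfolding dot_sum_right by (simp add: exp_sum[symmetric] sum_distrib_left)
    also have "\<dots> = complex_of_real (exp (- (\<Sum>k\<in>{1..n}. (t k)\<^sup>2) / 2))"
    proof -
      have "dot d (\<lambda>i. \<Sum>k\<in>{1..n}. t k * e k i) (\<lambda>i. \<Sum>k\<in>{1..n}. t k * e k i) = (\<Sum>k\<in>{1..n}. \<Sum>j\<in>{1..n}. t k * (t j * dot d (e k) (e j)))"
        unfolding dot_sum_right by (subst dot_commute) (simp add: dot_sum_right sum_distrib_left)
      also have "\<dots> = (\<Sum>k\<in>{1..n}. \<Sum>j\<in>{1..n}. if k = j then (t k)\<^sup>2 else 0)"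
        by (intro sum.cong refl) (auto simp: e power2_eq_square)
      also have "\<dots> = (\<Sum>k\<in>{1..n}. (t k)\<^sup>2)"
        by simp
      finally show ?thesis unfolding iexp_dot_gaussian by simp
    qed
    also have "\<dots> = (\<Prod>k\<in>{1..n}. complex_of_real (exp (- (t k)\<^sup>2 / 2)))"
      by (simp add: exp_sum[symmetric] sum_negf sum_divide_distrib flip: of_real_prod)
    also have "\<dots> = (\<Prod>k\<in>{1..n}. CLINT g|gaussian d. iexp (t k * dot d g (e k)))"
    proof (intro prod.cong refl)
      fix k assume k: "k \<in> {1..n}"
      have "(CLINT g|gaussian d. iexp (t k * dot d g (e k))) = (CLINT g|gaussian d. iexp (dot d g (\<lambda>i. t k * e k i)))"
        by (simp add: dot_scale_right)
      also have "\<dots> = exp (- (t k)\<^sup>2 / 2)"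
        unfolding iexp_dot_gaussian by (simp add: dot_scale_right dot_scale_left e[OF k k] power2_eq_square)
      finally show "complex_of_real (exp (- (t k)\<^sup>2 / 2)) = (CLINT g|gaussian d. iexp (t k * dot d g (e k)))" by simp
    qed
    finally show ?thesis .
  qed
  then have "distr (gaussian d) (Pi\<^sub>M {1..n} (\<lambda>_. borel)) (\<lambda>g. \<lambda>k\<in>{1..n}. dot d g (e k)) = Pi\<^sub>M {1..n} (\<lambda>k. distr (gaussian d) borel (\<lambda>g. dot d g (e k)))"
    by (intro G.char_factor_imp_distr_PiM) auto
  also have "\<dots> = gaussian n"
    unfolding gaussian_def[of n] by (intro PiM_cong refl one)
  finally show ?thesis .
qed

lemma gaussian_dot_tail:
  assumes "0 < \<eta>"
  shows "measure (gaussian d) {g \<in> space (gaussian d). \<eta> \<le> \<bar>dot d g v\<bar>} \<le> dot d v v / \<eta>\<^sup>2"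
proof -
  interpret G: prob_space "gaussian d" by (rule prob_space_gaussian)
  let ?D = "distr (gaussian d) borel (\<lambda>g. dot d g v)"
  have D: "?D = distr std_normal_distribution borel (\<lambda>z. enorm d v * z)" by (rule distr_gaussian_dot)
  have i2: "integrable std_normal_distribution (\<lambda>z. (enorm d v * z)\<^sup>2)"
    using std_normal_distribution_even_moments(2)[of 1] by (simp add: power_mult_distrib)
  then have "integrable ?D (\<lambda>x. x\<^sup>2)"
    unfolding D by (subst integrable_distr_eq) auto
  then have int: "integrable (gaussian d) (\<lambda>g. (dot d g v)\<^sup>2)"
    by (subst (asm) integrable_distr_eq) auto
  have "(LINT g|gaussian d. (dot d g v)\<^sup>2) = (LINT x|?D. x\<^sup>2)"
    by (subst integral_distr) auto
  also have "\<dots> = (LINT z|std_normal_distribution. (enorm d v * z)\<^sup>2)"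
    unfolding D by (subst integral_distr) auto
  also have "\<dots> = dot d v v"
    using std_normal_distribution_even_moments(1)[of 1] by (simp add: power_mult_distrib enorm_power2)
  finally have second: "(LINT g|gaussian d. (dot d g v)\<^sup>2) = dot d v v" .
  show ?thesis
    using G.second_moment_method[OF _ int assms] by (simp add: second)
qed

text \<open>
  The centred squares \<open>q (g i)\<close> are uncorrelated with variance $2$, so Chebyshev's inequality applies.
\<close>

lemma gaussian_norm_concentration:
  assumes d: "1 \<le> d" and \<eta>: "0 < \<eta>"
  shows "measure (gaussian d) {g \<in> space (gaussian d). \<eta> \<le> \<bar>dot d g g / d - 1\<bar>} \<le> 2 / (d * \<eta>\<^sup>2)"
proof -
  interpret G: prob_space "gaussian d" by (rule prob_space_gaussian)
  interpret N: product_sigma_finite "\<lambda>_. std_normal_distribution" by (rule product_sigma_finite_std_normal)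
  interpret N1: prob_space std_normal_distribution by (rule prob_space_std_normal)
  define q :: "real \<Rightarrow> real" where "q = (\<lambda>x. x\<^sup>2 - 1)"
  have m2: "(LINT x|std_normal_distribution. x\<^sup>2) = 1" "integrable std_normal_distribution (\<lambda>x. x\<^sup>2)"
    using std_normal_distribution_even_moments[of 1] by simp_all
  have m4: "(LINT x|std_normal_distribution. x^4) = 3" "integrable std_normal_distribution (\<lambda>x. x^4)"
    using std_normal_distribution_even_moments[of 2] by (simp_all add: fact_numeral)
  have q1: "integrable std_normal_distribution q" "(LINT x|std_normal_distribution. q x) = 0"
    using m2 N1.prob_space by (simp_all add: q_def)
  have qq: "q x * q x = x^4 - 2 * x\<^sup>2 + 1" for x
    by (simp add: q_def power2_eq_square power4_eq_xxxx algebra_simps)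
  have q2: "integrable std_normal_distribution (\<lambda>x. q x * q x)" "(LINT x|std_normal_distribution. q x * q x) = 2"
    unfolding qq using m2 m4 N1.prob_space by simp_all
  define h where "h = (\<lambda>(i::nat) j k x. (if k = i then q x else 1) * (if k = j then q x else 1))"
  have h_int: "integrable std_normal_distribution (h i j k)" for i j k
    unfolding h_def using q1 q2 by (cases "k = i"; cases "k = j") auto
  have prod_h: "q (g i) * q (g j) = (\<Prod>k\<in>{1..d}. h i j k (g k))" if "i \<in> {1..d}" "j \<in> {1..d}" for i j g
    using that by (simp add: h_def prod.distrib)
  have pair_int: "integrable (gaussian d) (\<lambda>g. q (g i) * q (g j))" if "i \<in> {1..d}" "j \<in> {1..d}" for i j
    unfolding prod_h[OF that] gaussian_def by (intro N.product_integrable_prod h_int) simp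
  have pair: "(LINT g|gaussian d. q (g i) * q (g j)) = (if i = j then 2 else 0)" if "i \<in> {1..d}" "j \<in> {1..d}" for i j
  proof -
    have "(LINT g|gaussian d. q (g i) * q (g j)) = (\<Prod>k\<in>{1..d}. LINT x|std_normal_distribution. h i j k x)"
      unfolding prod_h[OF that] gaussian_def by (intro N.product_integral_prod h_int) simp
    also have "\<dots> = (if i = j then 2 else 0)"
    proof (cases "i = j")
      case True
      have "(LINT x|std_normal_distribution. h i j k x) = (if k = i then 2 else 1)" for k
        using True q2 N1.prob_space by (simp add: h_def)
      then show ?thesis using True that by simp
    next
      case False
      have "(LINT x|std_normal_distribution. h i j i x) = 0"
        using False q1 by (simp add: h_def)
      then have "\<exists>k\<in>{1..d}. (LINT x|std_normal_distribution. h i j k x) = 0" using that by blast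
      then show ?thesis using False by (simp add: prod_zero_iff)
    qed
    finally show ?thesis .
  qed
  let ?f = "\<lambda>g. dot d g g / d - 1"
  have f: "?f g = (\<Sum>i\<in>{1..d}. q (g i)) / d" for g
    using d by (simp add: q_def dot_def power2_eq_square sum_subtractf diff_divide_distrib)
  have f2: "(?f g)\<^sup>2 = (\<Sum>i\<in>{1..d}. \<Sum>j\<in>{1..d}. q (g i) * q (g j)) / d\<^sup>2" for g
    unfolding f by (simp add: power_divide power2_eq_square sum_product)
  have int: "integrable (gaussian d) (\<lambda>g. (?f g)\<^sup>2)"
    unfolding f2 by (intro integrable_divide_zero Bochner_Integration.integrable_sum pair_int)
  have "(LINT g|gaussian d. (?f g)\<^sup>2) = (\<Sum>i\<in>{1..d}. \<Sum>j\<in>{1..d}. if i = j then 2 else 0) / d\<^sup>2"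
  proof -
    have "(LINT g|gaussian d. (\<Sum>i\<in>{1..d}. \<Sum>j\<in>{1..d}. q (g i) * q (g j)))
        = (\<Sum>i\<in>{1..d}. LINT g|gaussian d. (\<Sum>j\<in>{1..d}. q (g i) * q (g j)))"
      by (intro Bochner_Integration.integral_sum Bochner_Integration.integrable_sum pair_int)
    also have "\<dots> = (\<Sum>i\<in>{1..d}. \<Sum>j\<in>{1..d}. LINT g|gaussian d. q (g i) * q (g j))"
      by (intro sum.cong refl Bochner_Integration.integral_sum pair_int)
    also have "\<dots> = (\<Sum>i\<in>{1..d}. \<Sum>j\<in>{1..d}. if i = j then 2 else 0)"
      by (intro sum.cong refl pair)
    finally show ?thesis
      unfolding f2 by (subst integral_divide_zero) simp
  qed
  also have "\<dots> = 2 / d"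
    by (simp add: power2_eq_square)
  finally have second: "(LINT g|gaussian d. (?f g)\<^sup>2) = 2 / d" .
  have "measure (gaussian d) {g \<in> space (gaussian d). \<eta> \<le> \<bar>?f g\<bar>} \<le> (LINT g|gaussian d. (?f g)\<^sup>2) / \<eta>\<^sup>2"
    by (rule G.second_moment_method[OF _ int \<eta>]) measurable
  then show ?thesis unfolding second by simp
qed

text \<open>
  Three unit vectors with small mutual inner products are close to an orthonormal frame. The bound on
  the displacement comes from $|u - e|^2 = 2 - 2 \langle u, e\rangle$, where
  $\langle u, e\rangle$ is the length left after subtracting the projections: this length is
  \<open>s\<close> for the second vector and \<open>\<tau>\<close> for the third.
\<close>

lemma gram_schmidt3:
  fixes u :: "nat \<Rightarrow> nat \<Rightarrow> real"
  assumes unit: "\<And>i. i \<in> {1..3} \<Longrightarrow> dot d (u i) (u i) = 1"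
    and near: "\<And>i j. i \<in> {1..3} \<Longrightarrow> j \<in> {1..3} \<Longrightarrow> i \<noteq> j \<Longrightarrow> \<bar>dot d (u i) (u j)\<bar> \<le> \<delta>"
    and \<delta>: "\<delta> < 1 / 2"
  shows "\<exists>e. (\<forall>i\<in>{1..3}. \<forall>j\<in>{1..3}. dot d (e i) (e j) = (if i = j then 1 else 0)) \<and>
    (\<forall>i\<in>{1..3}. dot d (\<lambda>k. u i k - e i k) (\<lambda>k. u i k - e i k) \<le> 8 * \<delta>\<^sup>2)"
proof -
  define a b c where "a = dot d (u 1) (u 2)" and "b = dot d (u 1) (u 3)" and "c = dot d (u 2) (u 3)"
  have abc: "\<bar>a\<bar> \<le> \<delta>" "\<bar>b\<bar> \<le> \<delta>" "\<bar>c\<bar> \<le> \<delta>"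
    using near[of 1 2] near[of 1 3] near[of 2 3] by (simp_all add: a_def b_def c_def)
  have \<delta>0: "0 \<le> \<delta>" using abc by linarith
  have sq: "x\<^sup>2 \<le> \<delta>\<^sup>2" if "\<bar>x\<bar> \<le> \<delta>" for x :: real
    using that by (metis abs_ge_zero power2_abs power_mono)
  have \<delta>2: "\<delta>\<^sup>2 < 1 / 4"
    using power_strict_mono[OF \<delta> \<delta>0, of 2] by (simp add: power_divide)
  define s where "s = sqrt (1 - a\<^sup>2)"
  have s2: "s\<^sup>2 = 1 - a\<^sup>2" and s34: "3 / 4 < s\<^sup>2" and s0: "0 < s"
    using sq[OF abc(1)] \<delta>2 by (simp_all add: s_def)
  define e2 where "e2 k = (1 / s) * (u 2 k - a * u 1 k)" for k
  define \<beta> where "\<beta> = dot d (u 3) e2"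
  have \<beta>: "\<beta> = (c - a * b) / s"
    unfolding \<beta>_def e2_def dot_scale_right dot_diff_right
    by (simp add: a_def b_def c_def dot_commute[of d "u 3"])
  have "\<bar>c - a * b\<bar> \<le> (3 / 2) * \<delta>"
  proof -
    have "\<bar>a * b\<bar> \<le> \<delta> * (1 / 2)"
      unfolding abs_mult using abc \<delta> \<delta>0 by (intro mult_mono) auto
    then show ?thesis using abc by linarith
  qed
  then have "(c - a * b)\<^sup>2 \<le> ((3 / 2) * \<delta>)\<^sup>2"
    using \<delta>0 by (metis abs_ge_zero power2_abs power_mono)
  then have "\<beta>\<^sup>2 * s\<^sup>2 \<le> (9 / 4) * \<delta>\<^sup>2"
    using s0 by (simp add: \<beta> power_divide power_mult_distrib)
  moreover have "\<beta>\<^sup>2 * (3 / 4) \<le> \<beta>\<^sup>2 * s\<^sup>2" using s34 by (intro mult_left_mono) auto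
  ultimately have \<beta>2: "\<beta>\<^sup>2 \<le> 3 * \<delta>\<^sup>2" by simp
  define \<tau> where "\<tau> = sqrt (1 - b\<^sup>2 - \<beta>\<^sup>2)"
  have pos: "0 < 1 - b\<^sup>2 - \<beta>\<^sup>2" using sq[OF abc(2)] \<beta>2 \<delta>2 by linarith
  then have \<tau>2: "\<tau>\<^sup>2 = 1 - b\<^sup>2 - \<beta>\<^sup>2" and \<tau>0: "0 < \<tau>" by (simp_all add: \<tau>_def)
  define e3 where "e3 k = (1 / \<tau>) * (u 3 k - b * u 1 k - \<beta> * e2 k)" for k
  have u: "dot d (u 1) (u 1) = 1" "dot d (u 2) (u 2) = 1" "dot d (u 3) (u 3) = 1" using unit by simp_all
  have a': "dot d (u 2) (u 1) = a" and b': "dot d (u 3) (u 1) = b" and c': "dot d (u 3) (u 2) = c"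
    by (simp_all add: a_def b_def c_def dot_commute)
  note dots = dot_scale_right dot_scale_left dot_diff_right dot_diff_left u a' b' c' a_def[symmetric] b_def[symmetric] c_def[symmetric]
  have e12: "dot d (u 1) e2 = 0" unfolding e2_def dots by simp
  have e22: "dot d e2 e2 = 1"
  proof -
    have "dot d e2 e2 = (1 / s) * ((1 / s) * (1 - a * a) - a * ((1 / s) * (a - a * 1)))"
      unfolding e2_def dots ..
    also have "\<dots> = (1 - a\<^sup>2) / s\<^sup>2" by (simp add: power2_eq_square)
    finally show ?thesis using s0 by (simp add: s2[symmetric])
  qed
  have u2e2: "dot d (u 2) e2 = s"
  proof -
    have "dot d (u 2) e2 = (1 / s) * (1 - a * a)" unfolding e2_def dots ..
    also have "1 - a * a = s * s" using s2 by (simp add: power2_eq_square)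
    finally show ?thesis using s0 by simp
  qed
  have u3e2: "dot d (u 3) e2 = \<beta>" by (simp add: \<beta>_def)
  have e13: "dot d (u 1) e3 = 0" unfolding e3_def dots e12 by simp
  have e23: "dot d e2 e3 = 0"
    unfolding e3_def dots e22 dot_commute[of d e2 "u 3"] dot_commute[of d e2 "u 1"] u3e2 e12 by simp
  have e32: "dot d e3 e2 = 0" using e23 by (simp add: dot_commute)
  have u3e3: "dot d (u 3) e3 = \<tau>"
  proof -
    have "dot d (u 3) e3 = (1 / \<tau>) * (1 - b * b - \<beta> * \<beta>)" unfolding e3_def dots u3e2 ..
    also have "1 - b * b - \<beta> * \<beta> = \<tau> * \<tau>" using \<tau>2 by (simp add: power2_eq_square)
    finally show ?thesis using \<tau>0 by simp
  qed
  have e33: "dot d e3 e3 = 1"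
  proof -
    have "dot d e3 e3 = (1 / \<tau>) * (dot d e3 (u 3) - b * dot d e3 (u 1) - \<beta> * dot d e3 e2)"
    proof -
      have "e3 = (\<lambda>k. (1 / \<tau>) * (u 3 k - b * u 1 k - \<beta> * e2 k))"
        unfolding e3_def ..
      from arg_cong[OF this, of "dot d e3"] show ?thesis
        by (simp only: dot_scale_right dot_diff_right)
    qed
    then show ?thesis
      using \<tau>0 by (simp add: dot_commute[of d e3 "u 3"] dot_commute[of d e3 "u 1"] u3e3 e13 e32)
  qed
  define e where "e i = (if i = 1 then u 1 else if i = 2 then e2 else e3)" for i :: nat
  have I3: "{1..3} = {1, 2, 3::nat}" by auto
  have orth: "\<forall>i\<in>{1..3}. \<forall>j\<in>{1..3}. dot d (e i) (e j) = (if i = j then 1 else 0)"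
    unfolding I3
    by (simp add: e_def u e12 e13 e22 e23 e32 e33 dot_commute[of d e2 "u 1"] dot_commute[of d e3 "u 1"])
  have dist: "dot d (\<lambda>k. x k - y k) (\<lambda>k. x k - y k) = 2 - 2 * dot d x y" if "dot d x x = 1" "dot d y y = 1" for x y
    using that by (simp add: dot_diff_right dot_diff_left dot_commute[of d y x])
  have root: "2 - 2 * r \<le> 2 * (1 - r\<^sup>2)" if "0 < r" "r\<^sup>2 \<le> 1" for r :: real
  proof -
    have "r \<le> 1" using that by (simp add: abs_square_le_1 abs_le_iff)
    then have "r\<^sup>2 \<le> r" using that by (simp add: power2_eq_square mult_left_le)
    then show ?thesis by simp
  qed
  have "2 - 2 * s \<le> 2 * (1 - s\<^sup>2)" by (rule root) (use s0 s2 in auto)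
  also have "\<dots> \<le> 2 * \<delta>\<^sup>2" using sq[OF abc(1)] by (simp add: s2)
  also have "\<dots> \<le> 8 * \<delta>\<^sup>2" by simp
  finally have d2: "2 - 2 * s \<le> 8 * \<delta>\<^sup>2" .
  have "2 - 2 * \<tau> \<le> 2 * (1 - \<tau>\<^sup>2)" by (rule root) (use \<tau>0 \<tau>2 in auto)
  then have d3: "2 - 2 * \<tau> \<le> 8 * \<delta>\<^sup>2" unfolding \<tau>2 using sq[OF abc(2)] \<beta>2 by simp
  have "\<forall>i\<in>{1..3}. dot d (\<lambda>k. u i k - e i k) (\<lambda>k. u i k - e i k) \<le> 8 * \<delta>\<^sup>2"
    unfolding I3 using d2 d3 by (simp add: e_def dist u e22 e33 u2e2 u3e3 dot_def[of d "\<lambda>k. 0"])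
  with orth show ?thesis by blast
qed

text \<open>
  Since $\sqrt d / |g| \to 1$, the rescaled inner product of the random direction with \<open>u d\<close>
  is asymptotically \<open>dot d g (u d)\<close>, hence asymptotically \<open>dot d g (e d)\<close>. The three bad events of
  the proof are a large \<open>dot d g (u d - e d)\<close>, a large \<open>dot d g (u d)\<close> and a bad norm of \<open>g\<close>.
\<close>

lemma gaussian_direction_score:
  fixes A :: "nat \<Rightarrow> real" and u e :: "nat \<Rightarrow> nat \<Rightarrow> real"
  assumes A: "A \<longlonglongrightarrow> \<tau>"
    and u: "\<And>d. 1 \<le> d \<Longrightarrow> dot d (u d) (u d) = 1"
    and near: "(\<lambda>d. dot d (\<lambda>k. u d k - e d k) (\<lambda>k. u d k - e d k)) \<longlonglongrightarrow> 0"
    and \<eta>: "0 < \<eta>"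
  shows "(\<lambda>d. measure (gaussian d) {g \<in> space (gaussian d).
      \<eta> \<le> \<bar>A d * (sqrt d * dot d (direction d g) (u d)) - \<tau> * dot d g (e d)\<bar>}) \<longlonglongrightarrow> 0"
proof (rule tendstoI)
  fix r :: real assume r: "0 < r"
  define T where "T = \<bar>\<tau>\<bar> + 1"
  have T: "0 < T" by (simp add: T_def)
  define K where "K = sqrt (4 / r)"
  have K: "0 < K" "1 / K\<^sup>2 = r / 4" using r by (simp_all add: K_def)
  define \<theta> where "\<theta> = min (1 / 2) (\<eta> / (16 * K * T))"
  have \<theta>: "0 < \<theta>" "\<theta> \<le> 1 / 2" "\<theta> \<le> \<eta> / (16 * K * T)" using \<eta> K T by (auto simp: \<theta>_def)
  have \<theta>': "2 * T * \<theta> * K \<le> \<eta> / 8"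
    using \<theta>(3) K T by (simp add: field_simps)
  have "(\<lambda>d. dot d (\<lambda>k. u d k - e d k) (\<lambda>k. u d k - e d k) / (\<eta> / (2 * T))\<^sup>2) \<longlonglongrightarrow> 0 / (\<eta> / (2 * T))\<^sup>2"
    by (intro tendsto_divide near tendsto_const) (use \<eta> T in auto)
  then have ev1: "\<forall>\<^sub>F d in sequentially. dot d (\<lambda>k. u d k - e d k) (\<lambda>k. u d k - e d k) / (\<eta> / (2 * T))\<^sup>2 < r / 4"
    using r by (intro order_tendstoD(2)[where y=0]) auto
  have "(\<lambda>d. (2 / \<theta>\<^sup>2) * (1 / real d)) \<longlonglongrightarrow> (2 / \<theta>\<^sup>2) * 0"
    by (intro tendsto_mult tendsto_const lim_1_over_n)
  then have ev2: "\<forall>\<^sub>F d in sequentially. (2 / \<theta>\<^sup>2) * (1 / real d) < r / 4"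
    using r by (intro order_tendstoD(2)[where y=0]) auto
  have ev3: "\<forall>\<^sub>F d in sequentially. \<bar>A d - \<tau>\<bar> < min 1 (\<eta> / (8 * K))"
    using tendstoD[OF A, of "min 1 (\<eta> / (8 * K))"] \<eta> K by (simp add: dist_real_def)
  show "\<forall>\<^sub>F d in sequentially. dist (measure (gaussian d) {g \<in> space (gaussian d).
      \<eta> \<le> \<bar>A d * (sqrt d * dot d (direction d g) (u d)) - \<tau> * dot d g (e d)\<bar>}) 0 < r"
    using ev1 ev2 ev3 eventually_ge_at_top[of 1]
  proof eventually_elim
    case (elim d)
    interpret G: prob_space "gaussian d" by (rule prob_space_gaussian)
    let ?v = "\<lambda>k. u d k - e d k"
    let ?E1 = "{g \<in> space (gaussian d). \<eta> / (2 * T) \<le> \<bar>dot d g ?v\<bar>}"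
    let ?E2 = "{g \<in> space (gaussian d). K \<le> \<bar>dot d g (u d)\<bar>}"
    let ?E3 = "{g \<in> space (gaussian d). \<theta> \<le> \<bar>dot d g g / d - 1\<bar>}"
    let ?E = "{g \<in> space (gaussian d). \<eta> \<le> \<bar>A d * (sqrt d * dot d (direction d g) (u d)) - \<tau> * dot d g (e d)\<bar>}"
    have sub: "?E \<subseteq> ?E1 \<union> ?E2 \<union> ?E3"
    proof (rule subsetI, rule ccontr)
      fix g assume g: "g \<in> ?E" and "g \<notin> ?E1 \<union> ?E2 \<union> ?E3"
      then have n1: "\<bar>dot d g ?v\<bar> < \<eta> / (2 * T)" and n2: "\<bar>dot d g (u d)\<bar> < K" and n3: "\<bar>dot d g g / d - 1\<bar> < \<theta>"
        by auto
      define p where "p = enorm d g / sqrt d"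
      have p2: "p\<^sup>2 = dot d g g / d" by (simp add: p_def power_divide enorm_power2)
      have p0: "0 \<le> p" by (simp add: p_def enorm_nonneg)
      have "1 / 2 < p\<^sup>2" unfolding p2 using n3 \<theta>(2) by linarith
      moreover from this have "0 < p" using p0 by (cases "p = 0") auto
      moreover have "1 / 2 < p"
      proof (rule ccontr)
        assume "\<not> 1 / 2 < p"
        then have "p\<^sup>2 \<le> (1 / 2)\<^sup>2" using p0 by (intro power_mono) auto
        with \<open>1 / 2 < p\<^sup>2\<close> show False by (simp add: power2_eq_square)
      qed
      ultimately have p: "0 < p" "1 / 2 < p" by auto
      have "\<bar>1 / p - 1\<bar> = \<bar>1 - p\<^sup>2\<bar> / (p * (1 + p))"
      proof -
        have "1 / p - 1 = (1 - p\<^sup>2) / (p * (1 + p))"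
        proof -
          have "1 - p\<^sup>2 = (1 - p) * (1 + p)" by (simp add: power2_eq_square algebra_simps)
          then have "(1 - p\<^sup>2) / (p * (1 + p)) = (1 - p) / p" using p by simp
          then show ?thesis using p by (simp add: diff_divide_distrib)
        qed
        then show ?thesis using p by (simp add: abs_mult)
      qed
      also have "\<dots> \<le> \<theta> / (1 / 2)"
      proof (rule frac_le)
        have "1 / 2 * 1 \<le> p * (1 + p)" using p by (intro mult_mono) auto
        then show "1 / 2 \<le> p * (1 + p)" by simp
      qed (use n3 \<theta> in \<open>auto simp: p2\<close>)
      finally have invp: "\<bar>1 / p - 1\<bar> \<le> 2 * \<theta>" by simp
      have en: "enorm d g \<noteq> 0" using p by (auto simp: p_def)
      have "dot d (direction d g) (u d) = dot d g (u d) / enorm d g"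
        using en unfolding direction_def normalize_vec_def dot_def by (simp add: sum_divide_distrib)
      then have dir: "sqrt d * dot d (direction d g) (u d) = dot d g (u d) * (1 / p)"
        by (simp add: p_def)
      have AT: "\<bar>A d\<bar> \<le> T" using elim(3) by (auto simp: T_def)
      have diff: "A d * (sqrt d * dot d (direction d g) (u d)) - \<tau> * dot d g (e d)
          = A d * (1 / p - 1) * dot d g (u d) + (A d - \<tau>) * dot d g (u d) + \<tau> * dot d g ?v"
        unfolding dir dot_diff_right by (simp add: algebra_simps)
      have "\<bar>A d * (1 / p - 1) * dot d g (u d)\<bar> \<le> T * (2 * \<theta>) * K"
        unfolding abs_mult using AT invp n2 T \<theta> by (intro mult_mono) auto
      moreover have "\<bar>(A d - \<tau>) * dot d g (u d)\<bar> \<le> \<eta> / (8 * K) * K"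
        unfolding abs_mult using elim(3) n2 \<eta> K by (intro mult_mono) auto
      moreover have "\<bar>\<tau> * dot d g ?v\<bar> \<le> T * (\<eta> / (2 * T))"
        unfolding abs_mult using n1 T by (intro mult_mono) (auto simp: T_def)
      moreover have "T * (2 * \<theta>) * K \<le> \<eta> / 8" "\<eta> / (8 * K) * K = \<eta> / 8" "T * (\<eta> / (2 * T)) = \<eta> / 2"
        using \<theta>' K T by (simp_all add: mult_ac)
      ultimately have "\<bar>A d * (sqrt d * dot d (direction d g) (u d)) - \<tau> * dot d g (e d)\<bar> \<le> \<eta> / 8 + \<eta> / 8 + \<eta> / 2"
        unfolding diff by linarith
      with g \<eta> show False by auto
    qed
    have [measurable]: "?E1 \<in> sets (gaussian d)" "?E2 \<in> sets (gaussian d)" "?E3 \<in> sets (gaussian d)" by measurable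
    have "measure (gaussian d) ?E \<le> measure (gaussian d) (?E1 \<union> ?E2 \<union> ?E3)"
      by (rule G.finite_measure_mono[OF sub]) measurable
    also have "\<dots> \<le> measure (gaussian d) ?E1 + measure (gaussian d) ?E2 + measure (gaussian d) ?E3"
      by (intro order_trans[OF measure_Un_le] add_mono order_refl) measurable
    also have "measure (gaussian d) ?E1 \<le> dot d ?v ?v / (\<eta> / (2 * T))\<^sup>2"
      by (rule gaussian_dot_tail) (use \<eta> T in auto)
    also have "measure (gaussian d) ?E2 \<le> 1 / K\<^sup>2"
      using gaussian_dot_tail[OF K(1), of d "u d"] u[OF elim(4)] by simp
    also have "measure (gaussian d) ?E3 \<le> 2 / (d * \<theta>\<^sup>2)"
      by (rule gaussian_norm_concentration[OF elim(4) \<theta>(1)])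
    finally have "measure (gaussian d) ?E \<le> dot d ?v ?v / (\<eta> / (2 * T))\<^sup>2 + 1 / K\<^sup>2 + 2 / (d * \<theta>\<^sup>2)"
      by simp
    also have "\<dots> < r / 4 + r / 4 + r / 4"
      using elim(1,2) K(2) by (simp add: mult.commute)
    finally show ?case using r by simp
  qed
qed

section \<open>Scaling of the hyperbolic radii\<close>

lemma borel_measurable_cosh_real [measurable]: "(cosh :: real \<Rightarrow> real) \<in> borel_measurable borel"
  by (intro borel_measurable_continuous_onI continuous_intros)

lemma borel_measurable_sinh_real [measurable]: "(sinh :: real \<Rightarrow> real) \<in> borel_measurable borel"
  by (intro borel_measurable_continuous_onI continuous_intros)

lemma borel_measurable_coth [measurable]: "coth \<in> borel_measurable borel"
  unfolding coth_def[abs_def] by measurable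

lemma sinh_scaled_tendsto:
  fixes \<delta> w :: "nat \<Rightarrow> real"
  assumes \<delta>: "\<delta> \<longlonglongrightarrow> 0" and pos: "\<And>d. 1 \<le> d \<Longrightarrow> 0 < \<delta> d" and w: "w \<longlonglongrightarrow> x"
  shows "(\<lambda>d. sinh (\<delta> d * w d) / \<delta> d) \<longlonglongrightarrow> x"
proof -
  define S :: "real \<Rightarrow> real" where "S = (\<lambda>h. if h = 0 then 1 else sinh h / h)"
  have "(sinh has_real_derivative cosh 0) (at (0::real))"
    by (auto intro!: derivative_eq_intros)
  then have "((\<lambda>h::real. sinh h / h) \<longlongrightarrow> 1) (at 0)"
    by (simp add: DERIV_def)
  then have "(S \<longlongrightarrow> 1) (at 0)"
    by (rule Lim_transform_eventually) (auto simp: S_def eventually_at_filter)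
  then have "isCont S 0"
    by (simp add: isCont_def S_def)
  moreover have "(\<lambda>d. \<delta> d * w d) \<longlonglongrightarrow> 0"
    using tendsto_mult[OF \<delta> w] by simp
  ultimately have "(\<lambda>d. S (\<delta> d * w d)) \<longlonglongrightarrow> S 0"
    by (rule isCont_tendsto_compose)
  from tendsto_mult[OF w this] have "(\<lambda>d. w d * S (\<delta> d * w d)) \<longlonglongrightarrow> x"
    by (simp add: S_def)
  then show ?thesis
    by (rule tendsto_cong_from_1) (use pos in \<open>force simp: S_def\<close>)
qed

lemma coth_ge_1: "0 < x \<Longrightarrow> 1 \<le> coth (x :: real)"
  unfolding coth_def by (simp add: le_divide_eq sinh_le_cosh_real)

text \<open>
  The deterministic part of the asymptotics. Writing a radius as \<open>\<rho> d + \<epsilon> d * w\<close> and dividing the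
  law of cosines by \<open>sinh\<close> of the query radius and by \<open>sinh\<close> of the mean radius isolates two terms:
  a radial one, of order \<open>b d\<close>, and an angular one, of order $1/\sqrt{d}$. The three factors \<open>query_factor\<close>, \<open>radial_term\<close> and \<open>angular_factor\<close> are what remains
  once these orders are taken out; they tend to $1$, $w$ and $1$. Since \<open>coth \<ge> 1\<close>, the condition
  \<open>b \<longlonglongrightarrow> 0\<close> forces \<open>\<kappa> d * \<epsilon> d \<longlonglongrightarrow> 0\<close>, so that the expansion around the mean radius is
  legitimate whether \<open>\<kappa> d * \<rho> d\<close> stays bounded, tends to $0$ or tends to infinity.
\<close>

locale polar_scaling =
  fixes \<kappa> \<rho> \<epsilon> b :: "nat \<Rightarrow> real"
  assumes kappa: "\<And>d. 1 \<le> d \<Longrightarrow> 0 < \<kappa> d" and rho: "\<And>d. 1 \<le> d \<Longrightarrow> 0 < \<rho> d"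
    and eps: "\<And>d. 1 \<le> d \<Longrightarrow> 0 < \<epsilon> d"
    and b_eq: "\<And>d. 1 \<le> d \<Longrightarrow> b d = \<kappa> d * \<epsilon> d * coth (\<kappa> d * \<rho> d)"
    and b_lim: "b \<longlonglongrightarrow> 0"
begin

abbreviation mean :: "nat \<Rightarrow> real" where
  "mean d \<equiv> \<kappa> d * \<rho> d"

abbreviation sd :: "nat \<Rightarrow> real" where
  "sd d \<equiv> \<kappa> d * \<epsilon> d"

definition radius :: "nat \<Rightarrow> real \<Rightarrow> real" where
  "radius d w = \<rho> d + \<epsilon> d * w"

definition query_factor :: "nat \<Rightarrow> real \<Rightarrow> real" where
  "query_factor d w = coth (\<kappa> d * radius d w) / coth (mean d)"

definition radial_term :: "nat \<Rightarrow> real \<Rightarrow> real" where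
  "radial_term d w = coth (mean d) * (cosh (\<kappa> d * radius d w) / sinh (mean d) - coth (mean d)) / b d"

definition angular_factor :: "nat \<Rightarrow> real \<Rightarrow> real" where
  "angular_factor d w = sinh (\<kappa> d * radius d w) / sinh (mean d)"

text \<open>
  The right-hand side of the hyperbolic law of cosines, an increasing function of the distance.
\<close>

definition cosh_dist :: "nat \<Rightarrow> real \<Rightarrow> (nat \<Rightarrow> real) \<Rightarrow> real \<Rightarrow> (nat \<Rightarrow> real) \<Rightarrow> real" where
  "cosh_dist d r u r' u' =
     cosh (\<kappa> d * r) * cosh (\<kappa> d * r') - sinh (\<kappa> d * r) * sinh (\<kappa> d * r') * dot d u u'"

lemma sinh_mean_pos: "1 \<le> d \<Longrightarrow> 0 < sinh (mean d)"
  using kappa rho by simp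

lemma sinh_mean_nonzero: "1 \<le> d \<Longrightarrow> sinh (mean d) \<noteq> 0"
  using sinh_mean_pos[of d] by linarith

lemma coth_mean_ge_1: "1 \<le> d \<Longrightarrow> 1 \<le> coth (mean d)"
  using kappa rho by (intro coth_ge_1) simp

lemma sd_pos: "1 \<le> d \<Longrightarrow> 0 < sd d"
  using kappa eps by simp

lemma b_pos: "1 \<le> d \<Longrightarrow> 0 < b d"
  using kappa[of d] eps[of d] coth_mean_ge_1[of d] by (simp add: b_eq)

lemma scaled_radius: "\<kappa> d * radius d w = mean d + sd d * w"
  by (simp add: radius_def algebra_simps)

lemma sd_lim: "sd \<longlonglongrightarrow> 0"
proof (rule tendsto_sandwich[OF _ _ tendsto_const b_lim])
  show "\<forall>\<^sub>F d in sequentially. 0 \<le> sd d"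
    using eventually_ge_at_top[of 1] by eventually_elim (use kappa eps in force)
  show "\<forall>\<^sub>F d in sequentially. sd d \<le> b d"
    using eventually_ge_at_top[of 1]
  proof eventually_elim
    case (elim d)
    then show ?case
      using mult_left_mono[OF coth_mean_ge_1[OF elim], of "sd d"] kappa[OF elim] eps[OF elim]
      by (simp add: b_eq)
  qed
qed

context
  fixes w :: "nat \<Rightarrow> real" and x :: real
  assumes w: "w \<longlonglongrightarrow> x"
begin

lemma sinh_sd_ratio_lim: "(\<lambda>d. sinh (sd d * w d) / sd d) \<longlonglongrightarrow> x"
  by (rule sinh_scaled_tendsto[OF sd_lim sd_pos w])

lemma sd_w_lim: "(\<lambda>d. sd d * w d) \<longlonglongrightarrow> 0"
  using tendsto_mult[OF sd_lim w] by simp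

lemma cosh_sd_lim: "(\<lambda>d. cosh (sd d * w d)) \<longlonglongrightarrow> 1"
  using tendsto_cosh[OF sd_w_lim] by simp

lemma sinh_sd_lim: "(\<lambda>d. sinh (sd d * w d)) \<longlonglongrightarrow> 0"
  using tendsto_sinh[OF sd_w_lim] by simp

text \<open>
  The addition theorem gives \<open>cosh (sd * w) + coth mean * sinh (sd * w)\<close>, and the factor
  \<open>coth mean\<close>, possibly unbounded, is \<open>b / sd\<close>.
\<close>

lemma angular_factor_lim: "(\<lambda>d. angular_factor d (w d)) \<longlonglongrightarrow> 1"
proof -
  have "(\<lambda>d. cosh (sd d * w d) + b d * (sinh (sd d * w d) / sd d)) \<longlonglongrightarrow> 1 + 0 * x"
    by (intro tendsto_add tendsto_mult cosh_sd_lim b_lim sinh_sd_ratio_lim)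
  then have "(\<lambda>d. angular_factor d (w d)) \<longlonglongrightarrow> 1 + 0 * x"
  proof (rule tendsto_cong_from_1)
    fix d :: nat assume d: "1 \<le> d"
    have "b d * (sinh (sd d * w d) / sd d) = coth (mean d) * sinh (sd d * w d)"
      using sd_pos[OF d] unfolding b_eq[OF d] by simp
    moreover have "angular_factor d (w d) = cosh (sd d * w d) + coth (mean d) * sinh (sd d * w d)"
      unfolding angular_factor_def scaled_radius sinh_add coth_def add_divide_distrib
      using sinh_mean_nonzero[OF d] by simp
    ultimately show "cosh (sd d * w d) + b d * (sinh (sd d * w d) / sd d) = angular_factor d (w d)"
      by simp
  qed
  then show ?thesis by simp
qed

text \<open>
  Expanding \<open>cosh\<close> to second order, the quadratic contribution carries an extra factor \<open>b d\<close> and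
  disappears, so only the linear term \<open>sinh (sd * w) / sd\<close> survives.
\<close>

lemma radial_term_lim: "(\<lambda>d. radial_term d (w d)) \<longlonglongrightarrow> x"
proof -
  have half: "(\<lambda>d. sinh (sd d * (w d / 2)) / sd d) \<longlonglongrightarrow> x / 2"
    by (rule sinh_scaled_tendsto[OF sd_lim sd_pos]) (use w in \<open>auto intro: tendsto_divide\<close>)
  let ?g = "\<lambda>d. b d * (2 * (sinh (sd d * (w d / 2)) / sd d)\<^sup>2) + sinh (sd d * w d) / sd d"
  have "?g \<longlonglongrightarrow> 0 * (2 * (x / 2)\<^sup>2) + x"
    by (intro tendsto_add tendsto_mult tendsto_power tendsto_const half b_lim sinh_sd_ratio_lim)
  then have "(\<lambda>d. radial_term d (w d)) \<longlonglongrightarrow> 0 * (2 * (x / 2)\<^sup>2) + x"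
  proof (rule tendsto_cong_from_1)
    fix d :: nat assume d: "1 \<le> d"
    let ?D = "sd d" and ?C = "coth (mean d)"
    have D: "0 < ?D" by (rule sd_pos[OF d])
    have C: "0 < ?C" using coth_mean_ge_1[OF d] by simp
    have b: "b d = ?D * ?C" using b_eq[OF d] by simp
    have "cosh (2 * (?D * (w d / 2))) = 2 * (sinh (?D * (w d / 2)))\<^sup>2 + 1"
      unfolding cosh_double using cosh_square_eq[of "?D * (w d / 2)"] by simp
    then have two: "2 * (sinh (?D * (w d / 2)))\<^sup>2 = cosh (?D * w d) - 1" by simp
    have X: "cosh (\<kappa> d * radius d (w d)) / sinh (mean d) = ?C * cosh (?D * w d) + sinh (?D * w d)"
      unfolding scaled_radius cosh_add coth_def add_divide_distrib
      using sinh_mean_nonzero[OF d] by simp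
    have cancel: "?C * y / (?D * ?C) = y / ?D" for y using C by simp
    have "radial_term d (w d) = (?C * (cosh (?D * w d) - 1) + sinh (?D * w d)) / ?D"
      unfolding radial_term_def b X by (simp only: cancel) (simp add: algebra_simps)
    also have "\<dots> = ?C * (2 * (sinh (?D * (w d / 2)))\<^sup>2) / ?D + sinh (?D * w d) / ?D"
      by (simp only: two add_divide_distrib)
    also have "?C * (2 * (sinh (?D * (w d / 2)))\<^sup>2) / ?D = b d * (2 * (sinh (?D * (w d / 2)) / ?D)\<^sup>2)"
      unfolding b power_divide using D by (simp add: power2_eq_square)
    finally show "?g d = radial_term d (w d)" by simp
  qed
  then show ?thesis by simp
qed

lemma query_factor_lim: "(\<lambda>d. query_factor d (w d)) \<longlonglongrightarrow> 1"
proof -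
  have "(\<lambda>d. 1 / coth (mean d) * sinh (sd d * w d)) \<longlonglongrightarrow> 0"
  proof (rule Lim_null_comparison)
    show "(\<lambda>d. \<bar>sinh (sd d * w d)\<bar>) \<longlonglongrightarrow> 0"
      using tendsto_rabs[OF sinh_sd_lim] by simp
    show "\<forall>\<^sub>F d in sequentially. norm (1 / coth (mean d) * sinh (sd d * w d)) \<le> \<bar>sinh (sd d * w d)\<bar>"
      using eventually_ge_at_top[of 1]
    proof eventually_elim
      case (elim d)
      have "0 \<le> 1 / coth (mean d)" "1 / coth (mean d) \<le> 1"
        using coth_mean_ge_1[OF elim] by (simp_all add: divide_le_eq)
      then show ?case
        unfolding real_norm_def abs_mult by (intro mult_left_le_one_le) auto
    qed
  qed
  then have "(\<lambda>d. (cosh (sd d * w d) + 1 / coth (mean d) * sinh (sd d * w d)) / angular_factor d (w d))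
      \<longlonglongrightarrow> (1 + 0) / 1"
    by (intro tendsto_divide tendsto_add cosh_sd_lim angular_factor_lim) simp_all
  then have "(\<lambda>d. query_factor d (w d)) \<longlonglongrightarrow> (1 + 0) / 1"
  proof (rule tendsto_cong_from_1)
    fix d :: nat assume d: "1 \<le> d"
    have ca: "0 < cosh (mean d)" by (rule cosh_real_pos)
    have "cosh (sd d * w d) + 1 / coth (mean d) * sinh (sd d * w d)
        = cosh (\<kappa> d * radius d (w d)) / cosh (mean d)"
      unfolding scaled_radius cosh_add coth_def add_divide_distrib
      using sinh_mean_nonzero[OF d] ca by simp
    then show "(cosh (sd d * w d) + 1 / coth (mean d) * sinh (sd d * w d)) / angular_factor d (w d)
        = query_factor d (w d)"
      unfolding query_factor_def angular_factor_def by (simp add: coth_def)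
  qed
  then show ?thesis by simp
qed

end

text \<open>
  An affine function of \<open>cosh_dist\<close> with coefficients that depend on the query only. It therefore has
  the same maximizers over the prototypes, which is why the label can be read off the left-hand side.
\<close>

lemma cosh_dist_normalized:
  assumes d: "1 \<le> d" and r: "0 < radius d w\<^sub>0"
  shows "query_factor d w\<^sub>0 * b d * radial_term d w - angular_factor d w * dot d u\<^sub>0 u =
    cosh_dist d (radius d w\<^sub>0) u\<^sub>0 (radius d w) u / (sinh (\<kappa> d * radius d w\<^sub>0) * sinh (mean d))
      - coth (\<kappa> d * radius d w\<^sub>0) * coth (mean d)"
proof -
  let ?q = "\<kappa> d * radius d w\<^sub>0"
  have sa: "sinh (mean d) \<noteq> 0" and sq: "sinh ?q \<noteq> 0" and C: "coth (mean d) \<noteq> 0" and b: "b d \<noteq> 0"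
    using sinh_mean_pos[OF d] kappa[OF d] r coth_mean_ge_1[OF d] b_pos[OF d] by auto
  have "query_factor d w\<^sub>0 * b d * radial_term d w
      = coth ?q * (cosh (\<kappa> d * radius d w) / sinh (mean d) - coth (mean d))"
    using C b by (simp add: query_factor_def radial_term_def)
  also have "\<dots> = cosh ?q * cosh (\<kappa> d * radius d w) / (sinh ?q * sinh (mean d)) - coth ?q * coth (mean d)"
    by (simp add: coth_def right_diff_distrib)
  finally show ?thesis
    using sa sq by (simp add: cosh_dist_def angular_factor_def diff_divide_distrib)
qed

end

section \<open>Stability of the farthest label\<close>

definition argmax3 :: "(nat \<Rightarrow> real) \<Rightarrow> nat set" where
  "argmax3 x = {i \<in> {1..3}. \<forall>j\<in>{1..3}. x j \<le> x i}"

lemma finite_argmax3: "finite (argmax3 x)"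
  by (simp add: argmax3_def)

lemma argmax3_nonempty: "argmax3 x \<noteq> {}"
proof -
  have "Max (x ` {1..3}) \<in> x ` {1..3}" by (rule Max_in) auto
  then obtain i where "Max (x ` {1..3}) = x i" "i \<in> {1..3}" by (rule imageE)
  then have "i \<in> argmax3 x"
    by (auto simp: argmax3_def simp flip: \<open>Max (x ` {1..3}) = x i\<close>)
  then show ?thesis by blast
qed

lemma argmax3_affine:
  assumes "0 < \<alpha>"
  shows "argmax3 (\<lambda>i. \<alpha> * x i + \<beta>) = argmax3 x"
  using assms by (simp add: argmax3_def)

lemma mem_argmax3_iff_Max: "i \<in> {1..3} \<Longrightarrow> i \<in> argmax3 x \<longleftrightarrow> x i = Max (x ` {1..3})"
  by (auto simp: argmax3_def intro!: antisym)

lemma sets_argmax_event: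
  assumes i: "i \<in> {1..3::nat}"
  shows "{s \<in> space (Pi\<^sub>M {1..3} (\<lambda>_. borel)). s i = Max (s ` {1..3})} \<in> sets (Pi\<^sub>M {1..3} (\<lambda>_. borel :: real measure))"
proof -
  have "{s \<in> space (Pi\<^sub>M {1..3} (\<lambda>_. borel)). \<forall>j\<in>{1..3}. s j \<le> s i} \<in> sets (Pi\<^sub>M {1..3} (\<lambda>_. borel :: real measure))"
    by (intro sets.sets_Collect_finite_All borel_measurable_le measurable_component_singleton i) auto
  then show ?thesis
    using i by (simp add: argmax3_def flip: mem_argmax3_iff_Max)
qed

definition label_weight :: "(nat \<Rightarrow> real) \<Rightarrow> nat \<Rightarrow> real" where
  "label_weight x i = pmf (pmf_of_set (argmax3 x)) i"

lemma label_weight_eq: "label_weight x i =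
    (if i \<in> {1..3} \<and> (\<forall>j\<in>{1..3}. x j \<le> x i) then 1 else 0) /
    (\<Sum>k\<in>{1..3}. if \<forall>j\<in>{1..3}. x j \<le> x k then 1 else 0)"
proof -
  have "real (card (argmax3 x)) = (\<Sum>k\<in>{1..3}. if \<forall>j\<in>{1..3}. x j \<le> x k then 1 else 0)"
    by (simp add: argmax3_def sum.If_cases Int_def)
  then show ?thesis
    by (simp add: label_weight_def finite_argmax3 argmax3_nonempty indicator_def)
       (simp add: argmax3_def)
qed

lemma label_weight_nonneg: "0 \<le> label_weight x i"
  and label_weight_le_1: "label_weight x i \<le> 1"
  by (simp_all add: label_weight_def pmf_le_1)

lemma measurable_label_weight [measurable (raw)]:
  assumes [measurable]: "\<And>j. j \<in> {1..3} \<Longrightarrow> (\<lambda>x. X x j) \<in> borel_measurable M"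
  shows "(\<lambda>x. label_weight (X x) i) \<in> borel_measurable M"
proof (cases "i \<in> {1..3}")
  case True
  then have [measurable]: "(\<lambda>x. X x i) \<in> borel_measurable M" by simp
  show ?thesis unfolding label_weight_eq by measurable
next
  case False
  then show ?thesis unfolding label_weight_eq by simp
qed

lemma label_weight_stable:
  assumes close: "\<And>i. i \<in> {1..3} \<Longrightarrow> \<bar>x i - s i\<bar> < \<eta>"
    and gap: "\<And>i j. i \<in> {1..3} \<Longrightarrow> j \<in> {1..3} \<Longrightarrow> i \<noteq> j \<Longrightarrow> 2 * \<eta> \<le> \<bar>s i - s j\<bar>"
    and i: "i \<in> {1..3}"
  shows "label_weight x i = (if s i = Max (s ` {1..3}) then 1 else 0)"
proof -
  have iff: "x j \<le> x k \<longleftrightarrow> s j \<le> s k" if "j \<in> {1..3}" "k \<in> {1..3}" for j k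
  proof (cases "j = k")
    case False
    then show ?thesis
      using close[OF that(1)] close[OF that(2)] gap[OF that False] by linarith
  qed simp
  then have eq: "argmax3 x = argmax3 s"
    by (auto simp: argmax3_def)
  have \<eta>: "0 < \<eta>" using close[OF i] by linarith
  obtain m where m: "m \<in> argmax3 s" using argmax3_nonempty by blast
  have "k = m" if "k \<in> argmax3 s" for k
    using m that gap[of k m] \<eta> by (cases "k = m") (force simp: argmax3_def)+
  with m have single: "argmax3 s = {m}" by blast
  have "label_weight x i = indicator {m} i"
    by (simp add: label_weight_def eq single)
  also have "\<dots> = (if i \<in> argmax3 s then 1 else 0)"
    by (simp add: single)
  finally show ?thesis using mem_argmax3_iff_Max[OF i] by simp
qed

definition near_tie :: "(nat \<Rightarrow> real) measure \<Rightarrow> real \<Rightarrow> (nat \<Rightarrow> real) set" where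
  "near_tie Q \<eta> = {s \<in> space Q. \<exists>i\<in>{1..3}. \<exists>j\<in>{1..3}. i \<noteq> j \<and> \<bar>s i - s j\<bar> < 2 * \<eta>}"

lemma sets_near_tie:
  assumes [measurable_cong]: "sets Q = sets (Pi\<^sub>M {1..3} (\<lambda>_. borel))"
  shows "near_tie Q \<eta> \<in> sets Q"
  unfolding near_tie_def by measurable

lemma near_tie_prob_tendsto:
  assumes "prob_space Q" and sets_Q: "sets Q = sets (Pi\<^sub>M {1..3} (\<lambda>_. borel))"
    and no_ties: "\<And>i j. i \<in> {1..3} \<Longrightarrow> j \<in> {1..3} \<Longrightarrow> i \<noteq> j \<Longrightarrow> AE s in Q. s i \<noteq> s j"
  shows "(\<lambda>n. measure Q (near_tie Q (1 / Suc n))) \<longlonglongrightarrow> 0"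
proof -
  interpret Q: prob_space Q by fact
  define G where "G = near_tie Q"
  note G_def' = G_def near_tie_def
  have G_sets [measurable]: "G \<eta> \<in> sets Q" for \<eta>
    unfolding G_def by (rule sets_near_tie[OF sets_Q])
  have "AE s in Q. \<forall>i\<in>{1..3}. \<forall>j\<in>{1..3}. i \<noteq> j \<longrightarrow> s i \<noteq> s j"
    by (intro AE_finite_allI) (auto intro: no_ties)
  then have "AE s in Q. s \<notin> (\<Inter>n. G (1 / Suc n))"
  proof eventually_elim
    case (elim s)
    show ?case
    proof
      assume s: "s \<in> (\<Inter>n. G (1 / Suc n))"
      define P where "P = {p \<in> {1..3} \<times> {1..3}. fst p \<noteq> (snd p :: nat)}"
      have P: "finite P" "(1, 2) \<in> P" by (auto simp: P_def)
      define \<mu> where "\<mu> = Min ((\<lambda>p. \<bar>s (fst p) - s (snd p)\<bar>) ` P)"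
      have "\<mu> \<in> (\<lambda>p. \<bar>s (fst p) - s (snd p)\<bar>) ` P"
        unfolding \<mu>_def using P by (intro Min_in) auto
      then have "0 < \<mu>" using elim by (auto simp: P_def)
      then obtain n where n: "1 / real (Suc n) < \<mu> / 2"
        using reals_Archimedean[of "\<mu> / 2"] by (auto simp: inverse_eq_divide)
      from s have "s \<in> G (1 / Suc n)" by blast
      then obtain i j where ij: "(i, j) \<in> P" "\<bar>s i - s j\<bar> < 2 * (1 / Suc n)" by (auto simp: G_def' P_def)
      have "\<mu> \<le> \<bar>s i - s j\<bar>" unfolding \<mu>_def using P ij(1) by (intro Min_le) force+
      with ij(2) n show False by simp
    qed
  qed
  then have "measure Q (\<Inter>n. G (1 / Suc n)) = 0"
    by (intro Q.prob_eq_0[THEN iffD2]) auto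
  moreover have "(\<lambda>n. measure Q (G (1 / Suc n))) \<longlonglongrightarrow> measure Q (\<Inter>n. G (1 / Suc n))"
  proof (rule Q.finite_Lim_measure_decseq)
    show "decseq (\<lambda>n. G (1 / real (Suc n)))"
    proof (rule decseq_SucI)
      fix n
      have "2 * (1 / real (Suc (Suc n))) \<le> 2 * (1 / real (Suc n))"
        by (intro mult_left_mono divide_left_mono) auto
      then show "G (1 / real (Suc (Suc n))) \<subseteq> G (1 / real (Suc n))"
        unfolding G_def' by (auto intro: order_less_le_trans)
    qed
  qed auto
  ultimately show ?thesis by (simp add: G_def)
qed

text \<open>
  Scores \<open>X d\<close> that are close in probability to scores \<open>S d\<close> of a fixed law without ties have
  asymptotically the same label probabilities. Outside the event that some \<open>X d i\<close> and \<open>S d i\<close> differ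
  by \<open>\<eta>\<close>, or that two of the \<open>S d i\<close> are within \<open>2 * \<eta>\<close>, both give the same label; the
  second event has a small probability that does not depend on \<open>d\<close>.
\<close>

lemma argmax_prob_tendsto:
  fixes N :: "nat \<Rightarrow> 'a measure" and X S :: "nat \<Rightarrow> 'a \<Rightarrow> nat \<Rightarrow> real" and Q :: "(nat \<Rightarrow> real) measure"
  assumes N: "\<And>d. D \<le> d \<Longrightarrow> prob_space (N d)"
    and X: "\<And>d i. D \<le> d \<Longrightarrow> i \<in> {1..3} \<Longrightarrow> (\<lambda>x. X d x i) \<in> borel_measurable (N d)"
    and S: "\<And>d i. D \<le> d \<Longrightarrow> i \<in> {1..3} \<Longrightarrow> (\<lambda>x. S d x i) \<in> borel_measurable (N d)"
    and law: "\<And>d. D \<le> d \<Longrightarrow> distr (N d) (Pi\<^sub>M {1..3} (\<lambda>_. borel)) (\<lambda>x. \<lambda>i\<in>{1..3}. S d x i) = Q"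
    and close: "\<And>i \<eta>. i \<in> {1..3} \<Longrightarrow> 0 < \<eta> \<Longrightarrow>
        (\<lambda>d. measure (N d) {x \<in> space (N d). \<eta> \<le> \<bar>X d x i - S d x i\<bar>}) \<longlonglongrightarrow> 0"
    and no_ties: "\<And>i j. i \<in> {1..3} \<Longrightarrow> j \<in> {1..3} \<Longrightarrow> i \<noteq> j \<Longrightarrow> AE s in Q. s i \<noteq> s j"
    and i: "i \<in> {1..3}"
  shows "(\<lambda>d. \<integral>x. label_weight (X d x) i \<partial>N d) \<longlonglongrightarrow> measure Q {s \<in> space Q. s i = Max (s ` {1..3})}"
proof -
  let ?R3 = "Pi\<^sub>M {1..3} (\<lambda>_. borel) :: (nat \<Rightarrow> real) measure"
  have sets_Q [measurable_cong]: "sets Q = sets ?R3"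
    using law[OF order_refl] by (metis sets_distr)
  have PQ: "prob_space Q"
    using prob_space.prob_space_distr[OF N[OF order_refl], of "\<lambda>x. \<lambda>i\<in>{1..3}. S D x i" ?R3] law[OF order_refl] S[OF order_refl]
    by simp
  interpret Q: prob_space Q by (rule PQ)
  have G_sets [measurable]: "near_tie Q \<eta> \<in> sets Q" for \<eta>
    by (rule sets_near_tie[OF sets_Q])
  have G_lim: "(\<lambda>n. measure Q (near_tie Q (1 / Suc n))) \<longlonglongrightarrow> 0"
    by (rule near_tie_prob_tendsto[OF PQ sets_Q no_ties])
  let ?B = "{s \<in> space Q. s i = Max (s ` {1..3})}"
  have B_sets [measurable]: "?B \<in> sets Q"
    using sets_argmax_event[OF i] by (simp add: sets_Q sets_eq_imp_space_eq[OF sets_Q])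
  show ?thesis
  proof (rule tendstoI)
    fix r :: real assume r: "0 < r"
    obtain n where n: "measure Q (near_tie Q (1 / Suc n)) < r / 2"
      using order_tendstoD(2)[OF G_lim, of "r / 2"] r by (auto simp: eventually_sequentially)
    define \<eta> where "\<eta> = 1 / real (Suc n)"
    have \<eta>: "0 < \<eta>" by (simp add: \<eta>_def)
    have "\<forall>\<^sub>F d in sequentially. \<forall>k\<in>{1..3}. measure (N d) {x \<in> space (N d). \<eta> \<le> \<bar>X d x k - S d x k\<bar>} < r / 6"
      by (intro eventually_ball_finite ballI order_tendstoD(2)[OF close[OF _ \<eta>]]) (use r in auto)
    then show "\<forall>\<^sub>F d in sequentially. dist (\<integral>x. label_weight (X d x) i \<partial>N d) (measure Q ?B) < r"
      using eventually_ge_at_top[of D]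
    proof eventually_elim
      case (elim d)
      interpret N: prob_space "N d" by (rule N[OF elim(2)])
      have Xm [measurable]: "(\<lambda>x. X d x k) \<in> borel_measurable (N d)" if "k \<in> {1..3}" for k by (rule X[OF elim(2) that])
      have Sm [measurable]: "(\<lambda>x. S d x k) \<in> borel_measurable (N d)" if "k \<in> {1..3}" for k by (rule S[OF elim(2) that])
      let ?S = "\<lambda>x. \<lambda>i\<in>{1..3}. S d x i"
      have Sv [measurable]: "?S \<in> measurable (N d) Q"
        by (subst measurable_cong_sets[OF refl sets_Q]) measurable
      have "distr (N d) Q ?S = distr (N d) ?R3 ?S"
        by (intro distr_cong refl sets_Q)
      then have law': "distr (N d) Q ?S = Q"
        unfolding law[OF elim(2)] .
      let ?E = "\<lambda>k. {x \<in> space (N d). \<eta> \<le> \<bar>X d x k - S d x k\<bar>}"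
      have E_sets: "?E k \<in> sets (N d)" if "k \<in> {1..3}" for k using that by measurable
      define F where "F = ?S -` near_tie Q \<eta> \<inter> space (N d)"
      define H where "H = ?S -` ?B \<inter> space (N d)"
      have F_sets [measurable]: "F \<in> sets (N d)" and H_sets [measurable]: "H \<in> sets (N d)"
        unfolding F_def H_def by (rule measurable_sets[OF Sv], simp)+
      define Bad where "Bad = (\<Union>k\<in>{1..3}. ?E k) \<union> F"
      have Bad_sets [measurable]: "Bad \<in> sets (N d)" unfolding Bad_def using E_sets F_sets by auto
      have "measure (N d) F = measure (distr (N d) Q ?S) (near_tie Q \<eta>)"
        unfolding F_def by (rule measure_distr[symmetric]) auto
      then have mF: "measure (N d) F = measure Q (near_tie Q \<eta>)" unfolding law' .
      have "measure (N d) H = measure (distr (N d) Q ?S) ?B"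
        unfolding H_def by (rule measure_distr[symmetric]) auto
      then have mH: "measure (N d) H = measure Q ?B" unfolding law' .
      have intl: "integrable (N d) (\<lambda>x. label_weight (X d x) i)"
        by (rule N.integrable_const_bound[of _ 1]) (auto simp: label_weight_nonneg label_weight_le_1)
      have intH: "integrable (N d) (indicator H :: _ \<Rightarrow> real)" and intBad: "integrable (N d) (indicator Bad :: _ \<Rightarrow> real)"
        by (rule N.integrable_const_bound[of _ 1]; simp add: indicator_def)+
      have "\<bar>(\<integral>x. label_weight (X d x) i \<partial>N d) - measure Q ?B\<bar> = \<bar>\<integral>x. label_weight (X d x) i - indicator H x \<partial>N d\<bar>"
        unfolding mH[symmetric] by (subst Bochner_Integration.integral_diff[OF intl intH]) simp
      also have "\<dots> \<le> (\<integral>x. \<bar>label_weight (X d x) i - indicator H x\<bar> \<partial>N d)"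
        by (rule integral_abs_bound)
      also have "\<dots> \<le> (\<integral>x. indicator Bad x \<partial>N d)"
      proof (rule integral_mono)
        show "integrable (N d) (\<lambda>x. \<bar>label_weight (X d x) i - indicator H x\<bar>)"
          using intl intH by (intro integrable_abs Bochner_Integration.integrable_diff)
        show "integrable (N d) (indicator Bad :: _ \<Rightarrow> real)" by (rule intBad)
        fix x assume x: "x \<in> space (N d)"
        show "\<bar>label_weight (X d x) i - indicator H x\<bar> \<le> (indicator Bad x :: real)"
        proof (cases "x \<in> Bad")
          case True
          then show ?thesis using label_weight_nonneg[of "X d x" i] label_weight_le_1[of "X d x" i]
            by (auto simp: indicator_def abs_le_iff)
        next
          case False
          have S_sp: "?S x \<in> space Q" using measurable_space[OF Sv x] .
          have im: "?S x ` {1..3} = S d x ` {1..3}" by auto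
          have "label_weight (X d x) i = (if S d x i = Max (S d x ` {1..3}) then 1 else 0)"
          proof (rule label_weight_stable[OF _ _ i])
            show "\<bar>X d x k - S d x k\<bar> < \<eta>" if "k \<in> {1..3}" for k
              using False x that by (force simp: Bad_def)
            show "2 * \<eta> \<le> \<bar>S d x j - S d x k\<bar>" if "j \<in> {1..3}" "k \<in> {1..3}" "j \<noteq> k" for j k
            proof (rule ccontr)
              assume small: "\<not> 2 * \<eta> \<le> \<bar>S d x j - S d x k\<bar>"
              have "\<exists>i\<in>{1..3}. \<exists>l\<in>{1..3}. i \<noteq> l \<and> \<bar>?S x i - ?S x l\<bar> < 2 * \<eta>"
                by (rule bexI[of _ j], rule bexI[of _ k]) (use small that in auto)
              then have "?S x \<in> near_tie Q \<eta>"
                unfolding near_tie_def using S_sp by blast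
              then show False using False x by (auto simp: Bad_def F_def)
            qed
          qed
          moreover have "x \<in> H \<longleftrightarrow> S d x i = Max (S d x ` {1..3})"
            unfolding H_def using x S_sp i im by simp
          ultimately show ?thesis by (auto simp: indicator_def)
        qed
      qed
      also have "\<dots> = measure (N d) Bad" using Bad_sets by simp
      also have "\<dots> \<le> measure (N d) (\<Union>k\<in>{1..3}. ?E k) + measure (N d) F"
        unfolding Bad_def by (rule measure_Un_le) (use E_sets F_sets in auto)
      also have "measure (N d) (\<Union>k\<in>{1..3}. ?E k) \<le> (\<Sum>k\<in>{1..3}. measure (N d) (?E k))"
        by (rule measure_UNION_le) (use E_sets in auto)
      also have "\<dots> \<le> (\<Sum>k\<in>{1..3::nat}. r / 6)"
        by (intro sum_mono less_imp_le) (use elim(1) in auto)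
      also have "(\<Sum>k\<in>{1..3::nat}. r / 6) + measure (N d) F < r"
        using n mF by (simp add: \<eta>_def)
      finally show ?case by (simp add: dist_real_def)
    qed
  qed
qed

section \<open>Limiting cell probabilities\<close>

text \<open>
  The limiting score of prototype \<open>i\<close> is \<open>\<mu> * w i - \<tau> * z i\<close>, with radial deviations \<open>w\<close> and independent
  standard normal \<open>z\<close>. The case \<open>\<tau> = 1\<close> is the master curve at \<open>\<mu>\<close>; \<open>\<tau> = 0\<close>
  is the regime in which the radii alone decide.
\<close>

definition limit_prob :: "real \<Rightarrow> real \<Rightarrow> (nat \<Rightarrow> real) \<Rightarrow> nat \<Rightarrow> real" where
  "limit_prob \<mu> \<tau> w i = measure (gaussian 3)
     {z \<in> space (gaussian 3). \<mu> * w i - \<tau> * z i = Max ((\<lambda>j. \<mu> * w j - \<tau> * z j) ` {1..3})}"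

lemma limit_prob_eq_master_prob: "limit_prob l 1 w i = master_prob l w i"
  by (simp add: limit_prob_def master_prob_def gaussian_def Let_def)

lemma gaussian_no_ties:
  assumes "i \<in> {1..n}" "j \<in> {1..n}" "i \<noteq> j"
  shows "AE z in gaussian n. z i - z j \<noteq> c"
proof -
  define v :: "nat \<Rightarrow> real" where "v k = (if k = i then 1 else if k = j then -1 else 0)" for k
  have dot: "dot n z v = z i - z j" for z
  proof -
    have "dot n z v = (\<Sum>k\<in>{1..n}. (if k = i then z k else 0) + (if k = j then - z k else 0))"
      unfolding dot_def v_def using assms by (intro sum.cong) auto
    then show ?thesis using assms by (simp add: sum.distrib)
  qed
  have vv: "dot n v v = 2" unfolding dot using assms by (simp add: v_def)
  then have en: "enorm n v \<noteq> 0" by (simp add: enorm_def)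
  have "AE z in std_normal_distribution. z \<noteq> c / enorm n v"
    using AE_lborel_singleton[of "c / enorm n v"] by (subst AE_density) auto
  then have "AE z in std_normal_distribution. enorm n v * z \<noteq> c"
    by eventually_elim (use en in auto)
  then have "AE y in distr std_normal_distribution borel (\<lambda>z. enorm n v * z). y \<noteq> c"
    by (subst AE_distr_iff) auto
  then have "AE y in distr (gaussian n) borel (\<lambda>g. dot n g v). y \<noteq> c"
    unfolding distr_gaussian_dot .
  then have "AE g in gaussian n. dot n g v \<noteq> c"
    by (subst (asm) AE_distr_iff) auto
  then show ?thesis unfolding dot .
qed

definition limit_score_law :: "real \<Rightarrow> real \<Rightarrow> (nat \<Rightarrow> real) \<Rightarrow> (nat \<Rightarrow> real) measure" where
  "limit_score_law \<mu> \<tau> w =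
     distr (gaussian 3) (Pi\<^sub>M {1..3} (\<lambda>_. borel)) (\<lambda>z. \<lambda>i\<in>{1..3}. \<mu> * w i - \<tau> * z i)"

lemma measurable_limit_score:
  "(\<lambda>z. \<lambda>i\<in>{1..3}. \<mu> * w i - \<tau> * z i) \<in> measurable (gaussian 3) (Pi\<^sub>M {1..3} (\<lambda>_. borel))"
  by measurable

lemma measure_limit_score_law:
  assumes i: "i \<in> {1..3}"
  shows "measure (limit_score_law \<mu> \<tau> w) {s \<in> space (limit_score_law \<mu> \<tau> w). s i = Max (s ` {1..3})}
    = limit_prob \<mu> \<tau> w i"
proof -
  let ?T = "\<lambda>z. \<lambda>i\<in>{1..3}. \<mu> * w i - \<tau> * z i"
  let ?B = "{s \<in> space (Pi\<^sub>M {1..3} (\<lambda>_. borel :: real measure)). s i = Max (s ` {1..3})}"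
  have im: "?T z ` {1..3} = (\<lambda>j. \<mu> * w j - \<tau> * z j) ` {1..3}" for z by auto
  have "measure (limit_score_law \<mu> \<tau> w) ?B = measure (gaussian 3) (?T -` ?B \<inter> space (gaussian 3))"
    unfolding limit_score_law_def by (rule measure_distr[OF measurable_limit_score sets_argmax_event[OF i]])
  also have "?T -` ?B \<inter> space (gaussian 3)
      = {z \<in> space (gaussian 3). \<mu> * w i - \<tau> * z i = Max ((\<lambda>j. \<mu> * w j - \<tau> * z j) ` {1..3})}"
    using i im by (auto simp: space_PiM)
  finally show ?thesis by (simp add: limit_score_law_def limit_prob_def)
qed

lemma limit_score_law_no_ties:
  assumes nondeg: "\<tau> = 1 \<or> \<tau> = 0 \<and> \<mu> \<noteq> 0 \<and> inj_on w {1..3}"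
    and jk: "j \<in> {1..3}" "k \<in> {1..3}" "j \<noteq> k"
  shows "AE s in limit_score_law \<mu> \<tau> w. s j \<noteq> s k"
proof -
  have "AE z in gaussian 3. \<mu> * w j - \<tau> * z j \<noteq> \<mu> * w k - \<tau> * z k"
    using nondeg
  proof
    assume "\<tau> = 1"
    with gaussian_no_ties[OF jk, of "\<mu> * w j - \<mu> * w k"] show ?thesis
      by (auto elim: eventually_mono)
  next
    assume "\<tau> = 0 \<and> \<mu> \<noteq> 0 \<and> inj_on w {1..3}"
    then show ?thesis using jk by (auto dest: inj_onD)
  qed
  moreover have "{s \<in> space (Pi\<^sub>M {1..3} (\<lambda>_. borel :: real measure)). s j \<noteq> s k} \<in> sets (Pi\<^sub>M {1..3} (\<lambda>_. borel))"
    by (intro borel_measurable_neq measurable_component_singleton jk)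
  ultimately show ?thesis
    unfolding limit_score_law_def using jk by (subst AE_distr_iff[OF measurable_limit_score]) auto
qed

text \<open>
  Along an orthonormal frame the Gaussian noise has the limiting law exactly, in every dimension.
\<close>

lemma distr_frame_scores:
  assumes \<Omega>: "prob_space \<Omega>"
    and e: "\<And>i j. i \<in> {1..3} \<Longrightarrow> j \<in> {1..3} \<Longrightarrow> dot d (e i) (e j) = (if i = j then 1 else 0)"
  shows "distr (\<Omega> \<Otimes>\<^sub>M gaussian d) (Pi\<^sub>M {1..3} (\<lambda>_. borel))
      (\<lambda>p. \<lambda>i\<in>{1..3}. \<mu> * w i - \<tau> * dot d (snd p) (e i)) = limit_score_law \<mu> \<tau> w"
proof -
  let ?R3 = "Pi\<^sub>M {1..3} (\<lambda>_. borel) :: (nat \<Rightarrow> real) measure"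
  let ?Z = "\<lambda>g. \<lambda>k\<in>{1..3}. dot d g (e k)" and ?T = "\<lambda>z. \<lambda>i\<in>{1..3}. \<mu> * w i - \<tau> * z i"
  have T: "?T \<in> measurable ?R3 ?R3" and Z: "?Z \<in> measurable (gaussian d) ?R3"
    and s: "snd \<in> measurable (\<Omega> \<Otimes>\<^sub>M gaussian d) (gaussian d)"
    by measurable
  have "distr (\<Omega> \<Otimes>\<^sub>M gaussian d) ?R3 (\<lambda>p. \<lambda>i\<in>{1..3}. \<mu> * w i - \<tau> * dot d (snd p) (e i))
      = distr (distr (distr (\<Omega> \<Otimes>\<^sub>M gaussian d) (gaussian d) snd) ?R3 ?Z) ?R3 ?T"
    unfolding distr_distr[OF Z s] distr_distr[OF T measurable_comp[OF s Z]]
    by (intro distr_cong) (auto simp: fun_eq_iff)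
  also have "distr (\<Omega> \<Otimes>\<^sub>M gaussian d) (gaussian d) snd = gaussian d"
    by (rule prob_space.distr_pair_snd[OF \<Omega> prob_space_gaussian])
  also have "distr (gaussian d) ?R3 ?Z = gaussian 3"
    by (rule distr_gaussian_orthonormal[OF e])
  finally show ?thesis unfolding limit_score_law_def .
qed

lemma borel_measurable_limit_prob:
  assumes i: "i \<in> {1..3}"
  shows "(\<lambda>w. limit_prob \<mu> \<tau> w i) \<in> borel_measurable (Pi\<^sub>M {1..3} (\<lambda>_. borel))"
proof -
  interpret G: prob_space "gaussian 3" by (rule prob_space_gaussian)
  let ?B = "Pi\<^sub>M {1..3} (\<lambda>_. borel :: real measure)"
  define E where "E = {p \<in> space (?B \<Otimes>\<^sub>M gaussian 3). \<forall>j\<in>{1..3}. \<mu> * fst p j - \<tau> * snd p j \<le> \<mu> * fst p i - \<tau> * snd p i}"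
  have comp [measurable]: "(\<lambda>p. fst p j) \<in> borel_measurable (?B \<Otimes>\<^sub>M gaussian 3)" "(\<lambda>p. snd p j) \<in> borel_measurable (?B \<Otimes>\<^sub>M gaussian 3)" if "j \<in> {1..3}" for j
  proof -
    show "(\<lambda>p. fst p j) \<in> borel_measurable (?B \<Otimes>\<^sub>M gaussian 3)"
      by (rule measurable_compose[OF measurable_fst measurable_component_singleton[OF that]])
    show "(\<lambda>p. snd p j) \<in> borel_measurable (?B \<Otimes>\<^sub>M gaussian 3)"
      by (rule measurable_compose[OF measurable_snd measurable_gaussian_component[OF that]])
  qed
  have E: "E \<in> sets (?B \<Otimes>\<^sub>M gaussian 3)"
    unfolding E_def
    by (intro sets.sets_Collect_finite_All borel_measurable_le borel_measurable_diff borel_measurable_times borel_measurable_const comp i) auto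
  have "(\<lambda>w. measure (gaussian 3) (Pair w -` E)) \<in> borel_measurable ?B"
    unfolding measure_def by (intro borel_measurable_enn2real G.measurable_emeasure_Pair E)
  then show ?thesis
  proof (rule measurable_cong[THEN iffD1, rotated])
    fix w :: "nat \<Rightarrow> real" assume w: "w \<in> space ?B"
    have M: "\<mu> * w i - \<tau> * z i = Max ((\<lambda>j. \<mu> * w j - \<tau> * z j) ` {1..3}) \<longleftrightarrow> (\<forall>j\<in>{1..3}. \<mu> * w j - \<tau> * z j \<le> \<mu> * w i - \<tau> * z i)" for z
      using mem_argmax3_iff_Max[OF i, of "\<lambda>j. \<mu> * w j - \<tau> * z j"] i by (simp add: argmax3_def)
    have "Pair w -` E = {z \<in> space (gaussian 3). \<mu> * w i - \<tau> * z i = Max ((\<lambda>j. \<mu> * w j - \<tau> * z j) ` {1..3})}"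
      unfolding M using w by (auto simp: E_def space_pair_measure)
    then show "measure (gaussian 3) (Pair w -` E) = limit_prob \<mu> \<tau> w i"
      by (simp add: limit_prob_def)
  qed
qed

text \<open>
  Without radial signal the three cells are exchangeable: the Gaussian measure is invariant under
  transpositions of coordinates, and the cells partition the space up to ties.
\<close>

lemma limit_prob_pure_noise:
  assumes i: "i \<in> {1..3}"
  shows "limit_prob 0 1 w i = 1 / 3"
proof -
  interpret G: prob_space "gaussian 3" by (rule prob_space_gaussian)
  define A where "A k = {z \<in> space (gaussian 3). k \<in> argmax3 (\<lambda>j. - z j)}" for k
  note comp = measurable_gaussian_component[of _ 3]
  have A_sets [measurable]: "A k \<in> sets (gaussian 3)" if "k \<in> {1..3}" for k
  proof -
    have "A k = {z \<in> space (gaussian 3). \<forall>j\<in>{1..3}. z k \<le> z j}" using that by (auto simp: A_def argmax3_def)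
    also have "\<dots> \<in> sets (gaussian 3)" by (intro sets.sets_Collect_finite_All borel_measurable_le comp that) auto
    finally show ?thesis .
  qed
  have lp: "limit_prob 0 1 w k = measure (gaussian 3) (A k)" if "k \<in> {1..3}" for k
    unfolding limit_prob_def A_def mem_argmax3_iff_Max[OF that] by simp
  have sym: "measure (gaussian 3) (A k) = measure (gaussian 3) (A i)" if k: "k \<in> {1..3}" for k
  proof -
    define f where "f j = (if j = i then k else if j = k then i else j)" for j
    have fI: "f j \<in> {1..3} \<longleftrightarrow> j \<in> {1..3}" for j using i k by (auto simp: f_def)
    have ff: "f (f j) = j" for j by (simp add: f_def)
    have fk: "f k = i" by (simp add: f_def)
    have inv: "distr (gaussian 3) (gaussian 3) (\<lambda>z. \<lambda>n\<in>{1..3}. z (f n)) = gaussian 3"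
      unfolding gaussian_def
    proof (rule distr_PiM_reindex[of "{1..3}" "\<lambda>_. std_normal_distribution" f "{1..3}"])
      show "inj_on f {1..3}" by (rule inj_on_inverseI[of _ f]) (rule ff)
    qed (use fI in \<open>auto intro: prob_space_std_normal\<close>)
    have meas: "(\<lambda>z. \<lambda>n\<in>{1..3}. z (f n)) \<in> measurable (gaussian 3) (gaussian 3)"
      unfolding measurable_cong_sets[OF refl sets_gaussian]
      by (intro measurable_restrict comp) (simp only: fI)
    have "measure (gaussian 3) (A k) = measure (distr (gaussian 3) (gaussian 3) (\<lambda>z. \<lambda>n\<in>{1..3}. z (f n))) (A k)"
      by (simp only: inv)
    also have "\<dots> = measure (gaussian 3) ((\<lambda>z. \<lambda>n\<in>{1..3}. z (f n)) -` A k \<inter> space (gaussian 3))"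
      by (rule measure_distr[OF meas A_sets[OF k]])
    also have "(\<lambda>z. \<lambda>n\<in>{1..3}. z (f n)) -` A k \<inter> space (gaussian 3) = A i"
    proof -
      have "(\<forall>j\<in>{1..3}. z i \<le> z (f j)) \<longleftrightarrow> (\<forall>j\<in>{1..3}. z i \<le> z j)" for z :: "nat \<Rightarrow> real"
        using fI ff by metis
      then show ?thesis
        using i k fk by (auto simp: A_def argmax3_def space_gaussian)
    qed
    finally show ?thesis .
  qed
  have "AE z in gaussian 3. \<forall>j\<in>{1..3}. \<forall>k\<in>{1..3}. j \<noteq> k \<longrightarrow> z j - z k \<noteq> 0"
    by (intro AE_finite_allI finite_atLeastAtMost AE_impI gaussian_no_ties)
  then have one: "AE z in gaussian 3. (\<Sum>k\<in>{1..3}. indicator (A k) z) = (1 :: real)"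
    using AE_space
  proof eventually_elim
    case (elim z)
    obtain m where m: "m \<in> argmax3 (\<lambda>j. - z j)" using argmax3_nonempty by blast
    then have m3: "m \<in> {1..3}" by (simp add: argmax3_def)
    have "z \<in> A k \<longleftrightarrow> k = m" if k: "k \<in> {1..3}" for k
    proof
      assume "z \<in> A k"
      then have "z k = z m" using m m3 k by (auto simp: A_def argmax3_def intro!: antisym)
      then show "k = m" using elim(1) k m3 by (metis diff_self)
    qed (use m elim in \<open>simp add: A_def\<close>)
    then have "(\<Sum>k\<in>{1..3}. indicator (A k) z) = (\<Sum>k\<in>{1..3}. if k = m then 1 else (0::real))"
      by (intro sum.cong refl) (auto simp: indicator_def)
    then show ?case using m3 by simp
  qed
  have intA: "integrable (gaussian 3) (indicator (A k) :: _ \<Rightarrow> real)" if "k \<in> {1..3}" for k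
    by (rule G.integrable_const_bound[of _ 1]) (use that in \<open>auto simp: indicator_def\<close>)
  have "(\<Sum>k\<in>{1..3}. measure (gaussian 3) (A k)) = (\<Sum>k\<in>{1..3}. \<integral>z. indicator (A k) z \<partial>gaussian 3)"
    by (intro sum.cong refl) (use A_sets sets.sets_into_space[OF A_sets] in \<open>simp add: Int_absorb2\<close>)
  also have "\<dots> = (\<integral>z. (\<Sum>k\<in>{1..3}. indicator (A k) z) \<partial>gaussian 3)"
    by (rule Bochner_Integration.integral_sum[symmetric]) (rule intA)
  also have "\<dots> = (\<integral>z. 1 \<partial>gaussian 3)"
    by (rule integral_cong_AE) (use one A_sets in auto)
  also have "\<dots> = 1" by (simp add: G.prob_space)
  finally have "(\<Sum>k\<in>{1..3}. measure (gaussian 3) (A k)) = 1" .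
  moreover have "(\<Sum>k\<in>{1..3}. measure (gaussian 3) (A k)) = (\<Sum>k\<in>{1..3::nat}. measure (gaussian 3) (A i))"
    by (intro sum.cong refl sym)
  ultimately have "(\<Sum>k\<in>{1..3::nat}. measure (gaussian 3) (A i)) = 1" by simp
  then show ?thesis using lp[OF i] by simp
qed

section \<open>The entropy function\<close>

lemma x_ln_x_bounds:
  fixes x :: real
  assumes "0 \<le> x" "x \<le> 1"
  shows "x * ln x \<le> 0" "- (x * ln x) \<le> 2 * sqrt x" "- (x * ln x) \<le> 1"
proof -
  show "x * ln x \<le> 0" using assms by (cases "x = 0") (auto intro: mult_nonneg_nonpos)
  show "- (x * ln x) \<le> 2 * sqrt x"
  proof (cases "x = 0")
    case False
    with assms have x: "0 < x" by simp
    have "ln (1 / sqrt x) \<le> 1 / sqrt x" using ln_le_minus_one[of "1 / sqrt x"] x by simp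
    then have "x * (- ln x) \<le> x * (2 * (1 / sqrt x))"
      using x by (intro mult_left_mono) (simp_all add: ln_div ln_sqrt)
    also have "\<dots> = 2 * sqrt x" using x by (simp add: field_simps)
    finally show ?thesis by simp
  qed simp
  show "- (x * ln x) \<le> 1"
  proof (cases "x = 0")
    case False
    with assms have x: "0 < x" by simp
    have "- ln x \<le> 1 / x - 1" using ln_le_minus_one[of "1 / x"] x by (simp add: ln_div)
    then have "x * (- ln x) \<le> x * (1 / x - 1)" using x by (intro mult_left_mono) auto
    also have "\<dots> \<le> 1" using x by (simp add: right_diff_distrib)
    finally show ?thesis by simp
  qed simp
qed

lemma entropy3_bounds:
  assumes "\<And>i. i \<in> {1..3} \<Longrightarrow> 0 \<le> q i" "\<And>i. i \<in> {1..3} \<Longrightarrow> q i \<le> 1"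
  shows "\<bar>entropy3 q\<bar> \<le> 3"
proof -
  have "\<bar>\<Sum>i\<in>{1..3}. q i * ln (q i)\<bar> \<le> (\<Sum>i\<in>{1..3::nat}. 1)"
    by (intro order_trans[OF sum_abs] sum_mono) (use assms x_ln_x_bounds in \<open>auto simp: abs_le_iff intro: order_trans[of _ 0]\<close>)
  then show ?thesis by (simp add: entropy3_def)
qed

lemma entropy3_tendsto:
  assumes lim: "\<And>i. i \<in> {1..3} \<Longrightarrow> (\<lambda>d. q d i) \<longlonglongrightarrow> p i"
    and bounds: "\<And>d i. i \<in> {1..3} \<Longrightarrow> 0 \<le> q d i" "\<And>d i. i \<in> {1..3} \<Longrightarrow> q d i \<le> 1"
  shows "(\<lambda>d. entropy3 (q d)) \<longlonglongrightarrow> entropy3 p"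
  unfolding entropy3_def
proof (intro tendsto_minus tendsto_sum)
  fix i :: nat assume i: "i \<in> {1..3}"
  show "(\<lambda>d. q d i * ln (q d i)) \<longlonglongrightarrow> p i * ln (p i)"
  proof (cases "p i = 0")
    case False
    then show ?thesis by (intro tendsto_mult tendsto_ln lim i)
  next
    case True
    have "(\<lambda>d. 2 * sqrt (q d i)) \<longlonglongrightarrow> 2 * sqrt (p i)"
      by (intro tendsto_mult tendsto_const tendsto_real_sqrt lim i)
    then have small: "(\<lambda>d. 2 * sqrt (q d i)) \<longlonglongrightarrow> 0" using True by simp
    have "norm (q d i * ln (q d i)) \<le> 2 * sqrt (q d i)" for d
    proof -
      have "q d i * ln (q d i) \<le> 0" "- (q d i * ln (q d i)) \<le> 2 * sqrt (q d i)"
        by (rule x_ln_x_bounds[OF bounds[OF i]])+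
      then show ?thesis unfolding real_norm_def abs_le_iff by linarith
    qed
    then have "(\<lambda>d. q d i * ln (q d i)) \<longlonglongrightarrow> 0"
      by (intro Lim_null_comparison[OF always_eventually small] allI)
    then show ?thesis using True by simp
  qed
qed

lemma borel_measurable_entropy3:
  assumes "\<And>i. i \<in> {1..3} \<Longrightarrow> (\<lambda>x. q x i) \<in> borel_measurable M"
  shows "(\<lambda>x. entropy3 (q x)) \<in> borel_measurable M"
  unfolding entropy3_def using assms by (intro borel_measurable_uminus borel_measurable_sum borel_measurable_times borel_measurable_ln)

lemma entropy3_noiseless: "entropy3 (limit_prob \<mu> 0 w) = 0"
proof -
  interpret G: prob_space "gaussian 3" by (rule prob_space_gaussian)
  have "limit_prob \<mu> 0 w i = 0 \<or> limit_prob \<mu> 0 w i = 1" for i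
    by (cases "\<mu> * w i = Max ((\<lambda>j. \<mu> * w j) ` {1..3})") (simp_all add: limit_prob_def G.prob_space)
  then have "limit_prob \<mu> 0 w i * ln (limit_prob \<mu> 0 w i) = 0" for i
    by (metis ln_one mult_zero_left mult_zero_right)
  then show ?thesis unfolding entropy3_def by (simp only: sum.neutral_const minus_zero)
qed

lemma entropy3_pure_noise: "entropy3 (limit_prob 0 1 w) = ln 3"
proof -
  have "entropy3 (limit_prob 0 1 w) = - (\<Sum>i\<in>{1..3::nat}. 1 / 3 * ln (1 / 3))"
    unfolding entropy3_def by (intro arg_cong[where f=uminus] sum.cong refl) (simp only: limit_prob_pure_noise)
  also have "\<dots> = ln 3" by (simp add: ln_div)
  finally show ?thesis .
qed

section \<open>Cell probabilities of a fixed prototype triplet\<close>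

lemma near_orthonormal_frames:
  fixes u :: "nat \<Rightarrow> nat \<Rightarrow> nat \<Rightarrow> real"
  assumes unit: "\<And>d i. 1 \<le> d \<Longrightarrow> i \<in> {1..3} \<Longrightarrow> dot d (u d i) (u d i) = 1"
    and gram: "\<And>d i j. D \<le> d \<Longrightarrow> i \<in> {1..3} \<Longrightarrow> j \<in> {1..3} \<Longrightarrow> i \<noteq> j \<Longrightarrow> \<bar>dot d (u d i) (u d j)\<bar> \<le> \<delta> d"
    and \<delta>: "\<delta> \<longlonglongrightarrow> 0"
  shows "\<exists>e D\<^sub>0. 1 \<le> D\<^sub>0 \<and>
    (\<forall>d\<ge>D\<^sub>0. \<forall>i\<in>{1..3}. \<forall>j\<in>{1..3}. dot d (e d i) (e d j) = (if i = j then 1 else 0)) \<and>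
    (\<forall>i\<in>{1..3}. (\<lambda>d. dot d (\<lambda>k. u d i k - e d i k) (\<lambda>k. u d i k - e d i k)) \<longlonglongrightarrow> 0)"
proof -
  have "\<forall>\<^sub>F d in sequentially. \<delta> d < 1 / 2"
    using order_tendstoD(2)[OF \<delta>, of "1/2"] by simp
  then obtain D1 where D1: "\<And>d. D1 \<le> d \<Longrightarrow> \<delta> d < 1 / 2" by (auto simp: eventually_sequentially)
  define D0 where "D0 = max 1 (max D D1)"
  have "\<exists>e. \<forall>d. D0 \<le> d \<longrightarrow>
    (\<forall>i\<in>{1..3}. \<forall>j\<in>{1..3}. dot d (e d i) (e d j) = (if i = j then 1 else 0)) \<and>
    (\<forall>i\<in>{1..3}. dot d (\<lambda>k. u d i k - e d i k) (\<lambda>k. u d i k - e d i k) \<le> 8 * (\<delta> d)\<^sup>2)"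
  proof (intro choice allI)
    fix d
    show "\<exists>e. D0 \<le> d \<longrightarrow> (\<forall>i\<in>{1..3}. \<forall>j\<in>{1..3}. dot d (e i) (e j) = (if i = j then 1 else 0)) \<and>
      (\<forall>i\<in>{1..3}. dot d (\<lambda>k. u d i k - e i k) (\<lambda>k. u d i k - e i k) \<le> 8 * (\<delta> d)\<^sup>2)"
    proof (cases "D0 \<le> d")
      case True
      then show ?thesis
        using gram_schmidt3[of d "u d" "\<delta> d"] D1 unit gram by (auto simp: D0_def)
    qed simp
  qed
  then obtain e where e: "\<forall>d\<ge>D0. \<forall>i\<in>{1..3}. \<forall>j\<in>{1..3}. dot d (e d i) (e d j) = (if i = j then 1 else 0)"
    and near: "\<And>d i. D0 \<le> d \<Longrightarrow> i \<in> {1..3} \<Longrightarrow> dot d (\<lambda>k. u d i k - e d i k) (\<lambda>k. u d i k - e d i k) \<le> 8 * (\<delta> d)\<^sup>2"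
    by blast
  have "(\<lambda>d. dot d (\<lambda>k. u d i k - e d i k) (\<lambda>k. u d i k - e d i k)) \<longlonglongrightarrow> 0" if "i \<in> {1..3}" for i
  proof (rule tendsto_sandwich[OF _ _ tendsto_const])
    show "(\<lambda>d. 8 * (\<delta> d)\<^sup>2) \<longlonglongrightarrow> 0"
      using tendsto_mult[OF tendsto_const[of 8] tendsto_power[OF \<delta>, of 2]] by simp
    show "\<forall>\<^sub>F d in sequentially. dot d (\<lambda>k. u d i k - e d i k) (\<lambda>k. u d i k - e d i k) \<le> 8 * (\<delta> d)\<^sup>2"
      using eventually_ge_at_top[of D0] by eventually_elim (rule near[OF _ that])
  qed (simp add: dot_def sum_nonneg)
  moreover have "1 \<le> D0" by (simp add: D0_def)
  ultimately show ?thesis using e by blast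
qed

context polar_scaling
begin

text \<open>
  For prototypes with convergent radial deviations and asymptotically orthogonal directions, the
  scores of a random query are, after the affine normalization and multiplication by
  $c_d\sqrt d$, the difference of a radial part, which converges pointwise to \<open>\<mu> * w\<^sub>0 i\<close>, and an angular
  part, which is close to \<open>\<tau>\<close> times a Gaussian coordinate along the frame. The free factor \<open>c\<close> puts
  the regimes under one roof: \<open>c = 1\<close> for a bounded signal, \<open>c = 1 / \<Lambda>\<close> for a diverging one.
\<close>

lemma query_label_prob_tendsto:
  fixes \<Omega> :: "'b measure" and Y :: "nat \<Rightarrow> 'b \<Rightarrow> real" and Y\<^sub>0 :: "'b \<Rightarrow> real"
    and w u :: "nat \<Rightarrow> nat \<Rightarrow> _"
  assumes \<Omega>: "prob_space \<Omega>" and Y: "\<And>d. 1 \<le> d \<Longrightarrow> Y d \<in> borel_measurable \<Omega>"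
    and Y_lim: "\<And>\<omega>. \<omega> \<in> space \<Omega> \<Longrightarrow> (\<lambda>d. Y d \<omega>) \<longlonglongrightarrow> Y\<^sub>0 \<omega>"
    and Y_pos: "\<And>d. 1 \<le> d \<Longrightarrow> AE \<omega> in \<Omega>. 0 < radius d (Y d \<omega>)"
    and w: "\<And>i. i \<in> {1..3} \<Longrightarrow> (\<lambda>d. w d i) \<longlonglongrightarrow> w\<^sub>0 i"
    and unit: "\<And>d i. 1 \<le> d \<Longrightarrow> i \<in> {1..3} \<Longrightarrow> dot d (u d i) (u d i) = 1"
    and gram: "\<And>d i j. D \<le> d \<Longrightarrow> i \<in> {1..3} \<Longrightarrow> j \<in> {1..3} \<Longrightarrow> i \<noteq> j \<Longrightarrow> \<bar>dot d (u d i) (u d j)\<bar> \<le> \<delta> d"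
    and \<delta>: "\<delta> \<longlonglongrightarrow> 0"
    and c_pos: "\<And>d. 1 \<le> d \<Longrightarrow> 0 < c d" and c_mu: "(\<lambda>d. c d * (sqrt d * b d)) \<longlonglongrightarrow> \<mu>" and c_tau: "c \<longlonglongrightarrow> \<tau>"
    and nondeg: "\<tau> = 1 \<or> \<tau> = 0 \<and> \<mu> \<noteq> 0 \<and> inj_on w\<^sub>0 {1..3}"
    and i: "i \<in> {1..3}"
  shows "(\<lambda>d. \<integral>p. label_weight (\<lambda>j. cosh_dist d (radius d (Y d (fst p))) (direction d (snd p)) (radius d (w d j)) (u d j)) i
      \<partial>(\<Omega> \<Otimes>\<^sub>M gaussian d)) \<longlonglongrightarrow> limit_prob \<mu> \<tau> w\<^sub>0 i"
proof -
  obtain e D\<^sub>0 where D\<^sub>0: "1 \<le> D\<^sub>0"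
    and e: "\<And>d i j. D\<^sub>0 \<le> d \<Longrightarrow> i \<in> {1..3} \<Longrightarrow> j \<in> {1..3} \<Longrightarrow> dot d (e d i) (e d j) = (if i = j then 1 else 0)"
    and e_lim: "\<And>i. i \<in> {1..3} \<Longrightarrow> (\<lambda>d. dot d (\<lambda>k. u d i k - e d i k) (\<lambda>k. u d i k - e d i k)) \<longlonglongrightarrow> 0"
    using near_orthonormal_frames[where u=u and D=D and \<delta>=\<delta>, OF unit gram \<delta>] by blast
  define radial where "radial d \<omega> i = query_factor d (Y d \<omega>) * (c d * (sqrt d * b d)) * radial_term d (w d i)" for d \<omega> i
  define A where "A d i = c d * angular_factor d (w d i)" for d i
  define angular where "angular d g i = A d i * (sqrt d * dot d (direction d g) (u d i))" for d g i
  define X where "X d p i = radial d (fst p) i - angular d (snd p) i" for d p i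
  let ?N = "\<lambda>d. \<Omega> \<Otimes>\<^sub>M gaussian d"
  have radial_meas: "(\<lambda>\<omega>. radial d \<omega> i) \<in> borel_measurable \<Omega>" if "1 \<le> d" for d i
    using Y[OF that] unfolding radial_def query_factor_def radius_def by measurable
  have dir_meas: "(\<lambda>g. dot d (direction d g) v) \<in> borel_measurable (gaussian d)" if "1 \<le> d" for d v
    by (intro measurable_dot measurable_compose[OF measurable_direction_gaussian[OF that] measurable_sphere_component]
        borel_measurable_const) auto
  have angular_meas: "(\<lambda>g. angular d g i) \<in> borel_measurable (gaussian d)" if "1 \<le> d" for d i
    using dir_meas[OF that] unfolding angular_def by measurable
  have X_meas: "(\<lambda>p. X d p i) \<in> borel_measurable (?N d)" if "1 \<le> d" for d i
    using radial_meas[OF that] angular_meas[OF that] unfolding X_def by measurable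
  have radial_lim: "(\<lambda>d. radial d \<omega> i) \<longlonglongrightarrow> \<mu> * w\<^sub>0 i" if "i \<in> {1..3}" "\<omega> \<in> space \<Omega>" for i \<omega>
    unfolding radial_def
    using tendsto_mult[OF tendsto_mult[OF query_factor_lim[OF Y_lim[OF that(2)]] c_mu] radial_term_lim[OF w[OF that(1)]]]
    by simp
  have A_lim: "(\<lambda>d. A d i) \<longlonglongrightarrow> \<tau>" if "i \<in> {1..3}" for i
    unfolding A_def using tendsto_mult[OF c_tau angular_factor_lim[OF w[OF that]]] by simp
  have "(\<lambda>d. \<integral>p. label_weight (X d p) i \<partial>?N d) \<longlonglongrightarrow>
    measure (limit_score_law \<mu> \<tau> w\<^sub>0) {s \<in> space (limit_score_law \<mu> \<tau> w\<^sub>0). s i = Max (s ` {1..3})}"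
  proof (rule argmax_prob_tendsto[where S="\<lambda>d p i. \<mu> * w\<^sub>0 i - \<tau> * dot d (snd p) (e d i)" and D=D\<^sub>0, OF _ _ _ _ _ _ i])
    show "prob_space (?N d)" for d by (intro prob_space_pair \<Omega> prob_space_gaussian)
    show "(\<lambda>p. X d p j) \<in> borel_measurable (?N d)" if "D\<^sub>0 \<le> d" for d j
      by (rule X_meas) (use that D\<^sub>0 in simp)
    show "(\<lambda>p. \<mu> * w\<^sub>0 j - \<tau> * dot d (snd p) (e d j)) \<in> borel_measurable (?N d)" for d j by measurable
    show "distr (?N d) (Pi\<^sub>M {1..3} (\<lambda>_. borel)) (\<lambda>p. \<lambda>i\<in>{1..3}. \<mu> * w\<^sub>0 i - \<tau> * dot d (snd p) (e d i)) = limit_score_law \<mu> \<tau> w\<^sub>0"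
      if "D\<^sub>0 \<le> d" for d by (rule distr_frame_scores[OF \<Omega> e[OF that]])
    show "AE s in limit_score_law \<mu> \<tau> w\<^sub>0. s j \<noteq> s k" if "j \<in> {1..3}" "k \<in> {1..3}" "j \<noteq> k" for j k
      by (rule limit_score_law_no_ties[OF nondeg that])
    show "(\<lambda>d. measure (?N d) {p \<in> space (?N d). \<eta> \<le> \<bar>X d p j - (\<mu> * w\<^sub>0 j - \<tau> * dot d (snd p) (e d j))\<bar>}) \<longlonglongrightarrow> 0"
      if j: "j \<in> {1..3}" and \<eta>: "0 < \<eta>" for j \<eta>
    proof -
      let ?f = "\<lambda>d. measure \<Omega> {\<omega> \<in> space \<Omega>. \<eta> / 2 \<le> \<bar>radial d \<omega> j - \<mu> * w\<^sub>0 j\<bar>}"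
      let ?h = "\<lambda>d. measure (gaussian d) {g \<in> space (gaussian d). \<eta> / 2 \<le> \<bar>angular d g j - \<tau> * dot d g (e d j)\<bar>}"
      have f: "?f \<longlonglongrightarrow> 0"
        by (rule pointwise_limit_imp_in_probability[OF \<Omega>]) (use \<eta> radial_lim[OF j] radial_meas in auto)
      have h: "?h \<longlonglongrightarrow> 0"
        unfolding angular_def
        by (rule gaussian_direction_score[OF A_lim[OF j]]) (use \<eta> e_lim[OF j] unit[OF _ j] in auto)
      have "(\<lambda>d. ?f d + ?h d) \<longlonglongrightarrow> 0" using tendsto_add[OF f h] by simp
      then show ?thesis
      proof (rule tendsto_sandwich[OF _ _ tendsto_const, rotated 2])
        show "\<forall>\<^sub>F d in sequentially. measure (?N d) {p \<in> space (?N d). \<eta> \<le> \<bar>X d p j - (\<mu> * w\<^sub>0 j - \<tau> * dot d (snd p) (e d j))\<bar>} \<le> ?f d + ?h d"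
          using eventually_ge_at_top[of 1]
        proof eventually_elim
          case (elim d)
          have split: "X d p j - (\<mu> * w\<^sub>0 j - \<tau> * dot d (snd p) (e d j))
              = (radial d (fst p) j - \<mu> * w\<^sub>0 j) - (angular d (snd p) j - \<tau> * dot d (snd p) (e d j))" for p
            by (simp add: X_def)
          show ?case
            unfolding split
            by (rule prob_pair_difference_le[OF \<Omega> prob_space_gaussian,
                  where f="\<lambda>\<omega>. radial d \<omega> j - \<mu> * w\<^sub>0 j" and g="\<lambda>g. angular d g j - \<tau> * dot d g (e d j)"])
               (use radial_meas[OF elim] angular_meas[OF elim] in measurable)
        qed
      qed simp
    qed
  qed
  then show ?thesis
    unfolding measure_limit_score_law[OF i]
  proof (rule tendsto_cong_from_1)
    fix d :: nat assume d: "1 \<le> d"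
    let ?score = "\<lambda>p j. cosh_dist d (radius d (Y d (fst p))) (direction d (snd p)) (radius d (w d j)) (u d j)"
    have Yd [measurable]: "Y d \<in> borel_measurable \<Omega>" by (rule Y[OF d])
    have dirm [measurable]: "(\<lambda>g. dot d (direction d g) v) \<in> borel_measurable (gaussian d)" for v by (rule dir_meas[OF d])
    show "(\<integral>p. label_weight (X d p) i \<partial>?N d) = (\<integral>p. label_weight (?score p) i \<partial>?N d)"
    proof (rule integral_cong_AE)
      show "(\<lambda>p. label_weight (X d p) i) \<in> borel_measurable (?N d)"
        using X_meas[OF d] by measurable
      show "(\<lambda>p. label_weight (?score p) i) \<in> borel_measurable (?N d)"
        unfolding cosh_dist_def radius_def by measurable
      show "AE p in ?N d. label_weight (X d p) i = label_weight (?score p) i"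
        using AE_pair_fst[OF prob_space_gaussian Y_pos[OF d]]
      proof eventually_elim
        case (elim p)
        let ?r = "radius d (Y d (fst p))"
        define \<alpha> where "\<alpha> = c d * sqrt d / (sinh (\<kappa> d * ?r) * sinh (mean d))"
        define \<beta> where "\<beta> = - c d * sqrt d * (coth (\<kappa> d * ?r) * coth (mean d))"
        have \<alpha>: "0 < \<alpha>"
          unfolding \<alpha>_def using c_pos[OF d] d sinh_mean_pos[OF d] kappa[OF d] elim
          by (intro divide_pos_pos mult_pos_pos) simp_all
        have "X d p j = \<alpha> * ?score p j + \<beta>" for j
        proof -
          have "X d p j = c d * sqrt d * (query_factor d (Y d (fst p)) * b d * radial_term d (w d j)
              - angular_factor d (w d j) * dot d (direction d (snd p)) (u d j))"
            by (simp add: X_def radial_def angular_def A_def algebra_simps)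
          also have "\<dots> = \<alpha> * ?score p j + \<beta>"
            unfolding cosh_dist_normalized[OF d elim] by (simp add: \<alpha>_def \<beta>_def algebra_simps)
          finally show ?thesis .
        qed
        then have "X d p = (\<lambda>j. \<alpha> * ?score p j + \<beta>)" by (rule ext)
        then show ?case
          by (simp add: label_weight_def argmax3_affine[OF \<alpha>])
      qed
    qed
  qed
qed

end

section \<open>The triplet entropy in polar coordinates\<close>

lemma measurable_hyperboloid_component:
  "i \<in> {0..d} \<Longrightarrow> (\<lambda>x. x i) \<in> borel_measurable (hyperboloid_borel d \<kappa>)"
  unfolding hyperboloid_borel_def by (intro measurable_restrict_space1 measurable_component_singleton)

lemma measurable_hyp_dist:
  assumes f: "f \<in> measurable M (hyperboloid_borel d \<kappa>)" and g: "g \<in> measurable M (hyperboloid_borel d \<kappa>)"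
  shows "(\<lambda>p. hyp_dist d \<kappa> (f p) (g p)) \<in> borel_measurable M"
proof -
  have arcosh: "(arcosh :: real \<Rightarrow> real) \<in> borel_measurable borel"
    unfolding arcosh_def[abs_def] by measurable
  have comp: "(\<lambda>p. f p i) \<in> borel_measurable M" "(\<lambda>p. g p i) \<in> borel_measurable M" if "i \<in> {0..d}" for i
    by (rule measurable_compose[OF f measurable_hyperboloid_component[OF that]])
       (rule measurable_compose[OF g measurable_hyperboloid_component[OF that]])
  have "(\<lambda>p. \<kappa>\<^sup>2 * (f p 0 * g p 0 - dot d (f p) (g p))) \<in> borel_measurable M"
    by (intro borel_measurable_times borel_measurable_diff borel_measurable_const measurable_dot comp) auto
  from measurable_compose[OF this arcosh] show ?thesis
    unfolding hyp_dist_def by (intro borel_measurable_divide borel_measurable_const)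
qed

lemma measurable_hyp_polar:
  assumes \<kappa>: "0 < \<kappa>" and f: "f \<in> borel_measurable M" and g: "g \<in> measurable M (sphere_borel d)"
  shows "(\<lambda>p. hyp_polar d \<kappa> (f p) (g p)) \<in> measurable M (hyperboloid_borel d \<kappa>)"
  unfolding hyperboloid_borel_def
proof (rule measurable_restrict_space2)
  show "(\<lambda>p. hyp_polar d \<kappa> (f p) (g p)) \<in> space M \<rightarrow> hyperboloid d \<kappa>"
    using measurable_space[OF g] \<kappa> by (auto simp: space_sphere_borel intro: hyp_polar_in_hyperboloid)
  note f [measurable]
  have [measurable]: "(\<lambda>p. g p i) \<in> borel_measurable M" if "i \<in> {1..d}" for i
    by (rule measurable_compose[OF g measurable_sphere_component[OF that]])
  have ff: "(\<lambda>p. sinh (\<kappa> * f p) / \<kappa> * g p i) \<in> borel_measurable M" if "i \<in> {0..d}" "i \<noteq> 0" for i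
  proof -
    have "i \<in> {1..d}" using that by auto
    then have [measurable]: "(\<lambda>p. g p i) \<in> borel_measurable M" by measurable
    show ?thesis by measurable
  qed
  show "(\<lambda>p. hyp_polar d \<kappa> (f p) (g p)) \<in> measurable M (Pi\<^sub>M {0..d} (\<lambda>_. borel))"
    unfolding hyp_polar_def
  proof (rule measurable_restrict)
    fix i assume i: "i \<in> {0..d}"
    show "(\<lambda>p. if i = 0 then cosh (\<kappa> * f p) / \<kappa> else sinh (\<kappa> * f p) / \<kappa> * g p i) \<in> borel_measurable M"
    proof (cases "i = 0")
      case True then show ?thesis by simp
    next
      case False then show ?thesis using ff[OF i] by simp
    qed
  qed
qed

lemma farthest_eq_argmax3: "farthest D v x = argmax3 (\<lambda>j. D x (v j))"
  by (simp add: farthest_def argmax3_def)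

lemma argmax3_cong: "(\<And>j. j \<in> {1..3} \<Longrightarrow> x j = y j) \<Longrightarrow> argmax3 x = argmax3 y"
  by (auto simp: argmax3_def)

text \<open>
  On radii that are nonnegative the arguments of \<open>arcosh\<close> are at least $1$, where \<open>arcosh\<close> is increasing.
\<close>

lemma argmax3_hyp_dist:
  assumes \<kappa>: "0 < \<kappa>" and r: "0 \<le> r\<^sub>0" "\<And>j. j \<in> {1..3} \<Longrightarrow> 0 \<le> r j"
    and u: "u\<^sub>0 \<in> unit_sphere d" "\<And>j. j \<in> {1..3} \<Longrightarrow> u j \<in> unit_sphere d"
  shows "argmax3 (\<lambda>j. hyp_dist d \<kappa> (hyp_polar d \<kappa> r\<^sub>0 u\<^sub>0) (hyp_polar d \<kappa> (r j) (u j))) =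
    argmax3 (\<lambda>j. cosh (\<kappa> * r\<^sub>0) * cosh (\<kappa> * r j) - sinh (\<kappa> * r\<^sub>0) * sinh (\<kappa> * r j) * dot d u\<^sub>0 (u j))"
proof -
  let ?a = "\<lambda>j. cosh (\<kappa> * r\<^sub>0) * cosh (\<kappa> * r j) - sinh (\<kappa> * r\<^sub>0) * sinh (\<kappa> * r j) * dot d u\<^sub>0 (u j)"
  have ge: "1 \<le> ?a j" if "j \<in> {1..3}" for j
    using hyperbolic_law_of_cosines[OF \<kappa> r(1) r(2)[OF that] u(1) u(2)[OF that]] cosh_real_ge_1 by metis
  have "arcosh (?a j) / \<kappa> \<le> arcosh (?a k) / \<kappa> \<longleftrightarrow> ?a j \<le> ?a k" if "j \<in> {1..3}" "k \<in> {1..3}" for j k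
  proof -
    have "arcosh (?a j) / \<kappa> \<le> arcosh (?a k) / \<kappa> \<longleftrightarrow> arcosh (?a j) \<le> arcosh (?a k)"
      using \<kappa> by (intro divide_le_cancel[THEN trans]) auto
    also have "\<dots> \<longleftrightarrow> ?a j \<le> ?a k"
      using arcosh_less_iff_real[OF ge[OF that(2)] ge[OF that(1)]] by (meson not_le)
    finally show ?thesis .
  qed
  then show ?thesis
    unfolding hyp_dist_polar[OF \<kappa>] argmax3_def by blast
qed

lemma borel_measurable_cell_entropy:
  assumes P: "prob_space P" and sets_P: "sets P = sets (hyperboloid_borel d \<kappa>)"
  shows "(\<lambda>v. entropy3 (cell_prob P (hyp_dist d \<kappa>) v)) \<in> borel_measurable (Pi\<^sub>M {1..3} (\<lambda>_. hyperboloid_borel d \<kappa>))"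
proof (rule borel_measurable_entropy3)
  interpret P: prob_space P by (rule P)
  fix i :: nat
  let ?H = "hyperboloid_borel d \<kappa>"
  have "(\<lambda>(v, x). label_weight (\<lambda>j. hyp_dist d \<kappa> x (v j)) i) \<in> borel_measurable (Pi\<^sub>M {1..3} (\<lambda>_. ?H) \<Otimes>\<^sub>M P)"
    unfolding split_beta'
  proof (rule measurable_label_weight)
    fix j :: nat assume j: "j \<in> {1..3}"
    show "(\<lambda>p. hyp_dist d \<kappa> (snd p) (fst p j)) \<in> borel_measurable (Pi\<^sub>M {1..3} (\<lambda>_. ?H) \<Otimes>\<^sub>M P)"
    proof (rule measurable_hyp_dist)
      show "snd \<in> measurable (Pi\<^sub>M {1..3} (\<lambda>_. ?H) \<Otimes>\<^sub>M P) ?H"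
        by (subst measurable_cong_sets[OF refl sets_P[symmetric]]) (rule measurable_snd)
      show "(\<lambda>p. fst p j) \<in> measurable (Pi\<^sub>M {1..3} (\<lambda>_. ?H) \<Otimes>\<^sub>M P) ?H"
        by (rule measurable_compose[OF measurable_fst measurable_component_singleton[OF j]])
    qed
  qed
  then show "(\<lambda>v. cell_prob P (hyp_dist d \<kappa>) v i) \<in> borel_measurable (Pi\<^sub>M {1..3} (\<lambda>_. ?H))"
    unfolding cell_prob_def farthest_eq_argmax3 label_weight_def[symmetric]
    by (rule P.borel_measurable_lebesgue_integral)
qed

context polar_scaling
begin

text \<open>
  The cell probabilities in polar coordinates: a prototype is a pair of a radial deviation \<open>w j\<close> and a
  direction \<open>u j\<close>, the query has radial deviation \<open>y\<close> and a Gaussian vector that is normalized.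
\<close>

definition query_prob :: "'b measure \<Rightarrow> nat \<Rightarrow> ('b \<Rightarrow> real) \<Rightarrow> (nat \<Rightarrow> real) \<Rightarrow> (nat \<Rightarrow> nat \<Rightarrow> real) \<Rightarrow> nat \<Rightarrow> real" where
  "query_prob \<Omega> d y w u i = (\<integral>p. label_weight
      (\<lambda>j. cosh_dist d (radius d (y (fst p))) (direction d (snd p)) (radius d (w j)) (u j)) i \<partial>(\<Omega> \<Otimes>\<^sub>M gaussian d))"

definition polar_law :: "'b measure \<Rightarrow> nat \<Rightarrow> ('b \<Rightarrow> real) \<Rightarrow> (nat \<Rightarrow> real) measure" where
  "polar_law \<Omega> d y = distr (\<Omega> \<Otimes>\<^sub>M uniform_sphere d) (hyperboloid_borel d (\<kappa> d))
     (\<lambda>p. hyp_polar d (\<kappa> d) (radius d (y (fst p))) (snd p))"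

lemma query_prob_bounds:
  assumes \<Omega>: "prob_space \<Omega>"
  shows "0 \<le> query_prob \<Omega> d y w u i" "query_prob \<Omega> d y w u i \<le> 1"
proof -
  interpret P: prob_space "\<Omega> \<Otimes>\<^sub>M gaussian d" by (intro prob_space_pair \<Omega> prob_space_gaussian)
  show "0 \<le> query_prob \<Omega> d y w u i"
    unfolding query_prob_def by (intro Bochner_Integration.integral_nonneg label_weight_nonneg)
  show "query_prob \<Omega> d y w u i \<le> 1"
    unfolding query_prob_def
    using integral_mono'[of "\<Omega> \<Otimes>\<^sub>M gaussian d" "\<lambda>_. 1"] label_weight_le_1 by (force simp: P.prob_space)
qed

lemma entropy3_query_prob_bound: "prob_space \<Omega> \<Longrightarrow> \<bar>entropy3 (query_prob \<Omega> d y w u)\<bar> \<le> 3"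
  by (rule entropy3_bounds) (rule query_prob_bounds, assumption)+

context
  fixes \<Omega> :: "'b measure" and d :: nat and y :: "'b \<Rightarrow> real"
  assumes \<Omega>: "prob_space \<Omega>" and d: "1 \<le> d" and y [measurable]: "y \<in> borel_measurable \<Omega>"
begin

lemma borel_measurable_query_entropy:
  assumes w: "\<And>j. j \<in> {1..3} \<Longrightarrow> (\<lambda>x. w x j) \<in> borel_measurable L"
    and u: "\<And>j k. j \<in> {1..3} \<Longrightarrow> k \<in> {1..d} \<Longrightarrow> (\<lambda>x. u x j k) \<in> borel_measurable L"
  shows "(\<lambda>x. entropy3 (query_prob \<Omega> d y (w x) (u x))) \<in> borel_measurable L"
proof (rule borel_measurable_entropy3)
  fix i :: nat
  interpret P: prob_space "\<Omega> \<Otimes>\<^sub>M gaussian d" by (intro prob_space_pair \<Omega> prob_space_gaussian)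
  let ?N = "L \<Otimes>\<^sub>M (\<Omega> \<Otimes>\<^sub>M gaussian d)"
  have "(\<lambda>q. label_weight (\<lambda>j. cosh_dist d (radius d (y (fst (snd q)))) (direction d (snd (snd q))) (radius d (w (fst q) j)) (u (fst q) j)) i)
      \<in> borel_measurable ?N"
  proof (rule measurable_label_weight)
    fix j :: nat assume j: "j \<in> {1..3}"
    have 1 [measurable]: "(\<lambda>q. y (fst (snd q))) \<in> borel_measurable ?N" by measurable
    have 2 [measurable]: "(\<lambda>q. w (fst q) j) \<in> borel_measurable ?N" by (rule measurable_compose[OF measurable_fst w[OF j]])
    note dg = measurable_compose[OF measurable_direction_gaussian[OF d] measurable_sphere_component]
    have 3 [measurable]: "(\<lambda>q. dot d (direction d (snd (snd q))) (u (fst q) j)) \<in> borel_measurable ?N"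
    proof (rule measurable_dot)
      fix k assume k: "k \<in> {1..d}"
      show "(\<lambda>q. direction d (snd (snd q)) k) \<in> borel_measurable ?N"
        by (rule measurable_compose[OF _ dg[OF k]]) measurable
      show "(\<lambda>q. u (fst q) j k) \<in> borel_measurable ?N" by (rule measurable_compose[OF measurable_fst u[OF j k]])
    qed
    show "(\<lambda>q. cosh_dist d (radius d (y (fst (snd q)))) (direction d (snd (snd q))) (radius d (w (fst q) j)) (u (fst q) j)) \<in> borel_measurable ?N"
      unfolding cosh_dist_def radius_def by measurable
  qed
  then show "(\<lambda>x. query_prob \<Omega> d y (w x) (u x) i) \<in> borel_measurable L"
    unfolding query_prob_def by (intro P.borel_measurable_lebesgue_integral) (simp add: split_beta')
qed

lemma measurable_polar_point:
  "(\<lambda>p. hyp_polar d (\<kappa> d) (radius d (y (fst p))) (snd p)) \<in> measurable (\<Omega> \<Otimes>\<^sub>M uniform_sphere d) (hyperboloid_borel d (\<kappa> d))"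
proof (rule measurable_hyp_polar[OF kappa[OF d]])
  show "(\<lambda>p. radius d (y (fst p))) \<in> borel_measurable (\<Omega> \<Otimes>\<^sub>M uniform_sphere d)"
    unfolding radius_def by measurable
  show "snd \<in> measurable (\<Omega> \<Otimes>\<^sub>M uniform_sphere d) (sphere_borel d)"
    by (subst measurable_cong_sets[OF refl sets_uniform_sphere[symmetric]]) (rule measurable_snd)
qed

lemma prob_space_polar_law: "prob_space (polar_law \<Omega> d y)"
  unfolding polar_law_def
  by (intro prob_space.prob_space_distr prob_space_pair \<Omega> prob_space_uniform_sphere d measurable_polar_point)

lemma cell_prob_polar_law:
  assumes pos: "AE \<omega> in \<Omega>. 0 < radius d (y \<omega>)"
    and r: "\<And>j. j \<in> {1..3} \<Longrightarrow> 0 < radius d (w j)" and u: "\<And>j. j \<in> {1..3} \<Longrightarrow> u j \<in> unit_sphere d"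
    and v: "\<And>j. j \<in> {1..3} \<Longrightarrow> v j = hyp_polar d (\<kappa> d) (radius d (w j)) (u j)"
  shows "cell_prob (polar_law \<Omega> d y) (hyp_dist d (\<kappa> d)) v i = query_prob \<Omega> d y w u i"
proof -
  let ?H = "hyperboloid_borel d (\<kappa> d)"
  let ?\<Phi> = "\<lambda>p. hyp_polar d (\<kappa> d) (radius d (y (fst p))) (snd p)"
  let ?f = "\<lambda>x. label_weight (\<lambda>j. hyp_dist d (\<kappa> d) x (v j)) i"
  have \<kappa>: "0 < \<kappa> d" by (rule kappa[OF d])
  interpret O: prob_space \<Omega> by (rule \<Omega>)
  interpret G: prob_space "gaussian d" by (rule prob_space_gaussian)
  note dirm = measurable_direction_gaussian[OF d]
  have v_space: "v j \<in> space ?H" if "j \<in> {1..3}" for j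
    using hyp_polar_in_hyperboloid[OF \<kappa> u[OF that]]
    by (auto simp: v[OF that] hyperboloid_borel_def space_restrict_space space_PiM hyperboloid_def)
  have f_meas: "?f \<in> borel_measurable ?H"
    by (intro measurable_label_weight measurable_hyp_dist measurable_ident_sets refl measurable_const v_space)
  let ?S = "\<Omega> \<Otimes>\<^sub>M uniform_sphere d" and ?N = "\<Omega> \<Otimes>\<^sub>M gaussian d"
  let ?dir = "\<lambda>p. (fst p, direction d (snd p))"
  have S_eq: "?S = distr ?N (\<Omega> \<Otimes>\<^sub>M sphere_borel d) ?dir"
  proof -
    have "sigma_finite_measure (distr (gaussian d) (sphere_borel d) (direction d))"
      by (intro prob_space_imp_sigma_finite G.prob_space_distr dirm)
    from pair_measure_distr[OF measurable_ident dirm this, of \<Omega>] show ?thesis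
      unfolding uniform_sphere_eq_direction[OF d] by (simp add: split_beta' id_def distr_id2)
  qed
  have sets_S: "sets ?S = sets (\<Omega> \<Otimes>\<^sub>M sphere_borel d)"
    by (intro sets_pair_measure_cong refl sets_uniform_sphere)
  have \<Phi>: "?\<Phi> \<in> measurable (\<Omega> \<Otimes>\<^sub>M sphere_borel d) ?H"
    using measurable_polar_point by (subst (asm) measurable_cong_sets[OF sets_S refl])
  have dir: "?dir \<in> measurable ?N (\<Omega> \<Otimes>\<^sub>M sphere_borel d)"
    by (intro measurable_Pair measurable_fst measurable_compose[OF measurable_snd dirm])
  have "cell_prob (polar_law \<Omega> d y) (hyp_dist d (\<kappa> d)) v i = (\<integral>x. ?f x \<partial>polar_law \<Omega> d y)"
    by (simp add: cell_prob_def farthest_eq_argmax3 label_weight_def)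
  also have "\<dots> = (\<integral>p. ?f (?\<Phi> p) \<partial>?S)"
    unfolding polar_law_def by (rule integral_distr[OF measurable_polar_point f_meas])
  also have "\<dots> = (\<integral>p. ?f (?\<Phi> (?dir p)) \<partial>?N)"
    unfolding S_eq by (rule integral_distr[OF dir measurable_compose[OF \<Phi> f_meas]])
  also have "\<dots> = query_prob \<Omega> d y w u i"
    unfolding query_prob_def
  proof (rule integral_cong_AE)
    show "(\<lambda>p. ?f (?\<Phi> (?dir p))) \<in> borel_measurable ?N"
      by (rule measurable_compose[OF dir measurable_compose[OF \<Phi> f_meas]])
    have [measurable]: "(\<lambda>p. dot d (direction d (snd p)) (u j)) \<in> borel_measurable ?N" for j
      by (rule measurable_dot)
         (intro measurable_compose[OF measurable_snd measurable_compose[OF dirm measurable_sphere_component]], simp_all)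
    show "(\<lambda>p. label_weight (\<lambda>j. cosh_dist d (radius d (y (fst p))) (direction d (snd p)) (radius d (w j)) (u j)) i) \<in> borel_measurable ?N"
      unfolding cosh_dist_def radius_def by measurable
    show "AE p in ?N. ?f (?\<Phi> (?dir p)) = label_weight (\<lambda>j. cosh_dist d (radius d (y (fst p))) (direction d (snd p)) (radius d (w j)) (u j)) i"
      using AE_pair_fst[OF prob_space_gaussian pos]
    proof eventually_elim
      case (elim p)
      have "argmax3 (\<lambda>j. hyp_dist d (\<kappa> d) (?\<Phi> (?dir p)) (v j)) = argmax3 (\<lambda>j. hyp_dist d (\<kappa> d) (?\<Phi> (?dir p)) (hyp_polar d (\<kappa> d) (radius d (w j)) (u j)))"
        by (rule argmax3_cong) (simp add: v)
      also have "\<dots> = argmax3 (\<lambda>j. cosh_dist d (radius d (y (fst p))) (direction d (snd p)) (radius d (w j)) (u j))"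
        unfolding cosh_dist_def fst_conv snd_conv
        by (rule argmax3_hyp_dist[OF \<kappa>]) (use elim r u direction_in_sphere[OF d] in \<open>auto intro: less_imp_le\<close>)
      finally show ?case by (simp add: label_weight_def)
    qed
  qed
  finally show ?thesis .
qed

text \<open>
  Radii and directions of the prototypes are separated, so that the radii can be fixed while the
  average over the directions is taken.
\<close>

lemma triplet_entropy_polar_law:
  assumes pos: "AE \<omega> in \<Omega>. 0 < radius d (y \<omega>)"
  shows "triplet_entropy (polar_law \<Omega> d y) (hyp_dist d (\<kappa> d)) =
    (\<integral>\<omega>. \<integral>u. entropy3 (query_prob \<Omega> d y (\<lambda>j. y (\<omega> j)) u) \<partial>Pi\<^sub>M {1..3} (\<lambda>_. uniform_sphere d) \<partial>Pi\<^sub>M {1..3} (\<lambda>_. \<Omega>))"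
proof -
  let ?H = "hyperboloid_borel d (\<kappa> d)" and ?S = "uniform_sphere d"
  let ?\<Phi> = "\<lambda>p. hyp_polar d (\<kappa> d) (radius d (y (fst p))) (snd p)"
  let ?g = "\<lambda>v. entropy3 (cell_prob (polar_law \<Omega> d y) (hyp_dist d (\<kappa> d)) v)"
  let ?A = "Pi\<^sub>M {1..3::nat} (\<lambda>_. \<Omega>)" and ?B = "Pi\<^sub>M {1..3::nat} (\<lambda>_. ?S)"
  let ?T = "\<lambda>p. \<lambda>i\<in>{1..3::nat}. (fst p i, snd p i)"
  let ?h = "\<lambda>p. entropy3 (query_prob \<Omega> d y (\<lambda>j. y (fst p j)) (snd p))"
  have PS: "prob_space ?S" by (rule prob_space_uniform_sphere[OF d])
  have PN: "prob_space (\<Omega> \<Otimes>\<^sub>M ?S)" by (rule prob_space_pair[OF \<Omega> PS])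
  interpret AB: pair_prob_space ?A ?B
    by (intro pair_prob_space.intro pair_sigma_finite.intro prob_space_imp_sigma_finite prob_space_PiM \<Omega> PS)
  have g: "?g \<in> borel_measurable (Pi\<^sub>M {1..3} (\<lambda>_. ?H))"
    by (rule borel_measurable_cell_entropy[OF prob_space_polar_law]) (simp add: polar_law_def)
  have comp: "compose {1..3} ?\<Phi> \<in> measurable (Pi\<^sub>M {1..3} (\<lambda>_. \<Omega> \<Otimes>\<^sub>M ?S)) (Pi\<^sub>M {1..3} (\<lambda>_. ?H))"
    unfolding compose_def
    by (rule measurable_restrict, rule measurable_compose[OF _ measurable_polar_point], rule measurable_component_singleton)
  have T: "?T \<in> measurable (?A \<Otimes>\<^sub>M ?B) (Pi\<^sub>M {1..3} (\<lambda>_. \<Omega> \<Otimes>\<^sub>M ?S))"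
    by measurable
  have h: "?h \<in> borel_measurable (?A \<Otimes>\<^sub>M ?B)"
  proof (rule borel_measurable_query_entropy)
    show "(\<lambda>p. y (fst p j)) \<in> borel_measurable (?A \<Otimes>\<^sub>M ?B)" if "j \<in> {1..3}" for j
      by (intro measurable_compose[OF _ y] measurable_compose[OF measurable_fst measurable_component_singleton[OF that]])
    show "(\<lambda>p. snd p j k) \<in> borel_measurable (?A \<Otimes>\<^sub>M ?B)" if "j \<in> {1..3}" "k \<in> {1..d}" for j k
      by (rule measurable_compose[OF measurable_compose[OF measurable_snd measurable_component_singleton[OF that(1)]]
            measurable_uniform_sphere_component[OF that(2)]])
  qed
  have "triplet_entropy (polar_law \<Omega> d y) (hyp_dist d (\<kappa> d)) = (\<integral>v. ?g v \<partial>distr (Pi\<^sub>M {1..3} (\<lambda>_. \<Omega> \<Otimes>\<^sub>M ?S)) (Pi\<^sub>M {1..3} (\<lambda>_. ?H)) (compose {1..3} ?\<Phi>))"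
  proof -
    have "Pi\<^sub>M {1..3::nat} (\<lambda>_. polar_law \<Omega> d y) = distr (Pi\<^sub>M {1..3} (\<lambda>_. \<Omega> \<Otimes>\<^sub>M ?S)) (Pi\<^sub>M {1..3} (\<lambda>_. ?H)) (compose {1..3} ?\<Phi>)"
      unfolding polar_law_def by (rule PiM_distr_eq[OF PN finite_atLeastAtMost measurable_polar_point])
    then show ?thesis unfolding triplet_entropy_def by (simp only:)
  qed
  also have "\<dots> = (\<integral>x. ?g (compose {1..3} ?\<Phi> x) \<partial>Pi\<^sub>M {1..3} (\<lambda>_. \<Omega> \<Otimes>\<^sub>M ?S))"
    by (rule integral_distr[OF comp g])
  also have "\<dots> = (\<integral>p. ?g (compose {1..3} ?\<Phi> (?T p)) \<partial>(?A \<Otimes>\<^sub>M ?B))"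
    by (subst PiM_pair_eq_distr[OF \<Omega> PS finite_atLeastAtMost]) (rule integral_distr[OF T measurable_compose[OF comp g]])
  also have "\<dots> = (\<integral>p. ?h p \<partial>(?A \<Otimes>\<^sub>M ?B))"
  proof (rule integral_cong_AE)
    show "(\<lambda>p. ?g (compose {1..3} ?\<Phi> (?T p))) \<in> borel_measurable (?A \<Otimes>\<^sub>M ?B)"
      by (rule measurable_compose[OF T measurable_compose[OF comp g]])
    show "?h \<in> borel_measurable (?A \<Otimes>\<^sub>M ?B)" by (rule h)
    have "AE \<omega> in ?A. \<forall>j\<in>{1..3}. 0 < radius d (y (\<omega> j))"
      by (intro AE_finite_allI finite_atLeastAtMost AE_PiM_component \<Omega> pos)
    then have "AE p in ?A \<Otimes>\<^sub>M ?B. \<forall>j\<in>{1..3}. 0 < radius d (y (fst p j))"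
      by (rule AE_pair_fst[OF AB.M2.prob_space_axioms])
    then show "AE p in ?A \<Otimes>\<^sub>M ?B. ?g (compose {1..3} ?\<Phi> (?T p)) = ?h p"
      using AE_space
    proof eventually_elim
      case (elim p)
      have "snd p \<in> space ?B" using elim(2) by (simp add: space_pair_measure mem_Times_iff)
      then have u: "snd p j \<in> unit_sphere d" if "j \<in> {1..3}" for j
        using that by (auto simp: space_PiM space_uniform_sphere PiE_iff)
      have "cell_prob (polar_law \<Omega> d y) (hyp_dist d (\<kappa> d)) (compose {1..3} ?\<Phi> (?T p)) = query_prob \<Omega> d y (\<lambda>j. y (fst p j)) (snd p)"
        by (rule ext, rule cell_prob_polar_law[OF pos]) (use elim(1) u in \<open>auto simp: compose_def\<close>)
      then show ?case by simp
    qed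
  qed
  also have "\<dots> = (\<integral>\<omega>. \<integral>u. ?h (\<omega>, u) \<partial>?B \<partial>?A)"
    by (rule AB.integral_fst'[symmetric], rule AB.integrable_const_bound[OF _ h, of 3])
       (simp add: entropy3_query_prob_bound[OF \<Omega>])
  finally show ?thesis by simp
qed

end

end

section \<open>Almost orthogonal prototype directions\<close>

text \<open>
  Inner products of independent uniform directions are of order $d^{-1/2}$; the threshold
  $d^{-1/4}$ exceeds this order and still tends to $0$.
\<close>

definition overlap_bound :: "nat \<Rightarrow> real" where
  "overlap_bound d = 1 / sqrt (sqrt d)"

lemma overlap_bound_lim: "overlap_bound \<longlonglongrightarrow> 0"
proof -
  have "filterlim (\<lambda>d. sqrt (sqrt (real d))) at_top sequentially"
    by (intro filterlim_compose[OF sqrt_at_top] filterlim_real_sequentially)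
  then show ?thesis
    unfolding overlap_bound_def by (intro tendsto_divide_0[OF tendsto_const] filterlim_at_top_imp_at_infinity)
qed

lemma uniform_sphere_overlap_tendsto:
  assumes x: "\<And>d. 1 \<le> d \<Longrightarrow> x d \<in> unit_sphere d"
  shows "(\<lambda>d. measure (uniform_sphere d) {u \<in> space (uniform_sphere d). overlap_bound d \<le> \<bar>dot d (x d) u\<bar>}) \<longlonglongrightarrow> 0"
proof -
  have "(\<lambda>d. measure (gaussian d) {g \<in> space (gaussian d). 1 \<le> \<bar>overlap_bound d * (sqrt d * dot d (direction d g) (x d)) - 0 * dot d g (x d)\<bar>}) \<longlonglongrightarrow> 0"
  proof (rule gaussian_direction_score[OF overlap_bound_lim])
    show "dot d (x d) (x d) = 1" if "1 \<le> d" for d by (rule dot_self_unit_sphere[OF x[OF that]])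
  qed (simp_all add: dot_def)
  then show ?thesis
  proof (rule tendsto_cong_from_1)
    fix d :: nat assume elim: "1 \<le> d"
    note dirm = measurable_direction_gaussian[OF elim]
    let ?E = "{u \<in> space (uniform_sphere d). overlap_bound d \<le> \<bar>dot d (x d) u\<bar>}"
    have [measurable]: "(\<lambda>u. dot d (x d) u) \<in> borel_measurable (sphere_borel d)"
      by (rule measurable_dot) (simp_all add: measurable_sphere_component)
    have E: "?E \<in> sets (sphere_borel d)"
      unfolding space_uniform_sphere space_sphere_borel[symmetric] by measurable
    define q where "q = sqrt (sqrt (real d))"
    have q: "0 < q" "sqrt (real d) = q * q" using elim by (simp_all add: q_def)
    have ob: "overlap_bound d = 1 / q" by (simp add: overlap_bound_def q_def)
    have iff: "1 \<le> \<bar>overlap_bound d * (sqrt d * dot d (direction d g) (x d)) - 0 * dot d g (x d)\<bar> \<longleftrightarrow> overlap_bound d \<le> \<bar>dot d (x d) (direction d g)\<bar>" for g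
      unfolding ob q(2) using q(1) by (simp add: abs_mult dot_commute[of d "x d"] divide_le_eq mult.commute)
    have "measure (uniform_sphere d) ?E = measure (gaussian d) (direction d -` ?E \<inter> space (gaussian d))"
      by (subst (1) uniform_sphere_eq_direction[OF elim]) (rule measure_distr[OF dirm E])
    also have "direction d -` ?E \<inter> space (gaussian d) = {g \<in> space (gaussian d). overlap_bound d \<le> \<bar>dot d (x d) (direction d g)\<bar>}"
      using direction_in_sphere[OF elim] by (auto simp: space_uniform_sphere)
    finally show "measure (gaussian d) {g \<in> space (gaussian d). 1 \<le> \<bar>overlap_bound d * (sqrt d * dot d (direction d g) (x d)) - 0 * dot d g (x d)\<bar>}
      = measure (uniform_sphere d) ?E"
      unfolding iff by (rule sym)
  qed
qed

definition near_orthogonal :: "nat \<Rightarrow> (nat \<Rightarrow> nat \<Rightarrow> real) set" where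
  "near_orthogonal d = {u \<in> space (Pi\<^sub>M {1..3} (\<lambda>_. uniform_sphere d)).
     \<forall>i\<in>{1..3}. \<forall>j\<in>{1..3}. i \<noteq> j \<longrightarrow> \<bar>dot d (u i) (u j)\<bar> \<le> overlap_bound d}"

lemma measurable_PiM_sphere_dot:
  assumes "i \<in> I" "j \<in> I"
  shows "(\<lambda>u. dot d (u i) (u j)) \<in> borel_measurable (Pi\<^sub>M I (\<lambda>_. uniform_sphere d))"
proof (rule measurable_dot)
  fix k assume k: "k \<in> {1..d}"
  from measurable_uniform_sphere_component[OF k] have "(\<lambda>u. u l k) \<in> borel_measurable (Pi\<^sub>M I (\<lambda>_. uniform_sphere d))" if "l \<in> I" for l
    by (rule measurable_compose[OF measurable_component_singleton[OF that]])
  from this[OF assms(1)] this[OF assms(2)]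
  show "(\<lambda>u. u i k) \<in> borel_measurable (Pi\<^sub>M I (\<lambda>_. uniform_sphere d))" "(\<lambda>u. u j k) \<in> borel_measurable (Pi\<^sub>M I (\<lambda>_. uniform_sphere d))" .
qed

lemma sets_near_orthogonal: "near_orthogonal d \<in> sets (Pi\<^sub>M {1..3} (\<lambda>_. uniform_sphere d))"
  unfolding near_orthogonal_def
  by (intro sets.sets_Collect_finite_All sets.sets_Collect_imp sets.sets_Collect_const borel_measurable_le
        borel_measurable_abs measurable_PiM_sphere_dot borel_measurable_const) auto

text \<open>
  Given one direction, the overlap probability tends to $0$ along every sequence of directions,
  hence also on average; a union bound over the pairs of prototypes follows.
\<close>

lemma near_orthogonal_prob_tendsto:
  "(\<lambda>d. measure (Pi\<^sub>M {1..3} (\<lambda>_. uniform_sphere d)) (near_orthogonal d)) \<longlonglongrightarrow> 1"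
proof -
  define f where "f d x = measure (uniform_sphere d) {u \<in> space (uniform_sphere d). overlap_bound d \<le> \<bar>dot d x u\<bar>}" for d x
  define X where "X d = {p \<in> space (uniform_sphere d \<Otimes>\<^sub>M uniform_sphere d). overlap_bound d \<le> \<bar>dot d (fst p) (snd p)\<bar>}" for d
  have X_sets: "X d \<in> sets (uniform_sphere d \<Otimes>\<^sub>M uniform_sphere d)" for d
  proof -
    have "(\<lambda>p. dot d (fst p) (snd p)) \<in> borel_measurable (uniform_sphere d \<Otimes>\<^sub>M uniform_sphere d)"
      by (rule measurable_dot; rule measurable_compose[OF _ measurable_uniform_sphere_component]) auto
    then show ?thesis
      unfolding X_def by measurable
  qed
  have Pair_X: "Pair x -` X d = {u \<in> space (uniform_sphere d). overlap_bound d \<le> \<bar>dot d x u\<bar>}" if "x \<in> space (uniform_sphere d)" for x d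
    using that by (auto simp: X_def space_pair_measure)
  have f_meas: "f d \<in> borel_measurable (uniform_sphere d)" if d: "1 \<le> d" for d
  proof -
    interpret S: prob_space "uniform_sphere d" by (rule prob_space_uniform_sphere[OF d])
    have "(\<lambda>x. measure (uniform_sphere d) (Pair x -` X d)) \<in> borel_measurable (uniform_sphere d)"
      unfolding measure_def by (intro borel_measurable_enn2real S.measurable_emeasure_Pair X_sets)
    then show ?thesis
      by (rule measurable_cong[THEN iffD1, rotated]) (simp add: Pair_X f_def)
  qed
  have f_int: "measure (uniform_sphere d \<Otimes>\<^sub>M uniform_sphere d) (X d) = (\<integral>x. f d x \<partial>uniform_sphere d)" if d: "1 \<le> d" for d
  proof -
    interpret S: prob_space "uniform_sphere d" by (rule prob_space_uniform_sphere[OF d])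
    interpret SS: pair_prob_space "uniform_sphere d" "uniform_sphere d" ..
    have "(\<integral>x. f d x \<partial>uniform_sphere d) = (\<integral>x. (\<integral>u. indicator (X d) (x, u) \<partial>uniform_sphere d) \<partial>uniform_sphere d)"
    proof (rule Bochner_Integration.integral_cong[OF refl])
      fix x assume x: "x \<in> space (uniform_sphere d)"
      have "(\<integral>u. indicator (X d) (x, u) \<partial>uniform_sphere d) = (\<integral>u. indicator (Pair x -` X d) u \<partial>uniform_sphere d :: real)"
        by (simp add: indicator_def)
      also have "\<dots> = f d x" unfolding Pair_X[OF x] f_def
        by (subst Bochner_Integration.integral_indicator) (simp add: Int_def conj_commute cong: conj_cong)
      finally show "f d x = (\<integral>u. indicator (X d) (x, u) \<partial>uniform_sphere d)" by simp
    qed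
    also have "\<dots> = (\<integral>p. indicator (X d) p \<partial>(uniform_sphere d \<Otimes>\<^sub>M uniform_sphere d))"
      by (rule SS.integral_fst', rule SS.integrable_const_bound[of _ 1]) (use X_sets in \<open>auto simp: indicator_def\<close>)
    also have "\<dots> = measure (uniform_sphere d \<Otimes>\<^sub>M uniform_sphere d) (X d)"
      using sets.sets_into_space[OF X_sets] by (simp add: Int_absorb2)
    finally show ?thesis by simp
  qed
  have "(\<lambda>d. \<integral>x. f d x \<partial>uniform_sphere d) \<longlonglongrightarrow> 0"
  proof (rule integral_tendsto_of_selections[where K="\<lambda>d. space (uniform_sphere d)" and B=1])
    show "\<bar>f d x\<bar> \<le> 1" if "1 \<le> d" for d x
      using prob_space.prob_le_1[OF prob_space_uniform_sphere[OF that]] by (simp add: f_def)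
    have "\<forall>\<^sub>F d in sequentially. measure (uniform_sphere d) (space (uniform_sphere d)) = 1"
      using eventually_ge_at_top[of 1] by eventually_elim (rule prob_space.prob_space[OF prob_space_uniform_sphere])
    then show "(\<lambda>d. measure (uniform_sphere d) (space (uniform_sphere d))) \<longlonglongrightarrow> 1"
      by (rule tendsto_eventually)
    show "(\<lambda>d. f d (x d)) \<longlonglongrightarrow> 0" if "\<And>d. 1 \<le> d \<Longrightarrow> x d \<in> space (uniform_sphere d)" for x
      unfolding f_def by (rule uniform_sphere_overlap_tendsto) (use that in \<open>simp add: space_uniform_sphere\<close>)
  qed (auto intro: prob_space_uniform_sphere f_meas)
  then have "(\<lambda>d. 1 - (\<Sum>p\<in>{1..3::nat} \<times> {1..3::nat}. \<integral>x. f d x \<partial>uniform_sphere d)) \<longlonglongrightarrow> 1 - (\<Sum>p\<in>{1..3::nat} \<times> {1..3::nat}. 0)"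
    by (intro tendsto_diff tendsto_const tendsto_sum)
  then have lower: "(\<lambda>d. 1 - (\<Sum>p\<in>{1..3::nat} \<times> {1..3::nat}. \<integral>x. f d x \<partial>uniform_sphere d)) \<longlonglongrightarrow> 1"
    by simp
  show ?thesis
  proof (rule tendsto_sandwich[OF _ _ lower tendsto_const])
    show "\<forall>\<^sub>F d in sequentially. measure (Pi\<^sub>M {1..3} (\<lambda>_. uniform_sphere d)) (near_orthogonal d) \<le> 1"
      using eventually_ge_at_top[of 1]
      by eventually_elim (intro prob_space.prob_le_1 prob_space_PiM prob_space_uniform_sphere)
    show "\<forall>\<^sub>F d in sequentially. 1 - (\<Sum>p\<in>{1..3::nat} \<times> {1..3::nat}. \<integral>x. f d x \<partial>uniform_sphere d) \<le> measure (Pi\<^sub>M {1..3} (\<lambda>_. uniform_sphere d)) (near_orthogonal d)"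
      using eventually_ge_at_top[of 1]
    proof eventually_elim
      case (elim d)
      let ?S = "uniform_sphere d" and ?P = "Pi\<^sub>M {1..3::nat} (\<lambda>_. uniform_sphere d)"
      interpret S: prob_space ?S by (rule prob_space_uniform_sphere[OF elim])
      interpret P: prob_space ?P by (intro prob_space_PiM S.prob_space_axioms)
      define E where "E p = (if fst p \<noteq> snd p then {u \<in> space ?P. overlap_bound d \<le> \<bar>dot d (u (fst p)) (u (snd p))\<bar>} else {})" for p :: "nat \<times> nat"
      have E_sets: "E p \<in> sets ?P" if "p \<in> {1..3} \<times> {1..3}" for p
        unfolding E_def using that
        by (auto intro!: borel_measurable_le borel_measurable_const borel_measurable_abs measurable_PiM_sphere_dot simp: mem_Times_iff)
      have E_le: "measure ?P (E p) \<le> (\<integral>x. f d x \<partial>?S)" if p: "p \<in> {1..3} \<times> {1..3}" for p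
      proof (cases "fst p = snd p")
        case True
        then show ?thesis by (simp add: E_def f_def)
      next
        case False
        have ij: "fst p \<in> {1..3}" "snd p \<in> {1..3}" using p by auto
        have pm: "(\<lambda>u. (u (fst p), u (snd p))) \<in> measurable ?P (?S \<Otimes>\<^sub>M ?S)"
          by (intro measurable_Pair measurable_component_singleton ij)
        have "measure (?S \<Otimes>\<^sub>M ?S) (X d) = measure ?P ((\<lambda>u. (u (fst p), u (snd p))) -` X d \<inter> space ?P)"
          by (subst (1) distr_PiM_two_components[OF S.prob_space_axioms ij False, symmetric]) (rule measure_distr[OF pm X_sets])
        also have "(\<lambda>u. (u (fst p), u (snd p))) -` X d \<inter> space ?P = E p"
          using False measurable_space[OF pm] by (auto simp: X_def E_def)
        finally show ?thesis using f_int[OF elim] by simp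
      qed
      have "1 - measure ?P (near_orthogonal d) = measure ?P (space ?P - near_orthogonal d)"
        by (rule P.prob_compl[symmetric]) (rule sets_near_orthogonal)
      also have "\<dots> \<le> measure ?P (\<Union>p\<in>{1..3::nat} \<times> {1..3::nat}. E p)"
      proof (rule P.finite_measure_mono)
        show "space ?P - near_orthogonal d \<subseteq> (\<Union>p\<in>{1..3::nat} \<times> {1..3::nat}. E p)"
        proof
          fix u assume u: "u \<in> space ?P - near_orthogonal d"
          then obtain i j where "i \<in> {1..3}" "j \<in> {1..3}" "i \<noteq> j" "overlap_bound d < \<bar>dot d (u i) (u j)\<bar>"
            by (auto simp: near_orthogonal_def not_le)
          then show "u \<in> (\<Union>p\<in>{1..3::nat} \<times> {1..3::nat}. E p)"
            using u by (intro UN_I[of "(i, j)"]) (auto simp: E_def)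
        qed
        show "(\<Union>p\<in>{1..3::nat} \<times> {1..3::nat}. E p) \<in> sets ?P" using E_sets by auto
      qed
      also have "\<dots> \<le> (\<Sum>p\<in>{1..3::nat} \<times> {1..3::nat}. measure ?P (E p))"
        by (rule measure_UNION_le) (use E_sets in auto)
      also have "\<dots> \<le> (\<Sum>p\<in>{1..3::nat} \<times> {1..3::nat}. \<integral>x. f d x \<partial>?S)"
        by (intro sum_mono E_le)
      finally show ?case by simp
    qed
  qed
qed

section \<open>Convergence of the triplet entropy\<close>

context polar_scaling
begin

text \<open>
  With all radial deviations realized as pointwise convergent functions on one space, the radii are
  frozen first. For frozen radii the average over the directions converges, because it is carried by
  almost orthogonal directions, along which the cell probabilities have a limit. Dominated
  convergence then averages over the radii. When \<open>\<tau> = 0\<close>, continuity of \<open>F\<close> makes the three limiting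
  deviations almost surely distinct.
\<close>

lemma triplet_entropy_tendsto:
  fixes \<Omega> :: "'b measure" and Y :: "nat \<Rightarrow> 'b \<Rightarrow> real" and Y\<^sub>0 :: "'b \<Rightarrow> real"
  assumes \<Omega>: "prob_space \<Omega>" and Y: "\<And>d. 1 \<le> d \<Longrightarrow> Y d \<in> borel_measurable \<Omega>"
    and Y\<^sub>0: "Y\<^sub>0 \<in> borel_measurable \<Omega>"
    and Y_lim: "\<And>\<omega>. \<omega> \<in> space \<Omega> \<Longrightarrow> (\<lambda>d. Y d \<omega>) \<longlonglongrightarrow> Y\<^sub>0 \<omega>"
    and Y_pos: "\<And>d. 1 \<le> d \<Longrightarrow> AE \<omega> in \<Omega>. 0 < radius d (Y d \<omega>)"
    and F: "F = distr \<Omega> borel Y\<^sub>0"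
    and c_pos: "\<And>d. 1 \<le> d \<Longrightarrow> 0 < c d" and c_mu: "(\<lambda>d. c d * (sqrt d * b d)) \<longlonglongrightarrow> \<mu>" and c_tau: "c \<longlonglongrightarrow> \<tau>"
    and nondeg: "\<tau> = 1 \<or> \<tau> = 0 \<and> \<mu> \<noteq> 0 \<and> continuous_on UNIV (cdf F)"
  shows "(\<lambda>d. triplet_entropy (polar_law \<Omega> d (Y d)) (hyp_dist d (\<kappa> d))) \<longlonglongrightarrow>
    (\<integral>w. entropy3 (limit_prob \<mu> \<tau> w) \<partial>Pi\<^sub>M {1..3} (\<lambda>_. F))"
proof -
  interpret O: prob_space \<Omega> by (rule \<Omega>)
  interpret PO: prob_space "Pi\<^sub>M {1..3::nat} (\<lambda>_. \<Omega>)" by (intro prob_space_PiM \<Omega>)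
  let ?A = "Pi\<^sub>M {1..3::nat} (\<lambda>_. \<Omega>)" and ?B = "\<lambda>d. Pi\<^sub>M {1..3::nat} (\<lambda>_. uniform_sphere d)"
  let ?W = "Pi\<^sub>M {1..3::nat} (\<lambda>_. borel :: real measure)"
  define s where "s d \<omega> = (\<integral>u. entropy3 (query_prob \<Omega> d (Y d) (\<lambda>j. Y d (\<omega> j)) u) \<partial>?B d)" for d \<omega>
  let ?q = "\<lambda>w. entropy3 (limit_prob \<mu> \<tau> w)"
  have PB: "prob_space (?B d)" if "1 \<le> d" for d
    by (intro prob_space_PiM prob_space_uniform_sphere that)
  have q_meas: "?q \<in> borel_measurable ?W"
    by (intro borel_measurable_entropy3 borel_measurable_limit_prob)
  have Y0c: "compose {1..3} Y\<^sub>0 \<in> measurable ?A ?W"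
    unfolding compose_def
    by (rule measurable_restrict, rule measurable_compose[OF _ Y\<^sub>0], rule measurable_component_singleton)
  have u_comp: "(\<lambda>u. u j k) \<in> borel_measurable (?B d)" if "j \<in> {1..3}" "k \<in> {1..d}" for d j k
    by (rule measurable_compose[OF measurable_component_singleton[OF that(1)] measurable_uniform_sphere_component[OF that(2)]])
  have s_meas: "s d \<in> borel_measurable ?A" if d: "1 \<le> d" for d
  proof -
    interpret B: prob_space "?B d" by (rule PB[OF d])
    have "(\<lambda>p. entropy3 (query_prob \<Omega> d (Y d) (\<lambda>j. Y d (fst p j)) (snd p))) \<in> borel_measurable (?A \<Otimes>\<^sub>M ?B d)"
    proof (rule borel_measurable_query_entropy[OF \<Omega> d Y[OF d]])
      show "(\<lambda>p. Y d (fst p j)) \<in> borel_measurable (?A \<Otimes>\<^sub>M ?B d)" if "j \<in> {1..3}" for j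
        by (intro measurable_compose[OF _ Y[OF d]] measurable_compose[OF measurable_fst measurable_component_singleton[OF that]])
      show "(\<lambda>p. snd p j k) \<in> borel_measurable (?A \<Otimes>\<^sub>M ?B d)" if "j \<in> {1..3}" "k \<in> {1..d}" for j k
        by (rule measurable_compose[OF measurable_snd u_comp[OF that]])
    qed
    then show ?thesis
      unfolding s_def by (intro B.borel_measurable_lebesgue_integral) (simp add: split_beta')
  qed
  have s_bound: "\<bar>s d \<omega>\<bar> \<le> 3" if d: "1 \<le> d" for d \<omega>
  proof -
    interpret B: prob_space "?B d" by (rule PB[OF d])
    have "\<bar>s d \<omega>\<bar> \<le> (\<integral>u. \<bar>entropy3 (query_prob \<Omega> d (Y d) (\<lambda>j. Y d (\<omega> j)) u)\<bar> \<partial>?B d)"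
      unfolding s_def by (rule integral_abs_bound)
    also have "\<dots> \<le> (\<integral>u. 3 \<partial>?B d)"
      by (rule integral_mono') (use entropy3_query_prob_bound[OF \<Omega>] in auto)
    also have "\<dots> = 3" by (simp add: B.prob_space)
    finally show ?thesis .
  qed
  have inner: "(\<lambda>d. s d \<omega>) \<longlonglongrightarrow> ?q (compose {1..3} Y\<^sub>0 \<omega>)"
    if \<omega>: "\<omega> \<in> space ?A" and nd: "\<tau> = 1 \<or> \<tau> = 0 \<and> \<mu> \<noteq> 0 \<and> inj_on (compose {1..3} Y\<^sub>0 \<omega>) {1..3}" for \<omega>
    unfolding s_def
  proof (rule integral_tendsto_of_selections[where K=near_orthogonal and B=3])
    have \<omega>j: "\<omega> j \<in> space \<Omega>" if "j \<in> {1..3}" for j using \<omega> that by (auto simp: space_PiM)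
    show "(\<lambda>u. entropy3 (query_prob \<Omega> d (Y d) (\<lambda>j. Y d (\<omega> j)) u)) \<in> borel_measurable (?B d)" if "1 \<le> d" for d
      by (rule borel_measurable_query_entropy[OF \<Omega> that Y[OF that]]) (auto intro: u_comp)
    show "\<bar>entropy3 (query_prob \<Omega> d (Y d) (\<lambda>j. Y d (\<omega> j)) u)\<bar> \<le> 3" if "1 \<le> d" for d u
      by (rule entropy3_query_prob_bound[OF \<Omega>])
    fix u assume u: "\<And>d. 1 \<le> d \<Longrightarrow> u d \<in> space (?B d)" and ev: "\<forall>\<^sub>F d in sequentially. u d \<in> near_orthogonal d"
    from ev obtain D where D: "\<And>d. D \<le> d \<Longrightarrow> u d \<in> near_orthogonal d" by (auto simp: eventually_sequentially)
    have "(\<lambda>d. query_prob \<Omega> d (Y d) (\<lambda>j. Y d (\<omega> j)) (u d) i) \<longlonglongrightarrow> limit_prob \<mu> \<tau> (compose {1..3} Y\<^sub>0 \<omega>) i"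
      if i: "i \<in> {1..3}" for i
      unfolding query_prob_def
    proof (rule query_label_prob_tendsto[OF \<Omega> Y Y_lim Y_pos _ _ _ overlap_bound_lim c_pos c_mu c_tau nd i])
      show "(\<lambda>d. Y d (\<omega> j)) \<longlonglongrightarrow> compose {1..3} Y\<^sub>0 \<omega> j" if "j \<in> {1..3}" for j
        using Y_lim[OF \<omega>j[OF that]] that by (simp add: compose_def)
      show "dot d (u d j) (u d j) = 1" if "1 \<le> d" "j \<in> {1..3}" for d j
        using u[OF that(1)] that(2) by (intro dot_self_unit_sphere) (auto simp: space_PiM space_uniform_sphere)
      show "\<bar>dot d (u d j) (u d k)\<bar> \<le> overlap_bound d" if "D \<le> d" "j \<in> {1..3}" "k \<in> {1..3}" "j \<noteq> k" for d j k
        using D[OF that(1)] that(2-) by (auto simp: near_orthogonal_def)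
    qed
    then show "(\<lambda>d. entropy3 (query_prob \<Omega> d (Y d) (\<lambda>j. Y d (\<omega> j)) (u d))) \<longlonglongrightarrow> ?q (compose {1..3} Y\<^sub>0 \<omega>)"
      by (rule entropy3_tendsto[OF _ query_prob_bounds[OF \<Omega>]])
  qed (auto intro: PB sets_near_orthogonal near_orthogonal_prob_tendsto)
  have F_prob: "prob_space F" unfolding F by (rule O.prob_space_distr[OF Y\<^sub>0])
  have PF: "Pi\<^sub>M {1..3::nat} (\<lambda>_. F) = distr ?A ?W (compose {1..3} Y\<^sub>0)"
    unfolding F by (rule PiM_distr_eq[OF \<Omega> finite_atLeastAtMost Y\<^sub>0])
  have inj: "AE \<omega> in ?A. \<tau> = 1 \<or> \<tau> = 0 \<and> \<mu> \<noteq> 0 \<and> inj_on (compose {1..3} Y\<^sub>0 \<omega>) {1..3}"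
  proof (cases "\<tau> = 1")
    case False
    with nondeg have nd: "\<tau> = 0" "\<mu> \<noteq> 0" and cont: "continuous_on UNIV (cdf F)" by auto
    interpret F: real_distribution F
      using F_prob by (intro real_distribution.intro) (auto simp: F real_distribution_axioms_def)
    have atomless: "emeasure F {x} = 0" for x
      using cont F.isCont_cdf[of x] by (simp add: continuous_on_eq_continuous_at F.emeasure_eq_measure)
    have pair: "AE p in F \<Otimes>\<^sub>M F. fst p \<noteq> snd p"
    proof -
      interpret FF: pair_prob_space F F ..
      show ?thesis
      proof (rule FF.AE_pair_measure)
        show "{p \<in> space (F \<Otimes>\<^sub>M F). fst p \<noteq> snd p} \<in> sets (F \<Otimes>\<^sub>M F)" by measurable
        have "AE y in F. x \<noteq> y" for x
          by (rule AE_I[of _ _ "{x}"]) (use atomless in auto)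
        then show "AE x in F. AE y in F. fst (x, y) \<noteq> snd (x, y)" by simp
      qed
    qed
    have "AE w in Pi\<^sub>M {1..3::nat} (\<lambda>_. F). w i \<noteq> w j" if ij: "i \<in> {1..3}" "j \<in> {1..3}" "i \<noteq> j" for i j
    proof -
      have "AE p in distr (Pi\<^sub>M {1..3} (\<lambda>_. F)) (F \<Otimes>\<^sub>M F) (\<lambda>w. (w i, w j)). fst p \<noteq> snd p"
        using pair unfolding distr_PiM_two_components[OF F_prob ij] .
      then show ?thesis
        using AE_distrD[of "\<lambda>w. (w i, w j)" "Pi\<^sub>M {1..3} (\<lambda>_. F)" "F \<Otimes>\<^sub>M F"] ij by fastforce
    qed
    then have "AE w in Pi\<^sub>M {1..3::nat} (\<lambda>_. F). \<forall>i\<in>{1..3}. \<forall>j\<in>{1..3}. i \<noteq> j \<longrightarrow> w i \<noteq> w j"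
      by (intro AE_finite_allI finite_atLeastAtMost AE_impI)
    then have "AE \<omega> in ?A. \<forall>i\<in>{1..3}. \<forall>j\<in>{1..3}. i \<noteq> j \<longrightarrow> compose {1..3} Y\<^sub>0 \<omega> i \<noteq> compose {1..3} Y\<^sub>0 \<omega> j"
      unfolding PF by (rule AE_distrD[OF Y0c])
    then show ?thesis
      by eventually_elim (use nd in \<open>auto simp: inj_on_def\<close>)
  qed simp
  have "(\<lambda>d. \<integral>\<omega>. s (Suc d) \<omega> \<partial>?A) \<longlonglongrightarrow> (\<integral>\<omega>. ?q (compose {1..3} Y\<^sub>0 \<omega>) \<partial>?A)"
  proof (rule integral_dominated_convergence[where w="\<lambda>_. 3"])
    show "(\<lambda>\<omega>. ?q (compose {1..3} Y\<^sub>0 \<omega>)) \<in> borel_measurable ?A" by (rule measurable_compose[OF Y0c q_meas])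
    show "s (Suc d) \<in> borel_measurable ?A" for d by (rule s_meas) simp
    show "AE \<omega> in ?A. norm (s (Suc d) \<omega>) \<le> 3" for d using s_bound[of "Suc d"] by simp
    show "AE \<omega> in ?A. (\<lambda>d. s (Suc d) \<omega>) \<longlonglongrightarrow> ?q (compose {1..3} Y\<^sub>0 \<omega>)"
      using inj AE_space by eventually_elim (rule LIMSEQ_Suc[OF inner])
  qed simp
  then have "(\<lambda>d. \<integral>\<omega>. s d \<omega> \<partial>?A) \<longlonglongrightarrow> (\<integral>\<omega>. ?q (compose {1..3} Y\<^sub>0 \<omega>) \<partial>?A)"
    by (rule filterlim_sequentially_Suc[THEN iffD1])
  also have "(\<integral>\<omega>. ?q (compose {1..3} Y\<^sub>0 \<omega>) \<partial>?A) = (\<integral>w. ?q w \<partial>Pi\<^sub>M {1..3} (\<lambda>_. F))"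
    unfolding PF by (rule integral_distr[OF Y0c q_meas, symmetric])
  finally show ?thesis
    by (rule tendsto_cong_from_1) (simp add: s_def triplet_entropy_polar_law[OF \<Omega> _ Y Y_pos])
qed

end

theorem theorem2:
  fixes \<kappa> :: "nat \<Rightarrow> real"
    and M :: "nat \<Rightarrow> 'w measure"
    and R :: "nat \<Rightarrow> 'w \<Rightarrow> real"
    and U :: "nat \<Rightarrow> 'w \<Rightarrow> nat \<Rightarrow> real"
    and F :: "real measure"
    and \<rho> \<epsilon> b \<Lambda> :: "nat \<Rightarrow> real"
    and \<xi> :: "nat \<Rightarrow> 'w \<Rightarrow> real"
    and P :: "nat \<Rightarrow> (nat \<Rightarrow> real) measure"
  assumes kappa_pos: "\<And>d. 1 \<le> d \<Longrightarrow> 0 < \<kappa> d"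
    and prob: "\<And>d. 1 \<le> d \<Longrightarrow> prob_space (M d)"
    and indep: "\<And>d. 1 \<le> d \<Longrightarrow> indep_rv (M d) borel (R d) (sphere_borel d) (U d)"
    and U_unif: "\<And>d. 1 \<le> d \<Longrightarrow> distr (M d) (sphere_borel d) (U d) = uniform_sphere d"
    and R_pos: "\<And>d. 1 \<le> d \<Longrightarrow> AE \<omega> in M d. 0 < R d \<omega>"
    and R_L2: "\<And>d. 1 \<le> d \<Longrightarrow> integrable (M d) (\<lambda>\<omega>. (R d \<omega>)\<^sup>2)"
    and rho_def: "\<And>d. 1 \<le> d \<Longrightarrow> \<rho> d = (\<integral>\<omega>. R d \<omega> \<partial>(M d))"
    and eps_def: "\<And>d. 1 \<le> d \<Longrightarrow> \<epsilon> d = stddev (M d) (R d)"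
    and eps_pos: "\<And>d. 1 \<le> d \<Longrightarrow> 0 < \<epsilon> d"
    and xi_def: "\<And>d \<omega>. 1 \<le> d \<Longrightarrow> \<xi> d \<omega> = (R d \<omega> - \<rho> d) / \<epsilon> d"
    and P_def: "\<And>d. 1 \<le> d \<Longrightarrow> P d = hyp_polar_law d (\<kappa> d) (M d) (R d) (U d)"
    and F_dist: "real_distribution F"
    and xi_conv: "weak_conv_m (\<lambda>d. distr (M d) borel (\<xi> d)) F"
    and b_def: "\<And>d. 1 \<le> d \<Longrightarrow> b d = \<kappa> d * \<epsilon> d * coth (\<kappa> d * \<rho> d)"
    and b_lim: "b \<longlonglongrightarrow> 0"
    and Lambda_def: "\<And>d. 1 \<le> d \<Longrightarrow> \<Lambda> d = sqrt (real d) * b d"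
  shows "(\<Lambda> \<longlonglongrightarrow> 0 \<longrightarrow>
            (\<lambda>d. triplet_entropy (P d) (hyp_dist d (\<kappa> d))) \<longlonglongrightarrow> ln 3) \<and>
         (\<forall>l>0. \<Lambda> \<longlonglongrightarrow> l \<longrightarrow>
            (\<lambda>d. triplet_entropy (P d) (hyp_dist d (\<kappa> d))) \<longlonglongrightarrow> master_entropy l F) \<and>
         (filterlim \<Lambda> at_top sequentially \<and> continuous_on UNIV (cdf F) \<longrightarrow>
            (\<lambda>d. triplet_entropy (P d) (hyp_dist d (\<kappa> d))) \<longlonglongrightarrow> 0)"
proof -
  have R_meas: "R d \<in> borel_measurable (M d)" and U_meas: "U d \<in> measurable (M d) (sphere_borel d)" if "1 \<le> d" for d
    using indep[OF that] by (auto simp: indep_rv_def)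
  have R_int: "integrable (M d) (R d)" if d: "1 \<le> d" for d
  proof -
    interpret M: prob_space "M d" by (rule prob[OF d])
    show ?thesis by (rule M.square_integrable_imp_integrable[OF R_meas[OF d] R_L2[OF d]])
  qed
  have rho_pos: "0 < \<rho> d" if d: "1 \<le> d" for d
  proof -
    interpret M: prob_space "M d" by (rule prob[OF d])
    show ?thesis unfolding rho_def[OF d]
      using M.expectation_greater[OF R_int[OF d], of 0] R_pos[OF d] by simp
  qed
  interpret polar_scaling \<kappa> \<rho> \<epsilon> b
    by unfold_locales (use kappa_pos rho_pos eps_pos b_def b_lim in auto)
  have xi_meas: "\<xi> d \<in> borel_measurable (M d)" if d: "1 \<le> d" for d
    using R_meas[OF d] xi_def[OF d] by (simp add: measurable_cong[of "M d" "\<xi> d"])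
  (* nothing is assumed at d = 0, so the sequence of laws is completed there by its limit *)
  define \<nu> where "\<nu> d = (if 1 \<le> d then distr (M d) borel (\<xi> d) else F)" for d
  have nu_dist: "real_distribution (\<nu> d)" for d
    using F_dist prob_space.real_distribution_distr[OF prob xi_meas] by (simp add: \<nu>_def)
  have nu_conv: "weak_conv_m \<nu> F"
    unfolding weak_conv_m_def weak_conv_def
  proof (intro allI impI)
    fix x assume "isCont (cdf F) x"
    then have "(\<lambda>d. cdf (distr (M d) borel (\<xi> d)) x) \<longlonglongrightarrow> cdf F x"
      using xi_conv by (simp add: weak_conv_m_def weak_conv_def)
    then show "(\<lambda>d. cdf (\<nu> d) x) \<longlonglongrightarrow> cdf F x"
      by (rule tendsto_cong_from_1) (simp add: \<nu>_def)
  qed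
  obtain \<Omega> :: "real measure" and Y :: "nat \<Rightarrow> real \<Rightarrow> real" and Y\<^sub>0 :: "real \<Rightarrow> real"
    where coupling: "prob_space \<Omega> \<and> (\<forall>d. Y d \<in> measurable \<Omega> borel) \<and> (\<forall>d. distr \<Omega> borel (Y d) = \<nu> d) \<and>
      Y\<^sub>0 \<in> measurable \<Omega> lborel \<and> distr \<Omega> borel Y\<^sub>0 = F \<and> (\<forall>\<omega>\<in>space \<Omega>. (\<lambda>d. Y d \<omega>) \<longlonglongrightarrow> Y\<^sub>0 \<omega>)"
    using Skorohod[OF nu_dist F_dist nu_conv] by (elim exE)
  then have \<Omega>: "prob_space \<Omega>" and Y: "\<And>d. Y d \<in> borel_measurable \<Omega>" and Y_law: "\<And>d. distr \<Omega> borel (Y d) = \<nu> d"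
    and Y\<^sub>0: "Y\<^sub>0 \<in> borel_measurable \<Omega>" and Y\<^sub>0_law: "distr \<Omega> borel Y\<^sub>0 = F"
    and Y_lim: "\<And>\<omega>. \<omega> \<in> space \<Omega> \<Longrightarrow> (\<lambda>d. Y d \<omega>) \<longlonglongrightarrow> Y\<^sub>0 \<omega>"
    by auto
  have radius_law: "distr \<Omega> borel (\<lambda>\<omega>. radius d (Y d \<omega>)) = distr (M d) borel (R d)" if d: "1 \<le> d" for d
  proof -
    have m: "radius d \<in> borel_measurable borel" unfolding radius_def by measurable
    have "distr \<Omega> borel (\<lambda>\<omega>. radius d (Y d \<omega>)) = distr (distr \<Omega> borel (Y d)) borel (radius d)"
      using distr_distr[OF m Y[of d]] by (simp add: comp_def)
    also have "\<dots> = distr (M d) borel (\<lambda>\<omega>. radius d (\<xi> d \<omega>))"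
      using distr_distr[OF m xi_meas[OF d]] d by (simp add: comp_def Y_law \<nu>_def)
    also have "(\<lambda>\<omega>. radius d (\<xi> d \<omega>)) = R d"
      using eps_pos[OF d] by (simp add: radius_def xi_def[OF d] fun_eq_iff)
    finally show ?thesis .
  qed
  have radius_meas: "(\<lambda>\<omega>. radius d (Y d \<omega>)) \<in> borel_measurable \<Omega>" for d
    unfolding radius_def using Y[of d] by measurable
  have Y_pos: "AE \<omega> in \<Omega>. 0 < radius d (Y d \<omega>)" if d: "1 \<le> d" for d
  proof -
    have "AE r in distr (M d) borel (R d). 0 < r"
      using R_pos[OF d] R_meas[OF d] by (subst AE_distr_iff) auto
    then show ?thesis
      unfolding radius_law[OF d, symmetric] by (rule AE_distrD[OF radius_meas])
  qed
  have P_eq: "P d = polar_law \<Omega> d (Y d)" if d: "1 \<le> d" for d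
  proof -
    let ?H = "hyperboloid_borel d (\<kappa> d)" and ?BS = "borel \<Otimes>\<^sub>M sphere_borel d :: (real \<times> (nat \<Rightarrow> real)) measure"
    let ?\<Psi> = "\<lambda>p. hyp_polar d (\<kappa> d) (fst p) (snd p)"
    have \<Psi>: "?\<Psi> \<in> measurable ?BS ?H"
      by (rule measurable_hyp_polar[OF kappa_pos[OF d]]) measurable
    have RU: "(\<lambda>\<omega>. (R d \<omega>, U d \<omega>)) \<in> measurable (M d) ?BS"
      by (intro measurable_Pair R_meas U_meas d)
    have id_meas: "(\<lambda>u. u) \<in> measurable (uniform_sphere d) (sphere_borel d)"
      by (rule measurable_ident_sets) (rule sets_uniform_sphere)
    have id_law: "distr (uniform_sphere d) (sphere_borel d) (\<lambda>u. u) = uniform_sphere d"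
      by (rule distr_id2) (rule sets_uniform_sphere[symmetric])
    have YU: "(\<lambda>p. (radius d (Y d (fst p)), snd p)) \<in> measurable (\<Omega> \<Otimes>\<^sub>M uniform_sphere d) ?BS"
      by (intro measurable_Pair measurable_compose[OF measurable_fst radius_meas] measurable_compose[OF measurable_snd id_meas])
    have "P d = distr (distr (M d) ?BS (\<lambda>\<omega>. (R d \<omega>, U d \<omega>))) ?H ?\<Psi>"
      unfolding P_def[OF d] hyp_polar_law_def distr_distr[OF \<Psi> RU] by (simp add: comp_def)
    also have "distr (M d) ?BS (\<lambda>\<omega>. (R d \<omega>, U d \<omega>)) = distr \<Omega> borel (\<lambda>\<omega>. radius d (Y d \<omega>)) \<Otimes>\<^sub>M distr (uniform_sphere d) (sphere_borel d) (\<lambda>u. u)"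
      unfolding indep_rv_distr_pair[OF prob[OF d] indep[OF d]] U_unif[OF d] radius_law[OF d] id_law ..
    also have "\<dots> = distr (\<Omega> \<Otimes>\<^sub>M uniform_sphere d) ?BS (\<lambda>p. (radius d (Y d (fst p)), snd p))"
      using pair_measure_distr[OF radius_meas[of d] id_meas] prob_space_imp_sigma_finite[OF prob_space_uniform_sphere[OF d]]
      by (simp add: id_law split_beta')
    finally show ?thesis
      unfolding polar_law_def distr_distr[OF \<Psi> YU] by (simp add: comp_def)
  qed
  (* c is the factor by which the scores are rescaled *)
  have main: "(\<lambda>d. triplet_entropy (P d) (hyp_dist d (\<kappa> d))) \<longlonglongrightarrow> (\<integral>w. entropy3 (limit_prob \<mu> \<tau> w) \<partial>Pi\<^sub>M {1..3} (\<lambda>_. F))"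
    if c: "\<And>d. 1 \<le> d \<Longrightarrow> 0 < c d" "(\<lambda>d. c d * \<Lambda> d) \<longlonglongrightarrow> \<mu>" "c \<longlonglongrightarrow> \<tau>"
      and nondeg: "\<tau> = 1 \<or> \<tau> = 0 \<and> \<mu> \<noteq> 0 \<and> continuous_on UNIV (cdf F)" for c \<mu> \<tau>
  proof -
    have c_mu: "(\<lambda>d. c d * (sqrt d * b d)) \<longlonglongrightarrow> \<mu>"
      using c(2) by (rule tendsto_cong_from_1) (simp add: Lambda_def)
    have "(\<lambda>d. triplet_entropy (polar_law \<Omega> d (Y d)) (hyp_dist d (\<kappa> d))) \<longlonglongrightarrow> (\<integral>w. entropy3 (limit_prob \<mu> \<tau> w) \<partial>Pi\<^sub>M {1..3} (\<lambda>_. F))"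
      by (rule triplet_entropy_tendsto[OF \<Omega> Y Y\<^sub>0 Y_lim Y_pos Y\<^sub>0_law[symmetric] c(1) c_mu c(3) nondeg])
    then show ?thesis
      by (rule tendsto_cong_from_1) (simp add: P_eq)
  qed
  interpret PF: prob_space "Pi\<^sub>M {1..3::nat} (\<lambda>_. F)"
    using F_dist by (intro prob_space_PiM) (simp add: real_distribution_def)
  have finite_limit: "(\<lambda>d. triplet_entropy (P d) (hyp_dist d (\<kappa> d))) \<longlonglongrightarrow> (\<integral>w. entropy3 (limit_prob l 1 w) \<partial>Pi\<^sub>M {1..3} (\<lambda>_. F))"
    if "\<Lambda> \<longlonglongrightarrow> l" for l
    by (rule main[of "\<lambda>_. 1"]) (use that in auto)
  have "(\<lambda>d. triplet_entropy (P d) (hyp_dist d (\<kappa> d))) \<longlonglongrightarrow> ln 3" if "\<Lambda> \<longlonglongrightarrow> 0"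
    using finite_limit[OF that] by (simp add: entropy3_pure_noise PF.prob_space)
  moreover have "(\<lambda>d. triplet_entropy (P d) (hyp_dist d (\<kappa> d))) \<longlonglongrightarrow> master_entropy l F" if "\<Lambda> \<longlonglongrightarrow> l" for l
  proof -
    have "limit_prob l 1 w = master_prob l w" for w by (rule ext) (rule limit_prob_eq_master_prob)
    then show ?thesis using finite_limit[OF that] by (simp add: master_entropy_def)
  qed
  moreover have "(\<lambda>d. triplet_entropy (P d) (hyp_dist d (\<kappa> d))) \<longlonglongrightarrow> 0"
    if lim: "filterlim \<Lambda> at_top sequentially" and cont: "continuous_on UNIV (cdf F)"
  proof -
    have L_pos: "0 < \<Lambda> d" if "1 \<le> d" for d using b_pos[OF that] that by (simp add: Lambda_def)
    have "(\<lambda>d. triplet_entropy (P d) (hyp_dist d (\<kappa> d))) \<longlonglongrightarrow> (\<integral>w. entropy3 (limit_prob 1 0 w) \<partial>Pi\<^sub>M {1..3} (\<lambda>_. F))"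
    proof (rule main[of "\<lambda>d. 1 / \<Lambda> d"])
      show "(\<lambda>d. 1 / \<Lambda> d * \<Lambda> d) \<longlonglongrightarrow> 1"
        by (rule tendsto_eventually, rule eventually_mono[OF eventually_ge_at_top[of 1]]) (use L_pos in \<open>force\<close>)
      show "(\<lambda>d. 1 / \<Lambda> d) \<longlonglongrightarrow> 0"
        by (intro tendsto_divide_0[OF tendsto_const] filterlim_at_top_imp_at_infinity lim)
    qed (use L_pos cont in auto)
    then show ?thesis by (simp add: entropy3_noiseless)
  qed
  ultimately show ?thesis by blast
qed

end
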